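(* Let $F$ be a field of characteristic zero, $G$ a linearly reductive subgroup of $GL_n(F)$, and $A=End_G(F^n)\subseteq M_n(F)$ its centralizer. If $R$ is an $A$-algebra with trace satisfying all $A$-trace identities (pure and mixed) of $M_n(F)$, then there exist a commutative $F$-algebra $C$ and an injective homomorphism $R\hookrightarrow M_n(C)$ that preserves both the trace and the $A$-action (where $A$ acts on $M_n(C)$ via $A\subseteq M_n(F)\subseteq M_n(C)$ and $M_n(C)$ carries the usual trace).
   Context: An $A$-algebra with trace is a unital associative $F$-algebra $R$ with a unital homomorphism $A\to R$ and an $F$-linear map $tr:R\to R$ with central values satisfying $tr(rs)=tr(sr)$ and $tr(tr(r)s)=tr(r)tr(s)$. $A$-trace identities of $M_n(F)$ are $A$-trace polynomials (formal expressions built from variables, elements of $A$, products and a formal trace) vanishing under all substitutions of matrices for the variables; $R$ satisfies such an identity if it vanishes under all substitutions of elements of $R$, with elements of $A$ mapped via $A\to R$. *)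

theory Defs
  imports Main "HOL-Algebra.Ring" "HOL-Library.Multiset" "HOL-Combinatorics.Permutations"
begin

type_synonym ('n, 'f) fmat = "'n \<Rightarrow> 'n \<Rightarrow> 'f"

definition madd :: "('n, 'f::comm_ring_1) fmat \<Rightarrow> ('n, 'f) fmat \<Rightarrow> ('n, 'f) fmat" where
  "madd X Y = (\<lambda>i j. X i j + Y i j)"

definition mmul :: "('n::finite, 'f::comm_ring_1) fmat \<Rightarrow> ('n, 'f) fmat \<Rightarrow> ('n, 'f) fmat" where
  "mmul X Y = (\<lambda>i j. \<Sum>k\<in>UNIV. X i k * Y k j)"

definition mone :: "('n, 'f::comm_ring_1) fmat" where
  "mone = (\<lambda>i j. if i = j then 1 else 0)"

definition mzero :: "('n, 'f::comm_ring_1) fmat" where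
  "mzero = (\<lambda>i j. 0)"

definition msc :: "'f::comm_ring_1 \<Rightarrow> ('n, 'f) fmat \<Rightarrow> ('n, 'f) fmat" where
  "msc c X = (\<lambda>i j. c * X i j)"

definition mtrace :: "('n::finite, 'f::comm_ring_1) fmat \<Rightarrow> 'f" where
  "mtrace X = (\<Sum>i\<in>UNIV. X i i)"

text \<open>The trace on M_n(F) as an algebra with trace: tr(X) = trace(X) * I.\<close>
definition mtr :: "('n::finite, 'f::comm_ring_1) fmat \<Rightarrow> ('n, 'f) fmat" where
  "mtr X = msc (mtrace X) mone"

definition mdet :: "('n::finite, 'f::comm_ring_1) fmat \<Rightarrow> 'f" where
  "mdet X = (\<Sum>p | p permutes (UNIV::'n set). of_int (sign p) * (\<Prod>i\<in>UNIV. X i (p i)))"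

definition GL :: "('n::finite, 'f::comm_ring_1) fmat set" where
  "GL = {X. \<exists>Y. mmul X Y = mone \<and> mmul Y X = mone}"

inductive_set polyfun :: "(('n::finite, 'f::comm_ring_1) fmat \<Rightarrow> 'f) set" where
  pf_const: "(\<lambda>X. c) \<in> polyfun"
| pf_coord: "(\<lambda>X. X i j) \<in> polyfun"
| pf_add: "p \<in> polyfun \<Longrightarrow> q \<in> polyfun \<Longrightarrow> (\<lambda>X. p X + q X) \<in> polyfun"
| pf_mul: "p \<in> polyfun \<Longrightarrow> q \<in> polyfun \<Longrightarrow> (\<lambda>X. p X * q X) \<in> polyfun"

definition algebraic_subgroup :: "('n::finite, 'f::field) fmat set \<Rightarrow> bool" where
  "algebraic_subgroup G \<longleftrightarrow>
     G \<subseteq> GL \<and> mone \<in> G \<and>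
     (\<forall>g\<in>G. \<forall>h\<in>G. mmul g h \<in> G) \<and>
     (\<forall>g\<in>G. \<forall>h. mmul g h = mone \<longrightarrow> h \<in> G) \<and>
     (\<exists>S \<subseteq> polyfun. G = {X \<in> GL. \<forall>f\<in>S. f X = 0})"

definition regular_on :: "('n::finite, 'f::field) fmat set \<Rightarrow> (('n, 'f) fmat \<Rightarrow> 'f) \<Rightarrow> bool" where
  "regular_on G f \<longleftrightarrow> (\<exists>p \<in> polyfun. \<exists>k::nat. \<forall>g\<in>G. f g = p g / mdet g ^ k)"

text \<open>m x m matrices / vectors over F with m varying: functions on nat, indices < m.\<close>
definition nmul :: "nat \<Rightarrow> (nat \<Rightarrow> nat \<Rightarrow> 'f::comm_ring_1) \<Rightarrow> (nat \<Rightarrow> nat \<Rightarrow> 'f) \<Rightarrow> (nat \<Rightarrow> nat \<Rightarrow> 'f)" where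
  "nmul m X Y = (\<lambda>i j. \<Sum>k<m. X i k * Y k j)"

definition napply :: "nat \<Rightarrow> (nat \<Rightarrow> nat \<Rightarrow> 'f::comm_ring_1) \<Rightarrow> (nat \<Rightarrow> 'f) \<Rightarrow> (nat \<Rightarrow> 'f)" where
  "napply m X v = (\<lambda>i. if i < m then (\<Sum>k<m. X i k * v k) else 0)"

definition Fvec :: "nat \<Rightarrow> (nat \<Rightarrow> 'f::comm_ring_1) set" where
  "Fvec m = {v. \<forall>i\<ge>m. v i = 0}"

definition subspace_of :: "nat \<Rightarrow> (nat \<Rightarrow> 'f::field) set \<Rightarrow> bool" where
  "subspace_of m W \<longleftrightarrow> W \<subseteq> Fvec m \<and> (\<lambda>i. 0) \<in> W \<and>
     (\<forall>v\<in>W. \<forall>w\<in>W. (\<lambda>i. v i + w i) \<in> W) \<and> (\<forall>c. \<forall>v\<in>W. (\<lambda>i. c * v i) \<in> W)"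

definition rational_rep :: "('n::finite, 'f::field) fmat set \<Rightarrow> nat \<Rightarrow> (('n, 'f) fmat \<Rightarrow> nat \<Rightarrow> nat \<Rightarrow> 'f) \<Rightarrow> bool" where
  "rational_rep G m \<rho> \<longleftrightarrow>
     (\<forall>i<m. \<forall>j<m. \<rho> mone i j = (if i = j then 1 else 0)) \<and>
     (\<forall>g\<in>G. \<forall>h\<in>G. \<forall>i<m. \<forall>j<m. \<rho> (mmul g h) i j = nmul m (\<rho> g) (\<rho> h) i j) \<and>
     (\<forall>i<m. \<forall>j<m. regular_on G (\<lambda>g. \<rho> g i j))"

definition invariant_subspace :: "('n::finite, 'f::field) fmat set \<Rightarrow> nat \<Rightarrow> (('n, 'f) fmat \<Rightarrow> nat \<Rightarrow> nat \<Rightarrow> 'f) \<Rightarrow> (nat \<Rightarrow> 'f) set \<Rightarrow> bool" where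
  "invariant_subspace G m \<rho> W \<longleftrightarrow> subspace_of m W \<and> (\<forall>g\<in>G. \<forall>v\<in>W. napply m (\<rho> g) v \<in> W)"

definition completely_reducible :: "('n::finite, 'f::field) fmat set \<Rightarrow> nat \<Rightarrow> (('n, 'f) fmat \<Rightarrow> nat \<Rightarrow> nat \<Rightarrow> 'f) \<Rightarrow> bool" where
  "completely_reducible G m \<rho> \<longleftrightarrow>
     (\<forall>W. invariant_subspace G m \<rho> W \<longrightarrow>
        (\<exists>W'. invariant_subspace G m \<rho> W' \<and> W \<inter> W' = {\<lambda>i. 0} \<and>
              (\<forall>u\<in>Fvec m. \<exists>v\<in>W. \<exists>w\<in>W'. u = (\<lambda>i. v i + w i))))"

definition linearly_reductive :: "('n::finite, 'f::field) fmat set \<Rightarrow> bool" where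
  "linearly_reductive G \<longleftrightarrow> algebraic_subgroup G \<and>
     (\<forall>m \<rho>. rational_rep G m \<rho> \<longrightarrow> completely_reducible G m \<rho>)"

definition centralizer :: "('n::finite, 'f::comm_ring_1) fmat set \<Rightarrow> ('n, 'f) fmat set" where
  "centralizer G = {a. \<forall>g\<in>G. mmul a g = mmul g a}"

datatype ('f, 'm) tpoly =
    TVar nat
  | TElem 'm
  | TSc 'f
  | TAdd "('f, 'm) tpoly" "('f, 'm) tpoly"
  | TMul "('f, 'm) tpoly" "('f, 'm) tpoly"
  | TTr "('f, 'm) tpoly"

fun tconsts :: "('f, 'm) tpoly \<Rightarrow> 'm set" where
  "tconsts (TVar i) = {}"
| "tconsts (TElem a) = {a}"
| "tconsts (TSc c) = {}"
| "tconsts (TAdd p q) = tconsts p \<union> tconsts q"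
| "tconsts (TMul p q) = tconsts p \<union> tconsts q"
| "tconsts (TTr p) = tconsts p"

fun teval :: "('x \<Rightarrow> 'x \<Rightarrow> 'x) \<Rightarrow> ('x \<Rightarrow> 'x \<Rightarrow> 'x) \<Rightarrow> ('f \<Rightarrow> 'x) \<Rightarrow> ('m \<Rightarrow> 'x)
      \<Rightarrow> ('x \<Rightarrow> 'x) \<Rightarrow> (nat \<Rightarrow> 'x) \<Rightarrow> ('f, 'm) tpoly \<Rightarrow> 'x" where
  "teval ad mu sc el tr \<sigma> (TVar i) = \<sigma> i"
| "teval ad mu sc el tr \<sigma> (TElem a) = el a"
| "teval ad mu sc el tr \<sigma> (TSc c) = sc c"
| "teval ad mu sc el tr \<sigma> (TAdd p q) = ad (teval ad mu sc el tr \<sigma> p) (teval ad mu sc el tr \<sigma> q)"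
| "teval ad mu sc el tr \<sigma> (TMul p q) = mu (teval ad mu sc el tr \<sigma> p) (teval ad mu sc el tr \<sigma> q)"
| "teval ad mu sc el tr \<sigma> (TTr p) = tr (teval ad mu sc el tr \<sigma> p)"

definition Mn_trace_identity :: "('n::finite, 'f::field) fmat set \<Rightarrow> ('f, ('n, 'f) fmat) tpoly \<Rightarrow> bool" where
  "Mn_trace_identity A p \<longleftrightarrow> tconsts p \<subseteq> A \<and>
     (\<forall>\<sigma>. teval madd mmul (\<lambda>c. msc c mone) id mtr \<sigma> p = mzero)"

text \<open>R is a ring_1 type; beta : F -> R is the (central) F-algebra structure, alpha : A -> R
  the structure homomorphism (only its values on A matter), tr the trace.\<close>
definition A_algebra_with_trace ::
  "('n::finite, 'f::field) fmat set \<Rightarrow> ('f \<Rightarrow> 'r::ring_1) \<Rightarrow> (('n, 'f) fmat \<Rightarrow> 'r) \<Rightarrow> ('r \<Rightarrow> 'r) \<Rightarrow> bool" where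
  "A_algebra_with_trace A \<beta> \<alpha> tr \<longleftrightarrow>
     \<comment> \<open>unital associative F-algebra\<close>
     \<beta> 1 = 1 \<and> (\<forall>a b. \<beta> (a + b) = \<beta> a + \<beta> b) \<and> (\<forall>a b. \<beta> (a * b) = \<beta> a * \<beta> b) \<and>
     (\<forall>c x. \<beta> c * x = x * \<beta> c) \<and>
     \<comment> \<open>unital F-algebra homomorphism A -> R\<close>
     \<alpha> mone = 1 \<and>
     (\<forall>a\<in>A. \<forall>b\<in>A. \<alpha> (madd a b) = \<alpha> a + \<alpha> b) \<and>
     (\<forall>a\<in>A. \<forall>b\<in>A. \<alpha> (mmul a b) = \<alpha> a * \<alpha> b) \<and>
     (\<forall>c. \<forall>a\<in>A. \<alpha> (msc c a) = \<beta> c * \<alpha> a) \<and>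
     \<comment> \<open>F-linear trace with central values\<close>
     (\<forall>x y. tr (x + y) = tr x + tr y) \<and> (\<forall>c x. tr (\<beta> c * x) = \<beta> c * tr x) \<and>
     (\<forall>x y. tr x * y = y * tr x) \<and>
     (\<forall>x y. tr (x * y) = tr (y * x)) \<and>
     (\<forall>x y. tr (tr x * y) = tr x * tr y)"

definition satisfies_identity ::
  "('f \<Rightarrow> 'r::ring_1) \<Rightarrow> ('m \<Rightarrow> 'r) \<Rightarrow> ('r \<Rightarrow> 'r) \<Rightarrow> ('f, 'm) tpoly \<Rightarrow> bool" where
  "satisfies_identity \<beta> \<alpha> tr p \<longleftrightarrow> (\<forall>\<sigma>. teval (+) (*) \<beta> \<alpha> tr \<sigma> p = 0)"

definition comm_F_algebra :: "'u ring \<Rightarrow> ('f::field \<Rightarrow> 'u) \<Rightarrow> bool" where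
  "comm_F_algebra C \<iota> \<longleftrightarrow> cring C \<and> (\<forall>c. \<iota> c \<in> carrier C) \<and>
     \<iota> 1 = \<one>\<^bsub>C\<^esub> \<and> (\<forall>a b. \<iota> (a + b) = \<iota> a \<oplus>\<^bsub>C\<^esub> \<iota> b) \<and> (\<forall>a b. \<iota> (a * b) = \<iota> a \<otimes>\<^bsub>C\<^esub> \<iota> b)"

definition cmat_carrier :: "'u ring \<Rightarrow> ('n \<Rightarrow> 'n \<Rightarrow> 'u) set" where
  "cmat_carrier C = {X. \<forall>i j. X i j \<in> carrier C}"

definition cmadd :: "'u ring \<Rightarrow> ('n \<Rightarrow> 'n \<Rightarrow> 'u) \<Rightarrow> ('n \<Rightarrow> 'n \<Rightarrow> 'u) \<Rightarrow> ('n \<Rightarrow> 'n \<Rightarrow> 'u)" where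
  "cmadd C X Y = (\<lambda>i j. X i j \<oplus>\<^bsub>C\<^esub> Y i j)"

definition cmmul :: "'u ring \<Rightarrow> ('n::finite \<Rightarrow> 'n \<Rightarrow> 'u) \<Rightarrow> ('n \<Rightarrow> 'n \<Rightarrow> 'u) \<Rightarrow> ('n \<Rightarrow> 'n \<Rightarrow> 'u)" where
  "cmmul C X Y = (\<lambda>i j. finsum C (\<lambda>k. X i k \<otimes>\<^bsub>C\<^esub> Y k j) UNIV)"

definition cmscalar :: "'u ring \<Rightarrow> 'u \<Rightarrow> ('n \<Rightarrow> 'n \<Rightarrow> 'u)" where
  "cmscalar C c = (\<lambda>i j. if i = j then c else \<zero>\<^bsub>C\<^esub>)"

definition cmtrace :: "'u ring \<Rightarrow> ('n::finite \<Rightarrow> 'n \<Rightarrow> 'u) \<Rightarrow> 'u" where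
  "cmtrace C X = finsum C (\<lambda>i. X i i) UNIV"

definition cmof :: "('f \<Rightarrow> 'u) \<Rightarrow> ('n, 'f) fmat \<Rightarrow> ('n \<Rightarrow> 'n \<Rightarrow> 'u)" where
  "cmof \<iota> a = (\<lambda>i j. \<iota> (a i j))"

end

theory Submission
  imports Defs Complex_Main "HOL-Library.Function_Algebras" "HOL-Library.FuncSet" "HOL-Library.Poly_Mapping"
begin

text \<open>
  The centralizer \<open>A\<close> of \<open>G\<close> is von Neumann regular, because kernels and images of its elements have
  invariant complements; in characteristic zero it is therefore separable. Averaging over a
  separability idempotent in every tensor slot and over the symmetric group shows that the span
  \<open>calA k\<close> of \<open>A\<^sup>\<otimes>\<^sup>k\<close> and the permutations in \<open>End (V\<^sup>\<otimes>\<^sup>k)\<close> is von Neumann regular as well. Idempotents of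
  trace zero vanish, so the trace form on \<open>calA k\<close> is nondegenerate, and the orthogonal projection
  \<open>End (V\<^sup>\<otimes>\<^sup>k) \<rightarrow> calA k\<close> replaces the Reynolds operator. It commutes with partial traces, with tensoring
  by \<open>1\<close> and with permutations, by uniqueness alone; neither a first fundamental theorem nor a double
  centralizer theorem is needed.

  The elements of \<open>calA (k + 1)\<close> are \<open>k\<close>-linear mixed \<open>A\<close>-trace polynomial functions, and
  their values in \<open>R\<close> are well defined since \<open>R\<close> satisfies the identities of \<open>M\<^sub>n(F)\<close>. Projecting and
  evaluating gives linear functionals from the polynomial ring in the entries of the generic
  matrices \<open>\<xi>\<^sub>r\<close>, \<open>r \<in> R\<close>, to \<open>R\<close>. The ring \<open>C\<close> is the quotient by the largest ideal on which they
  vanish: this ideal contains all relations that make \<open>r \<mapsto> \<xi>\<^sub>r\<close> a homomorphism of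
  \<open>A\<close>-algebras with trace, and \<open>r\<close> is recovered from the values on the entries of \<open>\<xi>\<^sub>r\<close>.
\<close>

section \<open>Linear algebra over a field\<close>

text \<open>Of \<open>G\<close> only the invariant complements in \<open>F^n\<close> are used, and
  \<open>F\<close> need not be algebraically closed, so every projection is manufactured from a
  trace form instead of an integral or a decomposition into matrix rings. A mixed polynomial in k
  variables is stored as a multilinear form in k + 1 slots; the additional slot 0 is paired with
  matrix units to read off entries. This is why the indices read \<open>Suc k\<close> and why
  permutations of variables must fix 0. The functional attached to (a, b) takes a polynomial f in
  the generic entries to the value in \<open>R\<close> of the projection of f times the matrix unit
  (a, b). With the ideal generated by the relations, injectivity would require a proof that the
  functionals vanish on all its elements. For the largest ideal in their common kernel, each
  relation is a rule for their values on monomials, and injectivity is read off because they descend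
  to \<open>C\<close> as additive maps.\<close>

definition lin_on :: "('f::field \<Rightarrow> 'a::ab_group_add \<Rightarrow> 'a) \<Rightarrow> ('f \<Rightarrow> 'b::ab_group_add \<Rightarrow> 'b) \<Rightarrow> 'a set \<Rightarrow> ('a \<Rightarrow> 'b) \<Rightarrow> bool"
  where "lin_on s t W f \<longleftrightarrow>
    (\<forall>x\<in>W. \<forall>y\<in>W. f (x + y) = f x + f y) \<and> (\<forall>c. \<forall>x\<in>W. f (s c x) = t c (f x))"

lemma lin_onI:
  assumes "\<And>x y. x \<in> W \<Longrightarrow> y \<in> W \<Longrightarrow> f (x + y) = f x + f y"
    and "\<And>c x. x \<in> W \<Longrightarrow> f (s c x) = t c (f x)"
  shows "lin_on s t W f"
  using assms by (auto simp: lin_on_def)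

lemma lin_on_add: "lin_on s t W f \<Longrightarrow> x \<in> W \<Longrightarrow> y \<in> W \<Longrightarrow> f (x + y) = f x + f y"
  and lin_on_scale: "lin_on s t W f \<Longrightarrow> x \<in> W \<Longrightarrow> f (s c x) = t c (f x)"
  by (auto simp: lin_on_def)

lemma lin_on_mono: "lin_on s t W f \<Longrightarrow> V \<subseteq> W \<Longrightarrow> lin_on s t V f"
  unfolding lin_on_def by blast

context vector_space
begin

lemma lin_on_zero: "lin_on scale t W f \<Longrightarrow> subspace W \<Longrightarrow> f 0 = 0"
  using lin_on_add[of scale t W f 0 0] by (auto simp: subspace_0)

lemma lin_on_diff:
  assumes "lin_on scale t W f" "subspace W" "x \<in> W" "y \<in> W"
  shows "f (x - y) = f x - f y"
  using lin_on_add[OF assms(1), of "x - y" y] assms by (simp add: subspace_diff)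

lemma lin_on_sum:
  assumes f: "lin_on scale t W f" and W: "subspace W" and u: "\<And>i. i \<in> Q \<Longrightarrow> u i \<in> W"
  shows "f (\<Sum>i\<in>Q. u i) = (\<Sum>i\<in>Q. f (u i))"
  using u
proof (induction Q rule: infinite_finite_induct)
  case (insert i Q)
  then have "(\<Sum>i\<in>Q. u i) \<in> W" by (intro subspace_sum[OF W]) auto
  with insert show ?case by (simp add: lin_on_add[OF f])
qed (use lin_on_zero[OF f W] in auto)

lemma lin_on_sum_scale:
  assumes f: "lin_on scale t W f" and W: "subspace W" and u: "\<And>i. i \<in> Q \<Longrightarrow> u i \<in> W"
  shows "f (\<Sum>i\<in>Q. scale (c i) (u i)) = (\<Sum>i\<in>Q. t (c i) (f (u i)))"
  using u by (subst lin_on_sum[OF f W]) (auto intro!: sum.cong simp: subspace_scale[OF W] lin_on_scale[OF f])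

lemma finite_coordinates:
  assumes W: "subspace W" and T: "finite T" "W \<subseteq> span T"
  obtains B c where "finite B" "B \<subseteq> W"
    "\<And>b. lin_on scale (*) W (c b)"
    "\<And>x. x \<in> W \<Longrightarrow> (\<Sum>b\<in>B. scale (c b x) b) = x"
    "\<And>b b'. b \<in> B \<Longrightarrow> b' \<in> B \<Longrightarrow> c b b' = (if b = b' then 1 else 0)"
proof -
  obtain B where B: "B \<subseteq> W" "independent B" "W \<subseteq> span B"
    using basis_exists[of W] by metis
  have fin: "finite B" using independent_span_bound[OF T(1) B(2)] B(1) T(2) by blast
  show ?thesis
  proof (rule that[of B "\<lambda>b x. representation B x b"])
    show "lin_on scale (*) W (\<lambda>x. representation B x b)" for b
      using B by (intro lin_onI) (auto simp: representation_add representation_scale subset_iff)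
    show "(\<Sum>b\<in>B. scale (representation B x b) b) = x" if "x \<in> W" for x
      using sum_representation_eq[OF B(2), of x B] that B fin by auto
    show "representation B b' b = (if b = b' then 1 else 0)" if "b \<in> B" "b' \<in> B" for b b'
      using representation_basis[OF B(2) that(2)] by auto
  qed (use fin B in auto)
qed

text \<open>Induction on the number of functionals: on the kernel of \<open>l i\<close> the
  remaining ones suffice, and the error \<open>n\<close> of the resulting combination vanishes on
  that kernel, hence is a multiple of \<open>l i\<close>.\<close>

lemma functional_in_span:
  assumes "finite Q" "subspace W" "\<And>i. i \<in> Q \<Longrightarrow> lin_on scale (*) W (l i)" "lin_on scale (*) W m"
    and "\<And>x. x \<in> W \<Longrightarrow> (\<And>i. i \<in> Q \<Longrightarrow> l i x = 0) \<Longrightarrow> m x = 0"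
  shows "\<exists>c. \<forall>x\<in>W. m x = (\<Sum>i\<in>Q. c i * l i x)"
  using assms
proof (induction Q arbitrary: W rule: finite_induct)
  case empty
  then show ?case by auto
next
  case (insert i Q)
  note W = insert.prems(1) and li = insert.prems(2)[of i, simplified]
  define W' where "W' = {x\<in>W. l i x = 0}"
  have W': "subspace W'"
    using W by (auto simp: W'_def subspace_def lin_on_zero[OF li W] lin_on_add[OF li] lin_on_scale[OF li])
  have sub: "W' \<subseteq> W" by (auto simp: W'_def)
  have "\<exists>c. \<forall>x\<in>W'. m x = (\<Sum>j\<in>Q. c j * l j x)"
    by (rule insert.IH[OF W']) (use insert.prems sub in \<open>auto simp: W'_def intro: lin_on_mono\<close>)
  then obtain c where c: "\<And>x. x \<in> W' \<Longrightarrow> m x = (\<Sum>j\<in>Q. c j * l j x)" by blast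
  define n where "n = (\<lambda>x. m x - (\<Sum>j\<in>Q. c j * l j x))"
  have lj: "lin_on scale (*) W (l j)" if "j \<in> Q" for j using insert.prems(2) that by simp
  note m = insert.prems(3)
  have n_lin: "lin_on scale (*) W n"
  proof (rule lin_onI)
    fix x y assume xy: "x \<in> W" "y \<in> W"
    have "(\<Sum>j\<in>Q. c j * l j (x + y)) = (\<Sum>j\<in>Q. c j * l j x) + (\<Sum>j\<in>Q. c j * l j y)"
      unfolding sum.distrib[symmetric] using lin_on_add[OF lj xy]
      by (intro sum.cong) (auto simp: algebra_simps)
    then show "n (x + y) = n x + n y"
      unfolding n_def lin_on_add[OF m xy] by simp
  next
    fix k x assume x: "x \<in> W"
    have "(\<Sum>j\<in>Q. c j * l j (scale k x)) = k * (\<Sum>j\<in>Q. c j * l j x)"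
      unfolding sum_distrib_left using lin_on_scale[OF lj x]
      by (intro sum.cong) auto
    then show "n (scale k x) = k * n x"
      unfolding n_def lin_on_scale[OF m x] by (simp add: right_diff_distrib)
  qed
  show ?case
  proof (cases "\<exists>x0\<in>W. l i x0 \<noteq> 0")
    case False
    then have "W' = W" by (auto simp: W'_def)
    then show ?thesis using c insert.hyps
      by (intro exI[of _ "c(i := 0)"]) (auto intro!: sum.cong)
  next
    case True
    then obtain x0 where x0: "x0 \<in> W" "l i x0 \<noteq> 0" by blast
    have "m x = (\<Sum>j\<in>insert i Q. (c(i := n x0 / l i x0)) j * l j x)" if x: "x \<in> W" for x
    proof -
      define y where "y = x - scale (l i x / l i x0) x0"
      have "y \<in> W'"
        using x x0 by (auto simp: W'_def y_def subspace_diff[OF W] subspace_scale[OF W]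
            lin_on_diff[OF li W] lin_on_scale[OF li])
      then have "n y = 0" using c by (simp add: n_def)
      then have "n x = l i x / l i x0 * n x0"
        using x x0 by (simp add: y_def lin_on_diff[OF n_lin W] subspace_scale[OF W] lin_on_scale[OF n_lin])
      then have "m x = (\<Sum>j\<in>Q. c j * l j x) + n x0 / l i x0 * l i x"
        by (simp add: n_def field_simps)
      moreover have "(\<Sum>j\<in>insert i Q. (c(i := n x0 / l i x0)) j * l j x)
          = n x0 / l i x0 * l i x + (\<Sum>j\<in>Q. c j * l j x)"
        using insert.hyps by (subst sum.insert) (auto intro!: sum.cong)
      ultimately show ?thesis by simp
    qed
    then show ?thesis by blast
  qed
qed

text \<open>Nondegeneracy says that the functionals \<open>Bf b\<close>, with \<open>b\<close> in a
  finite basis, have no common zero except 0, so they span the dual space; linearity in the first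
  argument collects the coefficients into one vector.\<close>

lemma nondegenerate_represents_functional:
  assumes W: "subspace W" and T: "finite T" "W \<subseteq> span T"
    and lin1: "\<And>z. z \<in> W \<Longrightarrow> lin_on scale (*) W (\<lambda>w. Bf w z)"
    and lin2: "\<And>w. w \<in> W \<Longrightarrow> lin_on scale (*) W (Bf w)"
    and nd: "\<And>z. z \<in> W \<Longrightarrow> (\<And>w. w \<in> W \<Longrightarrow> Bf w z = 0) \<Longrightarrow> z = 0"
    and m: "lin_on scale (*) W m"
  shows "\<exists>w\<in>W. \<forall>z\<in>W. Bf w z = m z"
proof -
  obtain B c where B: "finite B" "B \<subseteq> W" and x: "\<And>x. x \<in> W \<Longrightarrow> (\<Sum>b\<in>B. scale (c b x) b) = x"
    by (rule finite_coordinates[OF W T]) blast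
  have "m z = 0" if z: "z \<in> W" and 0: "\<And>b. b \<in> B \<Longrightarrow> Bf b z = 0" for z
  proof -
    have "Bf w z = 0" if "w \<in> W" for w
      using lin_on_sum_scale[OF lin1[OF z] W, of B "\<lambda>b. b" "\<lambda>b. c b w"] B 0 x[OF that] by auto
    then have "z = 0" using nd z by blast
    then show ?thesis using lin_on_zero[OF m W] by simp
  qed
  then obtain d where d: "\<And>z. z \<in> W \<Longrightarrow> m z = (\<Sum>b\<in>B. d b * Bf b z)"
    using functional_in_span[OF B(1) W _ m, of Bf] lin2 B(2) by (metis subsetD)
  have "Bf (\<Sum>b\<in>B. scale (d b) b) z = m z" if "z \<in> W" for z
    using lin_on_sum_scale[OF lin1[OF that] W, of B "\<lambda>b. b" d] B d[OF that] by auto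
  moreover have "(\<Sum>b\<in>B. scale (d b) b) \<in> W"
    using B by (intro subspace_sum[OF W] subspace_scale[OF W]) auto
  ultimately show ?thesis by blast
qed

end

text \<open>The trace of an idempotent is its rank, computed in a basis of its image.\<close>
lemma idempotent_trace_zero:
  fixes scale :: "'f::field_char_0 \<Rightarrow> 'b::ab_group_add \<Rightarrow> 'b"
  assumes "vector_space scale" and W: "module.subspace scale W" and Q: "finite Q"
    and u: "\<And>i. i \<in> Q \<Longrightarrow> u i \<in> W"
    and c_lin: "\<And>i. i \<in> Q \<Longrightarrow> lin_on scale (*) W (c i)"
    and c: "\<And>x. x \<in> W \<Longrightarrow> (\<Sum>i\<in>Q. scale (c i x) (u i)) = x"
    and f_lin: "lin_on scale scale W f" and fW: "\<And>x. x \<in> W \<Longrightarrow> f x \<in> W"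
    and idem: "\<And>x. x \<in> W \<Longrightarrow> f (f x) = f x"
    and tr0: "(\<Sum>i\<in>Q. c i (f (u i))) = 0"
    and x: "x \<in> W"
  shows "f x = 0"
proof -
  interpret vector_space scale by fact
  define V where "V = f ` W"
  have VW: "V \<subseteq> W" using fW by (auto simp: V_def)
  have fV: "f y = y" if "y \<in> V" for y using that idem by (auto simp: V_def)
  have V: "subspace V"
    unfolding subspace_def V_def
  proof (intro conjI ballI allI; clarsimp?)
    show "0 \<in> f ` W"
      using lin_on_zero[OF f_lin W] subspace_0[OF W] by (metis imageI)
    show "f a + f b \<in> f ` W" if "a \<in> W" "b \<in> W" for a b
      using lin_on_add[OF f_lin that] subspace_add[OF W that] by (metis imageI)
    show "scale k (f a) \<in> f ` W" if "a \<in> W" for a k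
      using lin_on_scale[OF f_lin that] subspace_scale[OF W that] by (metis imageI)
  qed
  have "y \<in> span (u ` Q)" if y: "y \<in> V" for y
  proof -
    have "y \<in> W" using y VW by blast
    have "(\<Sum>i\<in>Q. scale (c i y) (u i)) \<in> span (u ` Q)"
      by (intro span_sum span_scale span_base imageI)
    then show ?thesis using c[OF \<open>y \<in> W\<close>] by simp
  qed
  then have "V \<subseteq> span (u ` Q)" by blast
  obtain D d where D: "finite D" "D \<subseteq> V" and d_lin: "\<And>b. lin_on scale (*) V (d b)"
    and d: "\<And>x. x \<in> V \<Longrightarrow> (\<Sum>b\<in>D. scale (d b x) b) = x"
    and dD: "\<And>b b'. b \<in> D \<Longrightarrow> b' \<in> D \<Longrightarrow> d b b' = (if b = b' then 1 else 0)"
    by (rule finite_coordinates[OF V finite_imageI[OF Q] \<open>V \<subseteq> span (u ` Q)\<close>]) blast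
  have df_lin: "lin_on scale (*) W (\<lambda>x. d b (f x))" for b
  proof (rule lin_onI)
    show "d b (f (x + y)) = d b (f x) + d b (f y)" if "x \<in> W" "y \<in> W" for x y
      unfolding lin_on_add[OF f_lin that] by (rule lin_on_add[OF d_lin]) (use that in \<open>auto simp: V_def\<close>)
    show "d b (f (scale k x)) = k * d b (f x)" if "x \<in> W" for k x
      unfolding lin_on_scale[OF f_lin that] by (rule lin_on_scale[OF d_lin]) (use that in \<open>auto simp: V_def\<close>)
  qed
  have DW: "\<And>b. b \<in> D \<Longrightarrow> b \<in> W" using D VW by blast
  \<comment> \<open>Expanding each \<open>f (u i)\<close> in the basis \<open>D\<close> of the image
    and contracting the sum over \<open>i\<close> by \<open>c\<close> turns the trace into the sum
    of the diagonal coordinates of \<open>f\<close> on \<open>D\<close>, where \<open>f\<close> is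
    the identity.\<close>
  have "(\<Sum>i\<in>Q. c i (f (u i))) = (\<Sum>i\<in>Q. c i (\<Sum>b\<in>D. scale (d b (f (u i))) b))"
    using d u by (intro sum.cong refl arg_cong[where f="c _"]) (auto simp: V_def)
  also have "\<dots> = (\<Sum>i\<in>Q. \<Sum>b\<in>D. d b (f (u i)) * c i b)"
    by (intro sum.cong refl lin_on_sum_scale[OF c_lin W] DW)
  also have "\<dots> = (\<Sum>b\<in>D. \<Sum>i\<in>Q. c i b * d b (f (u i)))"
    by (subst sum.swap) (simp add: mult.commute)
  also have "\<dots> = (\<Sum>b\<in>D. d b (f (\<Sum>i\<in>Q. scale (c i b) (u i))))"
    by (intro sum.cong refl lin_on_sum_scale[OF df_lin W, symmetric] u)
  also have "\<dots> = (\<Sum>b\<in>D. 1)"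
  proof (intro sum.cong refl)
    fix b assume b: "b \<in> D"
    then have "b \<in> V" using D by blast
    then show "d b (f (\<Sum>i\<in>Q. scale (c i b) (u i))) = 1"
      using c[OF DW[OF b]] fV dD[OF b b] by simp
  qed
  finally have "of_nat (card D) = (0::'f)" using tr0 by simp
  \<comment> \<open>Characteristic zero: a rank that vanishes in the field is 0.\<close>
  then have "D = {}" using D by simp
  moreover have "f x \<in> V" using x by (auto simp: V_def)
  ultimately show ?thesis using d[of "f x"] by simp
qed

section \<open>The centralizer of a linearly reductive group\<close>

definition vsc :: "'f::comm_ring_1 \<Rightarrow> ('i \<Rightarrow> 'f) \<Rightarrow> 'i \<Rightarrow> 'f" where
  "vsc c v = (\<lambda>i. c * v i)"

interpretation vec: vector_space "vsc :: 'f::field \<Rightarrow> ('i \<Rightarrow> 'f) \<Rightarrow> 'i \<Rightarrow> 'f"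
  by unfold_locales (auto simp: vsc_def fun_eq_iff algebra_simps)

interpretation mat: vector_space "msc :: 'f::field \<Rightarrow> ('i, 'f) fmat \<Rightarrow> ('i, 'f) fmat"
  by unfold_locales (auto simp: msc_def fun_eq_iff algebra_simps)

lemma madd_eq: "madd X Y = X + Y"
  by (simp add: madd_def fun_eq_iff)

lemma mzero_eq: "mzero = 0"
  by (simp add: mzero_def fun_eq_iff)

lemma sum_if_eq_mult [simp]:
  fixes h :: "'i \<Rightarrow> 'a::comm_ring_1"
  assumes "finite S"
  shows "(\<Sum>k\<in>S. (if i = k then 1 else 0) * h k) = (if i \<in> S then h i else 0)"
    and "(\<Sum>k\<in>S. (if k = i then 1 else 0) * h k) = (if i \<in> S then h i else 0)"
    and "(\<Sum>k\<in>S. h k * (if i = k then 1 else 0)) = (if i \<in> S then h i else 0)"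
    and "(\<Sum>k\<in>S. h k * (if k = i then 1 else 0)) = (if i \<in> S then h i else 0)"
  by (simp_all add: if_distrib if_distribR sum.delta sum.delta' assms cong: if_cong)

lemma mmul_assoc: "mmul (mmul X Y) Z = mmul X (mmul Y Z)"
proof -
  have "(\<Sum>k\<in>UNIV. (\<Sum>l\<in>UNIV. X i l * Y l k) * Z k j) = (\<Sum>l\<in>UNIV. X i l * (\<Sum>k\<in>UNIV. Y l k * Z k j))" for i j
    unfolding sum_distrib_left sum_distrib_right by (subst sum.swap) (simp add: mult.assoc)
  then show ?thesis by (simp add: mmul_def)
qed

lemma mmul_one [simp]: "mmul mone X = X" "mmul X mone = X"
  by (simp_all add: mmul_def mone_def fun_eq_iff)

lemma mmul_add: "mmul (X + Y) Z = mmul X Z + mmul Y Z" "mmul Z (X + Y) = mmul Z X + mmul Z Y"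
  by (simp_all add: mmul_def fun_eq_iff algebra_simps sum.distrib)

lemma mmul_zero [simp]: "mmul 0 X = 0" "mmul X 0 = 0"
  by (simp_all add: mmul_def fun_eq_iff)

lemma mmul_msc: "mmul (msc c X) Y = msc c (mmul X Y)" "mmul X (msc c Y) = msc c (mmul X Y)"
  by (simp_all add: mmul_def msc_def fun_eq_iff sum_distrib_left mult_ac)

lemma mmul_sum: "mmul (\<Sum>i\<in>Q. u i) Y = (\<Sum>i\<in>Q. mmul (u i) Y)"
  "mmul Y (\<Sum>i\<in>Q. u i) = (\<Sum>i\<in>Q. mmul Y (u i))"
  by (induction Q rule: infinite_finite_induct) (auto simp: mmul_add)

definition mvec :: "('n::finite, 'f::comm_ring_1) fmat \<Rightarrow> ('n \<Rightarrow> 'f) \<Rightarrow> 'n \<Rightarrow> 'f" where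
  "mvec X v = (\<lambda>i. \<Sum>k\<in>UNIV. X i k * v k)"

definition eunit :: "'n \<Rightarrow> 'n \<Rightarrow> 'f::comm_ring_1" where
  "eunit j = (\<lambda>i. if i = j then 1 else 0)"

lemma mvec_mmul: "mvec (mmul X Y) v = mvec X (mvec Y v)"
proof -
  have "(\<Sum>k\<in>UNIV. (\<Sum>l\<in>UNIV. X i l * Y l k) * v k) = (\<Sum>l\<in>UNIV. X i l * (\<Sum>k\<in>UNIV. Y l k * v k))" for i
    unfolding sum_distrib_left sum_distrib_right by (subst sum.swap) (simp add: mult.assoc)
  then show ?thesis by (simp add: mmul_def mvec_def)
qed

lemma mvec_add: "mvec X (v + w) = mvec X v + mvec X w"
  by (simp add: mvec_def fun_eq_iff algebra_simps sum.distrib)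

lemma mvec_vsc: "mvec X (vsc c v) = vsc c (mvec X v)"
  by (simp add: mvec_def vsc_def fun_eq_iff sum_distrib_left mult_ac)

lemma mvec_zero [simp]: "mvec X 0 = 0"
  by (simp add: mvec_def fun_eq_iff)

lemma mvec_eunit: "mvec X (eunit j) = (\<lambda>i. X i j)"
  by (simp add: mvec_def eunit_def fun_eq_iff)

lemma mvec_diff: "mvec X (v - w) = mvec X v - mvec X w"
  by (simp add: mvec_def fun_eq_iff algebra_simps sum_subtractf)

lemma vec_expand: "v = (\<Sum>j\<in>UNIV. vsc (v j) (eunit j))" for v :: "'n::finite \<Rightarrow> 'f::comm_ring_1"
proof
  fix i
  have "(\<Sum>j\<in>S. vsc (v j) (eunit j)) i = (\<Sum>j\<in>S. vsc (v j) (eunit j) i)" for S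
    by (induction S rule: infinite_finite_induct) auto
  then show "v i = (\<Sum>j\<in>UNIV. vsc (v j) (eunit j)) i"
    by (simp add: vsc_def eunit_def)
qed

lemma mmul_eqI: "X = Y" if "\<And>v. mvec X v = mvec Y v"
  using that[of "eunit _"] by (simp add: mvec_eunit fun_eq_iff)

text \<open>Reductivity is phrased for vectors indexed by numbers below \<open>m\<close>, so the
  tautological representation is transported along an enumeration \<open>e\<close> of the index
  type. Its matrix entries are coordinate functions, hence regular with determinant exponent
  0.\<close>

lemma invariant_complement:
  fixes G :: "('n::finite, 'f::field) fmat set"
  assumes red: "linearly_reductive G" and W: "vec.subspace W"
    and inv: "\<And>g v. g \<in> G \<Longrightarrow> v \<in> W \<Longrightarrow> mvec g v \<in> W"
  obtains U where "vec.subspace U" "\<And>g v. g \<in> G \<Longrightarrow> v \<in> U \<Longrightarrow> mvec g v \<in> U"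
    "W \<inter> U = {0}" "\<And>v. \<exists>w\<in>W. \<exists>u\<in>U. v = w + u"
proof -
  define m where "m = card (UNIV :: 'n set)"
  obtain e :: "nat \<Rightarrow> 'n" where e: "bij_betw e {..<m} UNIV"
    using ex_bij_betw_nat_finite[of "UNIV :: 'n set"] by (auto simp: m_def lessThan_atLeast0)
  define e' where "e' = inv_into {..<m} e"
  have e'1: "e' j < m" "e (e' j) = j" for j
    using e by (auto simp: e'_def bij_betw_def intro: f_inv_into_f inv_into_into[of _ e "{..<m}", simplified])
  have e'2: "e' (e i) = i" if "i < m" for i
    using e that by (auto simp: e'_def bij_betw_def inv_into_f_f)
  have einj: "e i = e j \<longleftrightarrow> i = j" if "i < m" "j < m" for i j using e'2 that by metis
  define to where "to = (\<lambda>(v :: 'n \<Rightarrow> 'f) i. if i < m then v (e i) else 0)"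
  define fro where "fro = (\<lambda>(x :: nat \<Rightarrow> 'f) j. x (e' j))"
  define \<rho> where "\<rho> = (\<lambda>(g :: ('n, 'f) fmat) i j. g (e i) (e j))"
  have sum_e: "(\<Sum>k<m. h (e k)) = (\<Sum>j\<in>UNIV. h j)" for h :: "'n \<Rightarrow> 'f"
    using sum.reindex_bij_betw[OF e, of h] .
  have to_fro: "to (fro x) = x" if "x \<in> Fvec m" for x
    using that e'2 by (auto simp: to_def fro_def Fvec_def fun_eq_iff)
  have to_app: "napply m (\<rho> g) (to v) = to (mvec g v)" for g v
    using sum_e[of "\<lambda>k. g _ k * v k"] by (auto simp: napply_def to_def \<rho>_def mvec_def fun_eq_iff)
  have to_add: "to (v + w) = (\<lambda>i. to v i + to w i)" for v w by (auto simp: to_def)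
  have to_sc: "to (vsc c v) = (\<lambda>i. c * to v i)" for c v by (auto simp: to_def vsc_def)
  have to_0: "to 0 = (\<lambda>i. 0)" by (auto simp: to_def)
  have to_Fvec: "to v \<in> Fvec m" for v by (auto simp: to_def Fvec_def)
  have to_inj: "v = w" if "to v = to w" for v w
  proof
    fix j show "v j = w j" using fun_cong[OF that, of "e' j"] e'1[of j] by (simp add: to_def)
  qed
  have "rational_rep G m \<rho>"
    unfolding rational_rep_def
  proof (intro conjI allI ballI impI)
    fix i j assume "i < m" "j < m"
    then show "\<rho> mone i j = (if i = j then 1 else 0)" by (simp add: \<rho>_def mone_def einj)
  next
    fix g h i j
    show "\<rho> (mmul g h) i j = nmul m (\<rho> g) (\<rho> h) i j"
      using sum_e[of "\<lambda>k. g (e i) k * h k (e j)"] by (simp add: \<rho>_def mmul_def nmul_def)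
  next
    fix i j
    show "regular_on G (\<lambda>g. \<rho> g i j)"
      unfolding regular_on_def
      by (rule bexI[of _ "\<lambda>X. X (e i) (e j)"], rule exI[of _ 0]) (auto simp: \<rho>_def intro: polyfun.intros)
  qed
  then have cr: "completely_reducible G m \<rho>" using red by (auto simp: linearly_reductive_def)
  have "invariant_subspace G m \<rho> (to ` W)"
    unfolding invariant_subspace_def subspace_of_def
  proof (intro conjI ballI allI subsetI; (elim imageE)?; clarify?)
    show "(\<lambda>i. 0) \<in> to ` W" using to_0 vec.subspace_0[OF W] by (metis imageI)
    show "(\<lambda>i. to v i + to w i) \<in> to ` W" if "v \<in> W" "w \<in> W" for v w
      using to_add vec.subspace_add[OF W that] by (metis imageI)
    show "(\<lambda>i. c * to v i) \<in> to ` W" if "v \<in> W" for c v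
      using to_sc vec.subspace_scale[OF W that] by (metis imageI)
    show "napply m (\<rho> g) (to v) \<in> to ` W" if "g \<in> G" "v \<in> W" for g v
      using to_app inv that by simp
  qed (use to_Fvec in auto)
  then obtain C where C: "invariant_subspace G m \<rho> C" "to ` W \<inter> C = {\<lambda>i. 0}"
    "\<And>u. u \<in> Fvec m \<Longrightarrow> \<exists>v\<in>to ` W. \<exists>w\<in>C. u = (\<lambda>i. v i + w i)"
    using cr[unfolded completely_reducible_def, rule_format, of "to ` W"] by blast
  note C' = C(1)[unfolded invariant_subspace_def subspace_of_def]
  define U where "U = {v. to v \<in> C}"
  show ?thesis
  proof (rule that[of U])
    show "vec.subspace U"
      unfolding vec.subspace_def U_def using C' by (auto simp: to_0 to_add to_sc)
    show "mvec g v \<in> U" if "g \<in> G" "v \<in> U" for g v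
      using that C' unfolding U_def by (auto simp: to_app[symmetric])
    show "W \<inter> U = {0}"
    proof
      show "W \<inter> U \<subseteq> {0}"
      proof
        fix v assume "v \<in> W \<inter> U"
        then have "to v \<in> to ` W \<inter> C" by (auto simp: U_def)
        then have "to v = to 0" using C(2) to_0 by auto
        then show "v \<in> {0}" using to_inj by blast
      qed
      show "{0} \<subseteq> W \<inter> U" using C' vec.subspace_0[OF W] by (auto simp: U_def to_0)
    qed
    show "\<exists>w\<in>W. \<exists>u\<in>U. v = w + u" for v
    proof -
      obtain w y where w: "w \<in> W" "y \<in> C" "to v = (\<lambda>i. to w i + y i)"
        using C(3)[OF to_Fvec[of v]] by blast
      have "y \<in> Fvec m" using w C' by auto
      then have "to v = to (w + fro y)" "fro y \<in> U" using w to_fro by (auto simp: to_add U_def)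
      then show ?thesis using w(1) to_inj by blast
    qed
  qed
qed

lemma centralizer_mult_vec: "a \<in> centralizer G \<Longrightarrow> g \<in> G \<Longrightarrow> mvec a (mvec g v) = mvec g (mvec a v)"
  by (metis (mono_tags, lifting) centralizer_def mem_Collect_eq mvec_mmul)

text \<open>The kernel and the image of \<open>a\<close> have invariant complements \<open>U\<close> and \<open>U'\<close>; the witness is
  the inverse of \<open>a : U \<rightarrow> im a\<close>, extended by zero on \<open>U'\<close>.\<close>
lemma centralizer_von_Neumann_regular:
  fixes G :: "('n::finite, 'f::field) fmat set"
  assumes red: "linearly_reductive G" and a: "a \<in> centralizer G"
  shows "\<exists>b\<in>centralizer G. mmul a (mmul b a) = a"
proof -
  obtain U where U: "vec.subspace U" "\<And>g v. g \<in> G \<Longrightarrow> v \<in> U \<Longrightarrow> mvec g v \<in> U"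
    and U0: "{v. mvec a v = 0} \<inter> U = {0}" and U1: "\<And>v. \<exists>w\<in>{v. mvec a v = 0}. \<exists>u\<in>U. v = w + u"
  proof (rule invariant_complement[OF red])
    show "vec.subspace {v. mvec a v = 0}"
      by (auto simp: vec.subspace_def mvec_add mvec_vsc)
    show "mvec g v \<in> {v. mvec a v = 0}" if "g \<in> G" "v \<in> {v. mvec a v = 0}" for g v
      using that centralizer_mult_vec[OF a] by auto
  qed blast
  obtain U' where U': "vec.subspace U'" "\<And>g v. g \<in> G \<Longrightarrow> v \<in> U' \<Longrightarrow> mvec g v \<in> U'"
    and U'0: "range (mvec a) \<inter> U' = {0}" and U'1: "\<And>v. \<exists>w\<in>range (mvec a). \<exists>u\<in>U'. v = w + u"
  proof (rule invariant_complement[OF red])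
    show "vec.subspace (range (mvec a))"
      unfolding vec.subspace_def
    proof (intro conjI ballI allI; clarify?)
      show "0 \<in> range (mvec a)" by (metis mvec_zero rangeI)
      show "mvec a x + mvec a y \<in> range (mvec a)" for x y by (metis mvec_add rangeI)
      show "vsc c (mvec a x) \<in> range (mvec a)" for c x by (metis mvec_vsc rangeI)
    qed
    show "mvec g v \<in> range (mvec a)" if "g \<in> G" "v \<in> range (mvec a)" for g v
      using that by (auto simp: centralizer_mult_vec[OF a, symmetric])
  qed blast
  \<comment> \<open>The graph of the witness: \<open>u\<close> is the preimage in \<open>U\<close>
    of the component of \<open>v\<close> in the image of \<open>a\<close>, taken along
    \<open>U'\<close>.\<close>
  define rel where "rel = (\<lambda>v u. u \<in> U \<and> v - mvec a u \<in> U')"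
  have rel_ex: "\<exists>u. rel v u" for v
  proof -
    obtain x u' where x: "u' \<in> U'" "v = mvec a x + u'" using U'1[of v] by blast
    obtain w u where u: "mvec a w = 0" "u \<in> U" "x = w + u" using U1[of x] by blast
    have "rel v u" using x u by (simp add: rel_def mvec_add)
    then show ?thesis by blast
  qed
  have rel_add: "rel (v + v') (u + u')" if "rel v u" "rel v' u'" for v v' u u'
  proof -
    have eq: "(v + v') - mvec a (u + u') = (v - mvec a u) + (v' - mvec a u')" by (simp add: mvec_add)
    show ?thesis using that vec.subspace_add[OF U(1)] vec.subspace_add[OF U'(1)]
      unfolding rel_def eq by blast
  qed
  have rel_sc: "rel (vsc c v) (vsc c u)" if "rel v u" for c v u
  proof -
    have eq: "vsc c v - mvec a (vsc c u) = vsc c (v - mvec a u)" by (simp add: mvec_vsc vec.scale_right_diff_distrib)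
    show ?thesis using that vec.subspace_scale[OF U(1)] vec.subspace_scale[OF U'(1)]
      unfolding rel_def eq by blast
  qed
  have rel_uniq: "u = u'" if "rel v u" "rel v u'" for v u u'
  proof -
    have eq: "(v - mvec a u') - (v - mvec a u) = mvec a (u - u')" by (simp add: mvec_diff)
    have "mvec a (u - u') \<in> U'"
      using vec.subspace_diff[OF U'(1), of "v - mvec a u'" "v - mvec a u"] that
      unfolding rel_def eq by blast
    then have "mvec a (u - u') \<in> range (mvec a) \<inter> U'" by blast
    moreover have "u - u' \<in> U" using that vec.subspace_diff[OF U(1)] by (simp add: rel_def)
    ultimately have "u - u' \<in> {v. mvec a v = 0} \<inter> U" using U'0 by auto
    then show ?thesis using U0 by auto
  qed
  have rel_g: "rel (mvec g v) (mvec g u)" if "rel v u" "g \<in> G" for g v u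
  proof -
    have eq: "mvec g v - mvec a (mvec g u) = mvec g (v - mvec a u)"
      by (simp add: mvec_diff centralizer_mult_vec[OF a that(2)])
    show ?thesis using that U(2) U'(2) unfolding rel_def eq by blast
  qed
  have rel_0: "rel 0 0" using vec.subspace_0[OF U(1)] vec.subspace_0[OF U'(1)] by (simp add: rel_def)
  \<comment> \<open>Each column is chosen among the related vectors; uniqueness makes the choice
    canonical, which gives commutation with \<open>G\<close> because \<open>G\<close> preserves the
    relation.\<close>
  define b where "b = (\<lambda>i j. (SOME u. rel (eunit j) u) i)"
  have b_e: "mvec b (eunit j) = (SOME u. rel (eunit j) u)" for j by (simp add: mvec_eunit b_def)
  have rel_be: "rel (eunit j) (mvec b (eunit j))" for j
    unfolding b_e by (rule someI_ex[OF rel_ex])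
  have rel_b: "rel v (mvec b v)" for v
  proof -
    have "rel (\<Sum>j\<in>S. vsc (v j) (eunit j)) (mvec b (\<Sum>j\<in>S. vsc (v j) (eunit j)))" for S
    proof (induction S rule: infinite_finite_induct)
      case (insert j S)
      have "rel (vsc (v j) (eunit j) + (\<Sum>j\<in>S. vsc (v j) (eunit j)))
          (vsc (v j) (mvec b (eunit j)) + mvec b (\<Sum>j\<in>S. vsc (v j) (eunit j)))"
        by (intro rel_add rel_sc rel_be insert.IH)
      then show ?case unfolding sum.insert[OF insert.hyps] mvec_add mvec_vsc .
    next
      case (infinite S)
      show ?case unfolding sum.infinite[OF infinite] mvec_zero by (rule rel_0)
    next
      case empty
      show ?case unfolding sum.empty mvec_zero by (rule rel_0)
    qed
    from this[of UNIV] show ?thesis unfolding vec_expand[symmetric] .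
  qed
  have "b \<in> centralizer G"
    unfolding centralizer_def
  proof (clarify, rule mmul_eqI)
    fix g v assume g: "g \<in> G"
    show "mvec (mmul b g) v = mvec (mmul g b) v"
      using rel_uniq[OF rel_b rel_g[OF rel_b g]] by (simp add: mvec_mmul)
  qed
  moreover have "mmul a (mmul b a) = a"
  proof (rule mmul_eqI)
    fix v
    have "mvec a v - mvec a (mvec b (mvec a v)) \<in> range (mvec a) \<inter> U'"
      using rel_b[of "mvec a v"] by (auto simp: rel_def mvec_diff[symmetric])
    then show "mvec (mmul a (mmul b a)) v = mvec a v" using U'0 by (simp add: mvec_mmul)
  qed
  ultimately show ?thesis by blast
qed

section \<open>Matrix units and separability of von Neumann regular matrix algebras\<close>

definition munit :: "'i \<Rightarrow> 'i \<Rightarrow> ('i, 'f::comm_ring_1) fmat" where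
  "munit i j = (\<lambda>a b. if a = i \<and> b = j then 1 else 0)"

lemma sum_fun2_apply: "(\<Sum>q\<in>Q. h q) a b = (\<Sum>q\<in>Q. h q a b)"
  by (induction Q rule: infinite_finite_induct) auto

lemma sum_fun_apply: "(\<Sum>q\<in>Q. h q) a = (\<Sum>q\<in>Q. h q a)"
  by (induction Q rule: infinite_finite_induct) auto

lemma mmul_diff: "mmul (X - Y) Z = mmul X Z - mmul Y Z"
  by (simp add: mmul_def fun_eq_iff algebra_simps sum_subtractf)

lemma mat_expand: "X = (\<Sum>i\<in>UNIV. \<Sum>j\<in>UNIV. msc (X i j) (munit i j))"
  for X :: "('n::finite, 'f::comm_ring_1) fmat"
proof (intro ext)
  fix a b
  have "(\<Sum>i\<in>UNIV. \<Sum>j\<in>UNIV. msc (X i j) (munit i j)) a b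
      = (\<Sum>i\<in>UNIV. \<Sum>j\<in>UNIV. if a = i then if b = j then X i j else 0 else 0)"
    by (auto simp: sum_fun2_apply msc_def munit_def intro!: sum.cong)
  also have "\<dots> = (\<Sum>i\<in>UNIV. if a = i then X i b else 0)"
    by (intro sum.cong refl) auto
  also have "\<dots> = X a b" by simp
  finally show "X a b = (\<Sum>i\<in>UNIV. \<Sum>j\<in>UNIV. msc (X i j) (munit i j)) a b" ..
qed

lemma mat_in_span_munit:
  "(X :: ('n::finite, 'f::field) fmat) \<in> mat.span (range (\<lambda>(i, j). munit i j))"
proof -
  have "(\<Sum>i\<in>UNIV. \<Sum>j\<in>UNIV. msc (X i j) (munit i j)) \<in> mat.span (range (\<lambda>(i, j). munit i j))"
    by (intro mat.span_sum mat.span_scale mat.span_base) auto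
  then show ?thesis by (simp only: mat_expand[symmetric])
qed

locale regular_matrix_algebra =
  fixes A :: "('n::finite, 'f::field_char_0) fmat set"
  assumes A_subspace: "mat.subspace A"
    and A_one: "mone \<in> A"
    and A_mult: "a \<in> A \<Longrightarrow> b \<in> A \<Longrightarrow> mmul a b \<in> A"
    and A_regular: "a \<in> A \<Longrightarrow> \<exists>b\<in>A. mmul a (mmul b a) = a"
begin

lemma A_msc: "a \<in> A \<Longrightarrow> msc c a \<in> A"
  by (rule mat.subspace_scale[OF A_subspace])

lemma A_sum: "(\<And>q. q \<in> Q \<Longrightarrow> h q \<in> A) \<Longrightarrow> (\<Sum>q\<in>Q. h q) \<in> A"
  by (rule mat.subspace_sum[OF A_subspace])

text \<open>The \<open>d b\<close> are dual to the basis \<open>B\<close> with respect to the trace form of the regular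
  representation, so \<open>\<Sum>b\<in>B. b \<otimes> d b\<close> is a separability idempotent.\<close>
lemma separability:
  obtains B d e where "finite B" "B \<subseteq> A" "\<And>b. b \<in> B \<Longrightarrow> d b \<in> A"
    "(\<Sum>b\<in>B. mmul b (d b)) = mone"
    "\<And>x b. x \<in> A \<Longrightarrow> b \<in> B \<Longrightarrow> mmul x b = (\<Sum>b'\<in>B. msc (e x b' b) b')"
    "\<And>x b'. x \<in> A \<Longrightarrow> b' \<in> B \<Longrightarrow> mmul (d b') x = (\<Sum>b\<in>B. msc (e x b' b) (d b))"
proof -
  have fin: "finite (range (\<lambda>(i :: 'n, j). munit i j :: ('n, 'f) fmat))" by simp
  have sp: "A \<subseteq> mat.span (range (\<lambda>(i, j). munit i j))" using mat_in_span_munit by blast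
  obtain B c where B: "finite B" "B \<subseteq> A" and c_lin: "\<And>b. lin_on msc (*) A (c b)"
    and c: "\<And>x. x \<in> A \<Longrightarrow> (\<Sum>b\<in>B. msc (c b x) b) = x"
    by (rule mat.finite_coordinates[OF A_subspace fin sp]) blast
  have BA: "b \<in> B \<Longrightarrow> b \<in> A" for b using B by blast
  define T where "T = (\<lambda>x. \<Sum>b\<in>B. c b (mmul x b))"
  have T_add: "T (x + y) = T x + T y" if "x \<in> A" "y \<in> A" for x y
    unfolding T_def sum.distrib[symmetric]
    by (intro sum.cong refl) (simp add: mmul_add lin_on_add[OF c_lin] A_mult that BA)
  have T_sc: "T (msc k x) = k * T x" if "x \<in> A" for k x
    unfolding T_def sum_distrib_left
    by (intro sum.cong refl) (simp add: mmul_msc lin_on_scale[OF c_lin] A_mult that BA)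
  have T_lin: "lin_on msc (*) A T" by (rule lin_onI) (simp_all add: T_add T_sc)
  have T_comm: "T (mmul x y) = T (mmul y x)" if "x \<in> A" "y \<in> A" for x y
  proof -
    have *: "T (mmul x y) = (\<Sum>b\<in>B. \<Sum>b'\<in>B. c b' (mmul y b) * c b (mmul x b'))"
      if xy: "x \<in> A" "y \<in> A" for x y
      unfolding T_def
    proof (intro sum.cong refl)
      fix b assume b: "b \<in> B"
      have "mmul (mmul x y) b = mmul x (\<Sum>b'\<in>B. msc (c b' (mmul y b)) b')"
        using c[of "mmul y b"] xy b by (simp add: mmul_assoc A_mult BA)
      also have "\<dots> = (\<Sum>b'\<in>B. msc (c b' (mmul y b)) (mmul x b'))"
        by (simp add: mmul_sum mmul_msc)
      finally show "c b (mmul (mmul x y) b) = (\<Sum>b'\<in>B. c b' (mmul y b) * c b (mmul x b'))"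
        using xy by (simp add: A_mult BA mat.lin_on_sum_scale[OF c_lin A_subspace])
    qed
    show ?thesis unfolding *[OF that] *[OF that(2,1)] by (subst sum.swap) (simp add: mult.commute)
  qed
  \<comment> \<open>Left multiplication by the idempotent \<open>y z\<close> has trace
    \<open>T (y z) = 0\<close>, hence is zero; applied to \<open>mone\<close> it gives
    \<open>y z = 0\<close>, and so \<open>z = z y z = 0\<close>.\<close>
  have nd: "z = 0" if z: "z \<in> A" and 0: "\<And>w. w \<in> A \<Longrightarrow> T (mmul w z) = 0" for z
  proof -
    obtain y where y: "y \<in> A" "mmul z (mmul y z) = z" using A_regular[OF z] by blast
    have "mmul (mmul y z) mone = 0"
    proof (rule idempotent_trace_zero[of msc A B "\<lambda>b. b" c "mmul (mmul y z)"])
      show "lin_on msc msc A (mmul (mmul y z))"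
        by (rule lin_onI) (simp_all add: mmul_add mmul_msc)
      show "mmul (mmul y z) (mmul (mmul y z) x) = mmul (mmul y z) x" if "x \<in> A" for x
        using y(2) by (metis mmul_assoc)
      show "(\<Sum>b\<in>B. c b (mmul (mmul y z) b)) = 0" using 0[OF y(1)] by (simp add: T_def)
    qed (use B c c_lin A_subspace y z A_mult A_one BA mat.vector_space_axioms in auto)
    then show ?thesis using y(2) by simp
  qed
  have "\<exists>w\<in>A. \<forall>z\<in>A. T (mmul w z) = c b z" for b
  proof (rule mat.nondegenerate_represents_functional[OF A_subspace fin sp])
    show "lin_on msc (*) A (\<lambda>w. T (mmul w z))" if "z \<in> A" for z
      by (rule lin_onI) (simp_all add: mmul_add mmul_msc T_add T_sc A_mult that)
    show "lin_on msc (*) A (\<lambda>z. T (mmul w z))" if "w \<in> A" for w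
      by (rule lin_onI) (simp_all add: mmul_add mmul_msc T_add T_sc A_mult that)
  qed (use nd c_lin in auto)
  then obtain d where d: "\<And>b. d b \<in> A" "\<And>b z. z \<in> A \<Longrightarrow> T (mmul (d b) z) = c b z" by metis
  have T_eqI: "x = y" if xy: "x \<in> A" "y \<in> A" and eq: "\<And>z. z \<in> A \<Longrightarrow> T (mmul x z) = T (mmul y z)" for x y
  proof -
    have "x - y = 0"
    proof (rule nd)
      show "x - y \<in> A" using xy by (intro mat.subspace_diff[OF A_subspace])
      fix w assume w: "w \<in> A"
      have "T (mmul (x - y) w) = T (mmul x w) - T (mmul y w)"
        unfolding mmul_diff by (rule mat.lin_on_diff[OF T_lin A_subspace]) (use xy w A_mult in auto)
      then show "T (mmul w (x - y)) = 0"
        using eq[OF w] T_comm[OF w \<open>x - y \<in> A\<close>] by simp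
    qed
    then show ?thesis by simp
  qed
  have T_sum: "T (\<Sum>q\<in>Q. h q) = (\<Sum>q\<in>Q. T (h q))" if "\<And>q. q \<in> Q \<Longrightarrow> h q \<in> A" for Q :: "('n, 'f) fmat set" and h
    using that by (rule mat.lin_on_sum[OF T_lin A_subspace])
  show ?thesis
  \<comment> \<open>The third argument is the coefficient of \<open>b'\<close> in
    \<open>x b\<close>. With it, the last two claims say that \<open>x\<close> can be moved across
    the sum of \<open>b \<otimes> d b\<close>, from the left of the first factors to the right of
    the second ones.\<close>
  proof (rule that[of B d "\<lambda>x b' b. c b' (mmul x b)"])
    show "(\<Sum>b\<in>B. mmul b (d b)) = mone"
    proof (rule T_eqI)
      fix z assume z: "z \<in> A"
      have "T (mmul (\<Sum>b\<in>B. mmul b (d b)) z) = (\<Sum>b\<in>B. T (mmul b (mmul (d b) z)))"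
        using z d by (simp add: mmul_sum T_sum A_mult BA mmul_assoc)
      \<comment> \<open>After this cyclic rotation, duality reads each term as the diagonal
        coefficient at \<open>b\<close> of left multiplication by \<open>z\<close>, and the sum is
        its trace.\<close>
      also have "\<dots> = (\<Sum>b\<in>B. T (mmul (d b) (mmul z b)))"
      proof (intro sum.cong refl)
        fix b assume b: "b \<in> B"
        show "T (mmul b (mmul (d b) z)) = T (mmul (d b) (mmul z b))"
          using T_comm[of b "mmul (d b) z"] b z d BA by (simp add: A_mult mmul_assoc)
      qed
      also have "\<dots> = T (mmul mone z)" using d z by (simp add: A_mult BA T_def)
      finally show "T (mmul (\<Sum>b\<in>B. mmul b (d b)) z) = T (mmul mone z)" .
    qed (use d BA A_one in \<open>auto intro!: A_sum A_mult\<close>)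
    show "mmul x b = (\<Sum>b'\<in>B. msc (c b' (mmul x b)) b')" if "x \<in> A" "b \<in> B" for x b
      using c[of "mmul x b"] that by (simp add: A_mult BA)
    show "mmul (d b') x = (\<Sum>b\<in>B. msc (c b' (mmul x b)) (d b))" if x: "x \<in> A" and b': "b' \<in> B" for x b'
    proof (rule T_eqI)
      fix z assume z: "z \<in> A"
      have "T (mmul (mmul (d b') x) z) = c b' (mmul x z)"
        using d x z by (simp add: mmul_assoc A_mult)
      also have "mmul x z = (\<Sum>b\<in>B. msc (c b z) (mmul x b))"
        using arg_cong[OF c[OF z], of "mmul x"] by (simp add: mmul_sum mmul_msc)
      also have "c b' \<dots> = (\<Sum>b\<in>B. c b z * c b' (mmul x b))"
        using x by (intro mat.lin_on_sum_scale[OF c_lin A_subspace]) (auto intro: A_mult BA)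
      also have "\<dots> = T (mmul (\<Sum>b\<in>B. msc (c b' (mmul x b)) (d b)) z)"
        using d z by (simp add: mmul_sum mmul_msc T_sum T_sc A_mult A_msc mult.commute)
      finally show "T (mmul (mmul (d b') x) z) = T (mmul (\<Sum>b\<in>B. msc (c b' (mmul x b)) (d b)) z)" .
    qed (use d x in \<open>auto intro!: A_sum A_msc A_mult\<close>)
  qed (use B d in auto)
qed

end

lemma centralizer_regular_matrix_algebra:
  fixes G :: "('n::finite, 'f::field_char_0) fmat set"
  assumes "linearly_reductive G"
  shows "regular_matrix_algebra (centralizer G)"
proof
  show "mat.subspace (centralizer G)"
    by (auto simp: mat.subspace_def centralizer_def mmul_add mmul_msc)
  show "mone \<in> centralizer G" by (simp add: centralizer_def)
  show "mmul a b \<in> centralizer G" if "a \<in> centralizer G" "b \<in> centralizer G" for a b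
    using that by (auto simp: centralizer_def) (metis mmul_assoc)
qed (use centralizer_von_Neumann_regular[OF assms] in auto)

section \<open>Kernels on tensor powers\<close>

text \<open>Multi-indices naming the standard basis of the k-th tensor power; extensionality makes
  them finite in number.\<close>

definition Ix :: "nat \<Rightarrow> (nat \<Rightarrow> 'n::finite) set" where
  "Ix k = PiE {..<k} (\<lambda>_. UNIV)"

definition opmul :: "nat \<Rightarrow> (nat \<Rightarrow> 'n::finite, 'f::comm_ring_1) fmat \<Rightarrow> (nat \<Rightarrow> 'n, 'f) fmat \<Rightarrow> (nat \<Rightarrow> 'n, 'f) fmat" where
  "opmul k Y Z = (\<lambda>I L. \<Sum>J\<in>Ix k. Y I J * Z J L)"

definition optr :: "nat \<Rightarrow> (nat \<Rightarrow> 'n::finite, 'f::comm_ring_1) fmat \<Rightarrow> 'f" where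
  "optr k Y = (\<Sum>I\<in>Ix k. Y I I)"

text \<open>Endomorphisms of the \<open>k\<close>-th tensor power are kernels depending only on the first \<open>k\<close> slots.\<close>
definition Op :: "nat \<Rightarrow> (nat \<Rightarrow> 'n, 'f) fmat set" where
  "Op k = {Y. \<forall>I I' J J'. (\<forall>s<k. I s = I' s \<and> J s = J' s) \<longrightarrow> Y I J = Y I' J'}"

text \<open>The kernel of \<open>(a\<^sub>0 \<otimes> \<dots> \<otimes> a\<^sub>k\<^sub>-\<^sub>1) P\<^sub>\<pi>\<close>, where \<open>P\<^sub>\<pi>\<close> permutes the tensor factors.\<close>
definition M :: "nat \<Rightarrow> (nat \<Rightarrow> nat) \<Rightarrow> (nat \<Rightarrow> ('n, 'f::comm_ring_1) fmat) \<Rightarrow> (nat \<Rightarrow> 'n, 'f) fmat" where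
  "M k \<pi> a = (\<lambda>I J. \<Prod>s<k. a s (I s) (J (\<pi> s)))"

abbreviation "pinv \<pi> \<equiv> inv_into UNIV \<pi>"

abbreviation "opone k \<equiv> M k id (\<lambda>_. mone)"
abbreviation "opperm k \<pi> \<equiv> M k \<pi> (\<lambda>_. mone)"
abbreviation "opslot k s x \<equiv> M k id ((\<lambda>_. mone)(s := x))"

lemma finite_Ix [simp]: "finite (Ix k)"
  by (simp add: Ix_def finite_PiE)

lemma Ix_0: "Ix 0 = {\<lambda>_. undefined}"
  by (simp add: Ix_def)

lemma restrict_in_Ix: "restrict I {..<k} \<in> Ix k"
  by (simp add: Ix_def)

lemma Ix_Suc_sum:
  fixes h :: "(nat \<Rightarrow> 'n::finite) \<Rightarrow> 'c::comm_monoid_add"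
  shows "(\<Sum>I\<in>Ix (Suc k). h I) = (\<Sum>I\<in>Ix k. \<Sum>i\<in>UNIV. h (I(k := i)))"
proof -
  have "bij_betw (\<lambda>(I, i). I(k := i)) (Ix k \<times> UNIV) (Ix (Suc k) :: (nat \<Rightarrow> 'n) set)"
    unfolding bij_betw_def
  proof
    show "inj_on (\<lambda>(I, i). I(k := i)) (Ix k \<times> UNIV :: ((nat \<Rightarrow> 'n) \<times> 'n) set)"
    proof (rule inj_onI, clarify)
      fix I I' :: "nat \<Rightarrow> 'n" and i i'
      assume I: "I \<in> Ix k" "I' \<in> Ix k" and eq: "I(k := i) = I'(k := i')"
      have "I s = I' s" for s
        using fun_cong[OF eq, of s] I by (cases "s = k") (auto simp: Ix_def PiE_def extensional_def)
      then show "I = I' \<and> i = i'" using fun_cong[OF eq, of k] by auto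
    qed
    show "(\<lambda>(I, i). I(k := i)) ` (Ix k \<times> UNIV :: ((nat \<Rightarrow> 'n) \<times> 'n) set) = Ix (Suc k)"
      unfolding Ix_def lessThan_Suc PiE_insert_eq by force
  qed
  from sum.reindex_bij_betw[OF this, of h] show ?thesis
    by (simp add: sum.cartesian_product case_prod_unfold)
qed

lemma sum_Ix_prod:
  fixes h :: "nat \<Rightarrow> 'n::finite \<Rightarrow> 'f::comm_ring_1"
  shows "(\<Sum>I\<in>Ix k. \<Prod>s<k. h s (I s)) = (\<Prod>s<k. \<Sum>i\<in>UNIV. h s i)"
  unfolding Ix_def by (subst prod_sum_PiE) auto

lemma Ix_permute: "\<pi> permutes {..<k} \<Longrightarrow> I \<in> Ix k \<Longrightarrow> I \<circ> \<pi> \<in> Ix k"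
  by (auto simp: Ix_def PiE_def extensional_def permutes_def)

lemma sum_Ix_permute:
  fixes h :: "(nat \<Rightarrow> 'n::finite) \<Rightarrow> 'c::comm_monoid_add"
  assumes "\<pi> permutes {..<k}"
  shows "(\<Sum>I\<in>Ix k. h (I \<circ> \<pi>)) = (\<Sum>I\<in>Ix k. h I)"
proof (rule sum.reindex_bij_witness[of _ "\<lambda>I. I \<circ> pinv \<pi>" "\<lambda>I. I \<circ> \<pi>"])
  show "I \<circ> pinv \<pi> \<in> Ix k" if "I \<in> Ix k" for I :: "nat \<Rightarrow> 'n"
    using Ix_permute[OF permutes_inv[OF assms] that] .
qed (auto simp: Ix_permute[OF assms] comp_assoc permutes_inv_o[OF assms])

lemma opmul_assoc: "opmul k (opmul k X Y) Z = opmul k X (opmul k Y Z)"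
proof -
  have "(\<Sum>reynolds\<in>Ix k. (\<Sum>L\<in>Ix k. X I L * Y L reynolds) * Z reynolds J) = (\<Sum>L\<in>Ix k. X I L * (\<Sum>reynolds\<in>Ix k. Y L reynolds * Z reynolds J))" for I J
    unfolding sum_distrib_left sum_distrib_right by (subst sum.swap) (simp add: mult.assoc)
  then show ?thesis by (simp add: opmul_def)
qed

lemma opmul_add: "opmul k (X + Y) Z = opmul k X Z + opmul k Y Z" "opmul k Z (X + Y) = opmul k Z X + opmul k Z Y"
  by (simp_all add: opmul_def fun_eq_iff algebra_simps sum.distrib)

lemma opmul_zero [simp]: "opmul k 0 X = 0" "opmul k X 0 = 0"
  by (simp_all add: opmul_def fun_eq_iff)

lemma opmul_msc: "opmul k (msc c X) Y = msc c (opmul k X Y)" "opmul k X (msc c Y) = msc c (opmul k X Y)"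
  by (simp_all add: opmul_def msc_def fun_eq_iff sum_distrib_left mult_ac)

lemma opmul_sum: "opmul k (\<Sum>i\<in>Q. u i) Y = (\<Sum>i\<in>Q. opmul k (u i) Y)"
  "opmul k Y (\<Sum>i\<in>Q. u i) = (\<Sum>i\<in>Q. opmul k Y (u i))"
  by (induction Q rule: infinite_finite_induct) (auto simp: opmul_add)

lemma optr_comm: "optr k (opmul k X Y) = optr k (opmul k Y X)"
  unfolding optr_def opmul_def by (subst sum.swap) (simp add: mult.commute)

lemma optr_add: "optr k (X + Y) = optr k X + optr k Y"
  by (simp add: optr_def sum.distrib)

lemma optr_msc: "optr k (msc c X) = c * optr k X"
  by (simp add: optr_def msc_def sum_distrib_left)

lemma optr_zero [simp]: "optr k 0 = 0"
  by (simp add: optr_def)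

lemma OpD: "Y \<in> Op k \<Longrightarrow> (\<And>s. s < k \<Longrightarrow> I s = I' s) \<Longrightarrow> (\<And>s. s < k \<Longrightarrow> J s = J' s) \<Longrightarrow> Y I J = Y I' J'"
  by (auto simp: Op_def)

lemma OpI: "(\<And>I I' J J'. (\<And>s. s < k \<Longrightarrow> I s = I' s) \<Longrightarrow> (\<And>s. s < k \<Longrightarrow> J s = J' s) \<Longrightarrow> Y I J = Y I' J') \<Longrightarrow> Y \<in> Op k"
  unfolding Op_def by blast

lemma Op_subspace: "mat.subspace (Op k)"
  unfolding mat.subspace_def
proof (intro conjI ballI allI)
  show "0 \<in> Op k" by (rule OpI) simp
next
  fix X Y :: "(nat \<Rightarrow> 'n, 'f::field) fmat" assume XY: "X \<in> Op k" "Y \<in> Op k"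
  show "X + Y \<in> Op k"
  proof (rule OpI)
    fix I I' J J' :: "nat \<Rightarrow> 'n"
    assume *: "\<And>s. s < k \<Longrightarrow> I s = I' s" "\<And>s. s < k \<Longrightarrow> J s = J' s"
    show "(X + Y) I J = (X + Y) I' J'"
      using OpD[OF XY(1) *] OpD[OF XY(2) *] by simp
  qed
next
  fix c and X :: "(nat \<Rightarrow> 'n, 'f::field) fmat" assume X: "X \<in> Op k"
  show "msc c X \<in> Op k"
  proof (rule OpI)
    fix I I' J J' :: "nat \<Rightarrow> 'n"
    assume *: "\<And>s. s < k \<Longrightarrow> I s = I' s" "\<And>s. s < k \<Longrightarrow> J s = J' s"
    show "msc c X I J = msc c X I' J'"
      using OpD[OF X *] by (simp add: msc_def)
  qed
qed

lemma Op_eqI: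
  fixes Y Z :: "(nat \<Rightarrow> 'n::finite, 'f) fmat"
  assumes "Y \<in> Op k" "Z \<in> Op k" "\<And>I J. I \<in> Ix k \<Longrightarrow> J \<in> Ix k \<Longrightarrow> Y I J = Z I J"
  shows "Y = Z"
proof (intro ext)
  fix I J :: "nat \<Rightarrow> 'n"
  have "Y I J = Y (restrict I {..<k}) (restrict J {..<k})" by (rule OpD[OF assms(1)]) auto
  also have "\<dots> = Z (restrict I {..<k}) (restrict J {..<k})" by (intro assms(3) restrict_in_Ix)
  also have "\<dots> = Z I J" by (rule OpD[OF assms(2)]) auto
  finally show "Y I J = Z I J" .
qed

lemma Op_opmul:
  fixes Y Z :: "(nat \<Rightarrow> 'n::finite, 'f::comm_ring_1) fmat"
  assumes "Y \<in> Op k" "Z \<in> Op k"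
  shows "opmul k Y Z \<in> Op k"
proof (rule OpI)
  fix I I' L L' :: "nat \<Rightarrow> 'n"
  assume *: "\<And>s. s < k \<Longrightarrow> I s = I' s" "\<And>s. s < k \<Longrightarrow> L s = L' s"
  have "Y I J = Y I' J" for J by (rule OpD[OF assms(1) *(1)]) auto
  moreover have "Z J L = Z J L'" for J by (rule OpD[OF assms(2) _ *(2)]) auto
  ultimately show "opmul k Y Z I L = opmul k Y Z I' L'" by (simp only: opmul_def)
qed

lemma Op_M:
  assumes "\<pi> permutes {..<k}"
  shows "M k \<pi> a \<in> Op k"
  unfolding M_def using permutes_in_image[OF assms] by (intro OpI prod.cong) auto

lemma M_cong:
  "(\<And>s. s < k \<Longrightarrow> a s = b s) \<Longrightarrow> (\<And>s. s < k \<Longrightarrow> \<pi> s = \<rho> s) \<Longrightarrow> M k \<pi> a = M k \<rho> b"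
  by (simp add: M_def fun_eq_iff)

text \<open>Reindexing the second product by \<pi> makes both factors depend on
  \<open>J \<circ> \<pi>\<close>, and the sum then factorises over the slots. The order
  \<open>\<rho> \<circ> \<pi>\<close> arises because a permutation acts by precomposition on the
  column index.\<close>

lemma M_mult:
  fixes a b :: "nat \<Rightarrow> ('n::finite, 'f::comm_ring_1) fmat"
  assumes \<pi>: "\<pi> permutes {..<k}"
  shows "opmul k (M k \<pi> a) (M k \<rho> b) = M k (\<rho> \<circ> \<pi>) (\<lambda>s. mmul (a s) (b (\<pi> s)))"
proof (intro ext)
  fix I L :: "nat \<Rightarrow> 'n"
  have "opmul k (M k \<pi> a) (M k \<rho> b) I L
      = (\<Sum>J\<in>Ix k. (\<Prod>s<k. a s (I s) ((J \<circ> \<pi>) s)) * (\<Prod>s<k. b (\<pi> s) ((J \<circ> \<pi>) s) (L (\<rho> (\<pi> s)))))"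
    unfolding opmul_def M_def
  proof (intro sum.cong refl arg_cong2[where f="(*)"])
    show "(\<Prod>s<k. b s (J s) (L (\<rho> s))) = (\<Prod>s<k. b (\<pi> s) ((J \<circ> \<pi>) s) (L (\<rho> (\<pi> s))))" for J
      using prod.permute[OF \<pi>, of "\<lambda>s. b s (J s) (L (\<rho> s))"] by (simp add: o_def)
  qed simp
  also have "\<dots> = (\<Sum>J\<in>Ix k. \<Prod>s<k. a s (I s) (J s) * b (\<pi> s) (J s) (L (\<rho> (\<pi> s))))"
    by (subst sum_Ix_permute[OF \<pi>, where h="\<lambda>J. (\<Prod>s<k. a s (I s) (J s)) * (\<Prod>s<k. b (\<pi> s) (J s) (L (\<rho> (\<pi> s))))"])
      (simp add: prod.distrib)
  also have "\<dots> = (\<Prod>s<k. \<Sum>j\<in>UNIV. a s (I s) j * b (\<pi> s) j (L (\<rho> (\<pi> s))))"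
    by (rule sum_Ix_prod[where h="\<lambda>s j. a s (I s) j * b (\<pi> s) j (L (\<rho> (\<pi> s)))"])
  also have "\<dots> = M k (\<rho> \<circ> \<pi>) (\<lambda>s. mmul (a s) (b (\<pi> s))) I L"
    by (simp add: M_def mmul_def)
  finally show "opmul k (M k \<pi> a) (M k \<rho> b) I L = M k (\<rho> \<circ> \<pi>) (\<lambda>s. mmul (a s) (b (\<pi> s))) I L" .
qed

lemma M_sum_slot:
  fixes a :: "nat \<Rightarrow> ('n, 'f::comm_ring_1) fmat"
  assumes "s < k"
  shows "M k \<pi> (a(s := (\<Sum>q\<in>Q. msc (c q) (x q)))) = (\<Sum>q\<in>Q. msc (c q) (M k \<pi> (a(s := x q))))"
proof (intro ext)
  fix I J :: "nat \<Rightarrow> 'n"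
  have *: "M k \<pi> (a(s := y)) I J = y (I s) (J (\<pi> s)) * (\<Prod>t\<in>{..<k} - {s}. a t (I t) (J (\<pi> t)))" for y
    unfolding M_def using assms by (subst prod.remove[of _ s]) auto
  show "M k \<pi> (a(s := (\<Sum>q\<in>Q. msc (c q) (x q)))) I J = (\<Sum>q\<in>Q. msc (c q) (M k \<pi> (a(s := x q)))) I J"
    unfolding * sum_fun2_apply msc_def sum_distrib_right by (simp add: * mult.assoc)
qed

lemma M_one_entry: "opone k I J = (if \<forall>s<k. I s = J s then 1 else 0)"
proof (cases "\<forall>s<k. I s = J s")
  case False
  then obtain s where "s < k" "I s \<noteq> J s" by blast
  then show ?thesis using False
    by (auto simp: M_def mone_def intro!: prod_zero bexI[of _ s])
qed (simp add: M_def mone_def)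

lemma Ix_ext: "I \<in> Ix k \<Longrightarrow> J \<in> Ix k \<Longrightarrow> (\<forall>s<k. I s = J s) \<longleftrightarrow> I = J"
  unfolding Ix_def by (auto intro: PiE_ext)

lemma opmul_one:
  fixes Y :: "(nat \<Rightarrow> 'n::finite, 'f::comm_ring_1) fmat"
  assumes "Y \<in> Op k"
  shows "opmul k (opone k) Y = Y" "opmul k Y (opone k) = Y"
proof -
  have *: "opone k I J = (if I = J then 1 else 0 :: 'f)" if "I \<in> Ix k" "J \<in> Ix k" for I J :: "nat \<Rightarrow> 'n"
    unfolding M_one_entry Ix_ext[OF that] ..
  have op: "(opone k :: (nat \<Rightarrow> 'n, 'f) fmat) \<in> Op k" by (rule Op_M) (rule permutes_id)
  show "opmul k (opone k) Y = Y"
  proof (rule Op_eqI[OF Op_opmul[OF op assms] assms])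
    fix I J :: "nat \<Rightarrow> 'n" assume IJ: "I \<in> Ix k" "J \<in> Ix k"
    have "opmul k (opone k) Y I J = (\<Sum>reynolds\<in>Ix k. (if I = reynolds then 1 else 0) * Y reynolds J)"
      unfolding opmul_def using IJ by (intro sum.cong refl) (simp only: *)
    then show "opmul k (opone k) Y I J = Y I J" using IJ by simp
  qed
  show "opmul k Y (opone k) = Y"
  proof (rule Op_eqI[OF Op_opmul[OF assms op] assms])
    fix I J :: "nat \<Rightarrow> 'n" assume IJ: "I \<in> Ix k" "J \<in> Ix k"
    have "opmul k Y (opone k) I J = (\<Sum>reynolds\<in>Ix k. Y I reynolds * (if reynolds = J then 1 else 0))"
      unfolding opmul_def using IJ by (intro sum.cong refl) (simp only: *)
    then show "opmul k Y (opone k) I J = Y I J" using IJ by simp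
  qed
qed

lemma opperm_mult: "\<pi> permutes {..<k} \<Longrightarrow> opmul k (opperm k \<pi>) (opperm k \<rho>) = opperm k (\<rho> \<circ> \<pi>)"
  by (simp add: M_mult)

lemma opperm_opslot:
  assumes "\<pi> permutes {..<k}"
  shows "opmul k (opperm k \<pi>) (opslot k s x) = opmul k (opslot k (pinv \<pi> s) x) (opperm k \<pi>)"
proof -
  have "((\<lambda>_. mone)(s := x)) (\<pi> t) = ((\<lambda>_. mone)(pinv \<pi> s := x)) t" for t
    using permutes_inv_eq[OF assms, of s t] by auto
  then show ?thesis unfolding M_mult[OF assms] M_mult[OF permutes_id] by (simp only: mmul_one id_o o_id id_apply)
qed

definition opunits :: "nat \<Rightarrow> (nat \<Rightarrow> 'n::finite, 'f::field) fmat set" where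
  "opunits k = (\<lambda>(I, J). M k id (\<lambda>s. munit (I s) (J s))) ` (Ix k \<times> Ix k)"

lemma finite_opunits [simp]: "finite (opunits k)"
  by (simp add: opunits_def)

text \<open>Tensor products of matrix units have Kronecker deltas as entries. The finite spanning
  set makes the duality arguments for \<open>calA k\<close> finite dimensional, although kernels are
  functions on an infinite index type.\<close>

lemma Op_span: "(Op k :: (nat \<Rightarrow> 'n::finite, 'f::field) fmat set) \<subseteq> mat.span (opunits k)"
proof
  fix Y :: "(nat \<Rightarrow> 'n, 'f) fmat" assume Y: "Y \<in> Op k"
  define Z where "Z = (\<Sum>I\<in>Ix k. \<Sum>J\<in>Ix k. msc (Y I J) (M k id (\<lambda>s. munit (I s) (J s)) :: (nat \<Rightarrow> 'n, 'f) fmat))"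
  have Z: "Z \<in> mat.span (opunits k)"
    unfolding Z_def opunits_def by (intro mat.span_sum mat.span_scale mat.span_base) auto
  have e: "M k id (\<lambda>s. munit (I s) (J s)) I' J' = ((if I = I' then 1 else 0) * (if J = J' then 1 else 0) :: 'f)"
    if "I \<in> Ix k" "J \<in> Ix k" "I' \<in> Ix k" "J' \<in> Ix k" for I J I' J' :: "nat \<Rightarrow> 'n"
  proof -
    have "M k id (\<lambda>s. munit (I s) (J s)) I' J' = (\<Prod>s<k. mone (I s) (I' s) * mone (J s) (J' s) :: 'f)"
      unfolding M_def by (intro prod.cong) (auto simp: munit_def mone_def)
    also have "\<dots> = opone k I I' * opone k J J'"
      unfolding prod.distrib by (simp add: M_def)
    finally show ?thesis
      unfolding M_one_entry Ix_ext[OF that(1,3)] Ix_ext[OF that(2,4)] .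
  qed
  have "Y = Z"
  proof (rule Op_eqI[OF Y])
    show "Z \<in> Op k" unfolding Z_def
      by (intro mat.subspace_sum[OF Op_subspace] mat.subspace_scale[OF Op_subspace] Op_M permutes_id)
    fix I J :: "nat \<Rightarrow> 'n" assume IJ: "I \<in> Ix k" "J \<in> Ix k"
    have "Z I J = (\<Sum>I'\<in>Ix k. \<Sum>J'\<in>Ix k. if I' = I then if J' = J then Y I' J' else 0 else 0)"
      unfolding Z_def sum_fun2_apply msc_def
      by (intro sum.cong refl) (use IJ in \<open>simp add: e\<close>)
    also have "\<dots> = (\<Sum>I'\<in>Ix k. if I' = I then Y I' J else 0)"
      using IJ by (intro sum.cong refl) (auto simp: sum.delta)
    also have "\<dots> = Y I J" using IJ by (simp add: sum.delta)
    finally show "Y I J = Z I J" ..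
  qed
  then show "Y \<in> mat.span (opunits k)" using Z by simp
qed

text \<open>\<open>E\<close> acts as an idempotent on the column vectors supported on
  \<open>Ix k\<close>, and its trace there is \<open>optr k E\<close>.\<close>

lemma op_idempotent_trace_zero:
  fixes E :: "(nat \<Rightarrow> 'n::finite, 'f::field_char_0) fmat"
  assumes E: "E \<in> Op k" and idem: "opmul k E E = E" and tr0: "optr k E = 0"
  shows "E = 0"
proof -
  define W where "W = {v :: (nat \<Rightarrow> 'n) \<Rightarrow> 'f. \<forall>I. I \<notin> Ix k \<longrightarrow> v I = 0}"
  define f where "f = (\<lambda>v I. if I \<in> Ix k then \<Sum>J\<in>Ix k. E I J * v J else 0)"
  have fe: "f (eunit J) = (\<lambda>I. if I \<in> Ix k then E I J else 0)" if "J \<in> Ix k" for J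
    using that by (intro ext) (simp add: f_def eunit_def)
  have f0: "f (eunit J) = 0" if J: "J \<in> Ix k" for J
  proof (rule idempotent_trace_zero[of vsc W "Ix k" eunit "\<lambda>I v. v I" f])
    show "vector_space (vsc :: 'f \<Rightarrow> ((nat \<Rightarrow> 'n) \<Rightarrow> 'f) \<Rightarrow> _)" by (rule vec.vector_space_axioms)
    show "vec.subspace W" by (auto simp: vec.subspace_def W_def vsc_def)
    show "lin_on vsc (*) W (\<lambda>v. v I)" for I by (rule lin_onI) (auto simp: vsc_def)
    show "lin_on vsc vsc W f"
      by (rule lin_onI) (auto simp: vsc_def f_def fun_eq_iff algebra_simps sum.distrib sum_distrib_left)
    show "(\<Sum>I\<in>Ix k. vsc (v I) (eunit I)) = v" if "v \<in> W" for v
    proof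
      fix J
      show "(\<Sum>I\<in>Ix k. vsc (v I) (eunit I)) J = v J"
        using that by (auto simp: sum_fun_apply vsc_def eunit_def W_def)
    qed
    show "f (f v) = f v" if "v \<in> W" for v
    proof -
      have "(\<Sum>J\<in>Ix k. E I J * (\<Sum>L\<in>Ix k. E J L * v L)) = (\<Sum>L\<in>Ix k. opmul k E E I L * v L)" for I
        unfolding opmul_def sum_distrib_left sum_distrib_right by (subst sum.swap) (simp add: mult.assoc)
      then show ?thesis by (simp add: f_def fun_eq_iff idem)
    qed
    show "(\<Sum>I\<in>Ix k. f (eunit I) I) = 0"
      using tr0 by (simp add: fe optr_def)
  qed (use J in \<open>auto simp: W_def eunit_def f_def\<close>)
  show ?thesis
  proof (rule Op_eqI[OF E])
    show "(0 :: (nat \<Rightarrow> 'n, 'f) fmat) \<in> Op k" by (rule mat.subspace_0[OF Op_subspace])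
    show "E I J = 0 I J" if "I \<in> Ix k" "J \<in> Ix k" for I J
      using fun_cong[OF f0[OF that(2)], of I] that by (simp add: fe)
  qed
qed

section \<open>The projection onto the algebra generated by permutations and coefficients\<close>

text \<open>As simp rules these also fire on unapplied sums of kernels and eta-expand them.\<close>
declare plus_fun_apply [simp del] zero_fun_apply [simp del]

text \<open>Peels one slot off an elementary tensor. Together with \<open>M_slots_perm\<close> this
  reduces linearity over \<open>calA k\<close> to linearity over the generators
  \<open>opslot\<close> and \<open>opperm\<close>.\<close>

lemma M_slots: "M k id (\<lambda>s. if s < Suc j then a s else mone)
    = opmul k (opslot k j (a j)) (M k id (\<lambda>s. if s < j then a s else mone))"
proof -
  have "((\<lambda>_. mone)(j := a j)) s = (if s = j then a j else mone)" for s by simp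
  then have "mmul (((\<lambda>_. mone)(j := a j)) s) (if id s < j then a (id s) else mone) = (if s < Suc j then a s else mone)" for s
    by (cases "s = j") auto
  then show ?thesis unfolding M_mult[OF permutes_id] by (simp only: id_o)
qed

lemma M_slots_perm: "M k \<pi> a = opmul k (M k id (\<lambda>s. if s < k then a s else mone)) (opperm k \<pi>)"
  unfolding M_mult[OF permutes_id] by (rule M_cong) auto

lemma opslot_comm:
  assumes "s \<noteq> t"
  shows "opmul k (opslot k s x) (opslot k t y) = opmul k (opslot k t y) (opslot k s x)"
proof -
  have "mmul (((\<lambda>_. mone)(s := x)) r) (((\<lambda>_. mone)(t := y)) (id r))
      = mmul (((\<lambda>_. mone)(t := y)) r) (((\<lambda>_. mone)(s := x)) (id r))" for r
    using assms by auto
  then show ?thesis unfolding M_mult[OF permutes_id] by (simp only:)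
qed

lemma opslot_mult: "opmul k (opslot k s x) (opslot k s y) = opslot k s (mmul x y)"
  unfolding M_mult[OF permutes_id] by (rule M_cong) auto

lemma opslot_sum: "s < k \<Longrightarrow> opslot k s (\<Sum>q\<in>Q. msc (c q) (x q)) = (\<Sum>q\<in>Q. msc (c q) (opslot k s (x q)))"
  by (rule M_sum_slot)

lemma opslot_sum': "s < k \<Longrightarrow> opslot k s (\<Sum>q\<in>Q. x q) = (\<Sum>q\<in>Q. opslot k s (x q))"
  using opslot_sum[of s k "\<lambda>_. 1" x Q] by (simp add: msc_def)

lemma opslot_mone: "opslot k s mone = opone k"
  by (rule M_cong) auto

context regular_matrix_algebra
begin

definition calA :: "nat \<Rightarrow> (nat \<Rightarrow> 'n, 'f) fmat set" where
  "calA k = mat.span {M k \<pi> a |\<pi> a. \<pi> permutes {..<k} \<and> (\<forall>s. a s \<in> A)}"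

lemma calA_subspace: "mat.subspace (calA k)"
  unfolding calA_def by (rule mat.subspace_span)

lemma calA_M: "\<pi> permutes {..<k} \<Longrightarrow> (\<And>s. a s \<in> A) \<Longrightarrow> M k \<pi> a \<in> calA k"
  unfolding calA_def by (rule mat.span_base) blast

lemma calA_perm: "\<pi> permutes {..<k} \<Longrightarrow> opperm k \<pi> \<in> calA k"
  by (rule calA_M) (use A_one in auto)

lemma calA_one: "opone k \<in> calA k"
  by (rule calA_perm) (rule permutes_id)

lemma calA_slot: "x \<in> A \<Longrightarrow> opslot k s x \<in> calA k"
  by (rule calA_M) (use A_one permutes_id in auto)

lemma calA_add: "Y \<in> calA k \<Longrightarrow> Z \<in> calA k \<Longrightarrow> Y + Z \<in> calA k"
  and calA_msc: "Y \<in> calA k \<Longrightarrow> msc c Y \<in> calA k"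
  and calA_zero: "0 \<in> calA k"
  using calA_subspace by (auto simp: mat.subspace_def)

lemma calA_sum: "(\<And>q. q \<in> Q \<Longrightarrow> h q \<in> calA k) \<Longrightarrow> (\<Sum>q\<in>Q. h q) \<in> calA k"
  by (rule mat.subspace_sum[OF calA_subspace])

lemma calA_induct [consumes 1, case_names zero M add scale]:
  assumes "Y \<in> calA k" "P 0"
    and M: "\<And>\<pi> a. \<pi> permutes {..<k} \<Longrightarrow> (\<And>s. a s \<in> A) \<Longrightarrow> P (M k \<pi> a)"
    and add: "\<And>X Y. X \<in> calA k \<Longrightarrow> Y \<in> calA k \<Longrightarrow> P X \<Longrightarrow> P Y \<Longrightarrow> P (X + Y)"
    and sc: "\<And>c X. X \<in> calA k \<Longrightarrow> P X \<Longrightarrow> P (msc c X)"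
  shows "P Y"
proof -
  have "Y \<in> calA k \<and> P Y"
    using assms(1) unfolding calA_def
  proof (induction rule: mat.span_induct_alt)
    case base
    then show ?case using assms(2) mat.span_zero by blast
  next
    case (step c x y)
    then obtain \<pi> a where x: "x = M k \<pi> a" "\<pi> permutes {..<k}" "\<And>s. a s \<in> A" by blast
    have "msc c x \<in> calA k \<and> P (msc c x)"
      using sc[OF calA_M[OF x(2,3)] M[OF x(2,3)]] calA_msc[OF calA_M[OF x(2,3)]] x(1) by simp
    with step show ?case using add[of "msc c x" y] calA_add[of "msc c x" k y] unfolding calA_def by blast
  qed
  then show ?thesis ..
qed

lemma calA_Op: "Y \<in> calA k \<Longrightarrow> Y \<in> Op k"
  by (induction rule: calA_induct)
    (auto intro: mat.subspace_0[OF Op_subspace] mat.subspace_add[OF Op_subspace]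
      mat.subspace_scale[OF Op_subspace] Op_M)

lemma calA_span: "calA k \<subseteq> mat.span (opunits k)"
  using calA_Op Op_span by blast

lemma calA_mult:
  assumes "Y \<in> calA k" "Z \<in> calA k"
  shows "opmul k Y Z \<in> calA k"
  using assms(1)
proof (induction rule: calA_induct)
  case (M \<pi> a)
  show ?case using assms(2)
  proof (induction rule: calA_induct)
    case (M \<rho> b)
    show ?case unfolding M_mult[OF \<open>\<pi> permutes {..<k}\<close>]
      by (intro calA_M permutes_compose A_mult M \<open>\<pi> permutes {..<k}\<close> \<open>\<And>s. a s \<in> A\<close>)
  qed (simp_all add: opmul_add opmul_msc calA_add calA_msc calA_zero)
qed (simp_all add: opmul_add opmul_msc calA_add calA_msc calA_zero)

text \<open>The averaging steps enlarge \<open>X\<close> from the empty set to a set of generators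
  of \<open>calA k\<close>; the final \<open>q\<close> is a retraction onto \<open>L\<close> that is
  linear over \<open>calA k\<close>.\<close>

definition average :: "nat \<Rightarrow> ((nat \<Rightarrow> 'n, 'f) fmat \<Rightarrow> (nat \<Rightarrow> 'n, 'f) fmat) \<Rightarrow> (nat \<Rightarrow> 'n, 'f) fmat set
    \<Rightarrow> (nat \<Rightarrow> 'n, 'f) fmat set \<Rightarrow> bool" where
  "average k q L X \<longleftrightarrow> lin_on msc msc (Op k) q \<and> (\<forall>U\<in>Op k. q U \<in> L) \<and> (\<forall>U\<in>L. q U = U)
    \<and> (\<forall>x\<in>X. \<forall>U\<in>Op k. q (opmul k x U) = opmul k x (q U))"

text \<open>In module terms, a left \<open>calA k\<close>-submodule of \<open>Op k\<close>, which
  may reach outside \<open>calA k\<close>.\<close>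

definition left_ideal :: "nat \<Rightarrow> (nat \<Rightarrow> 'n, 'f) fmat set \<Rightarrow> bool" where
  "left_ideal k L \<longleftrightarrow> mat.subspace L \<and> L \<subseteq> Op k \<and> (\<forall>Z\<in>calA k. \<forall>U\<in>L. opmul k Z U \<in> L)"

text \<open>The separability idempotent of \<open>A\<close> is wrapped around \<open>q\<close> in
  slot \<open>s\<close>. Since the products \<open>b (d b)\<close> add up to 1, \<open>L\<close>
  stays fixed pointwise; moving \<open>x\<close> across the idempotent gives linearity in slot
  \<open>s\<close>; and operators in different slots commute, which preserves linearity in the
  earlier ones.\<close>

lemma average_slot:
  assumes L: "left_ideal k L" and q: "average k q L {opslot k t x |t x. t < s \<and> x \<in> A}" and s: "s < k"
  shows "\<exists>q'. average k q' L {opslot k t x |t x. t < Suc s \<and> x \<in> A}"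
proof -
  obtain B d e where B: "finite B" "B \<subseteq> A" and d: "\<And>b. b \<in> B \<Longrightarrow> d b \<in> A"
    and one: "(\<Sum>b\<in>B. mmul b (d b)) = mone"
    and e1: "\<And>x b. x \<in> A \<Longrightarrow> b \<in> B \<Longrightarrow> mmul x b = (\<Sum>b'\<in>B. msc (e x b' b) b')"
    and e2: "\<And>x b'. x \<in> A \<Longrightarrow> b' \<in> B \<Longrightarrow> mmul (d b') x = (\<Sum>b\<in>B. msc (e x b' b) (d b))"
    by (rule separability) blast
  have BA: "b \<in> B \<Longrightarrow> b \<in> A" for b using B by blast
  note Ls = L[unfolded left_ideal_def]
  have Lmul: "opmul k Z U \<in> L" if "Z \<in> calA k" "U \<in> L" for Z U using Ls that by blast
  have q_lin: "lin_on msc msc (Op k) q" and qL: "\<And>U. U \<in> Op k \<Longrightarrow> q U \<in> L" and qid: "\<And>U. U \<in> L \<Longrightarrow> q U = U"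
    and qc: "\<And>t x U. t < s \<Longrightarrow> x \<in> A \<Longrightarrow> U \<in> Op k \<Longrightarrow> q (opmul k (opslot k t x) U) = opmul k (opslot k t x) (q U)"
    using q unfolding average_def by blast+
  have So: "opmul k (opslot k t x) U \<in> Op k" if "U \<in> Op k" for t x U
    using that by (intro Op_opmul Op_M permutes_id)
  define q' where "q' = (\<lambda>U. \<Sum>b\<in>B. opmul k (opslot k s b) (q (opmul k (opslot k s (d b)) U)))"
  have "average k q' L {opslot k t x |t x. t < Suc s \<and> x \<in> A}"
    unfolding average_def
  proof (intro conjI ballI)
    show "lin_on msc msc (Op k) q'"
      unfolding q'_def
      by (rule lin_onI) (simp_all add: opmul_add opmul_msc lin_on_add[OF q_lin] lin_on_scale[OF q_lin] So
          sum.distrib mat.scale_sum_right)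
    show "q' U \<in> L" if "U \<in> Op k" for U
      unfolding q'_def using Ls
      by (intro mat.subspace_sum Lmul qL So that calA_slot BA) auto
    show "q' U = U" if U: "U \<in> L" for U
    proof -
      have "q' U = (\<Sum>b\<in>B. opmul k (opslot k s (mmul b (d b))) U)"
        unfolding q'_def opslot_mult[symmetric] opmul_assoc
        by (intro sum.cong refl arg_cong[where f="opmul k _"] qid Lmul calA_slot d U)
      also have "\<dots> = opmul k (opslot k s (\<Sum>b\<in>B. mmul b (d b))) U"
        unfolding opslot_sum'[OF s] opmul_sum ..
      also have "\<dots> = U" unfolding one opslot_mone using opmul_one(1) U Ls by blast
      finally show ?thesis .
    qed
    fix y U :: "(nat \<Rightarrow> 'n, 'f) fmat"
    assume y: "y \<in> {opslot k t x |t x. t < Suc s \<and> x \<in> A}" and U: "U \<in> Op k"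
    then obtain t x where y_eq: "y = opslot k t x" and t: "t < Suc s" and x: "x \<in> A" by blast
    show "q' (opmul k y U) = opmul k y (q' U)"
    proof (cases "t = s")
      case False
      then have "t < s" using t by simp
      have *: "opmul k (opslot k s z) (opmul k (opslot k t x) V) = opmul k (opslot k t x) (opmul k (opslot k s z) V)" for z V
        unfolding opmul_assoc[symmetric] using opslot_comm[of s t] False by metis
      show ?thesis unfolding y_eq q'_def opmul_sum *
        unfolding qc[OF \<open>t < s\<close> x So[OF U]] * ..
    next
      case True
      have "q' (opmul k y U) = (\<Sum>b'\<in>B. opmul k (opslot k s b') (q (opmul k (opslot k s (mmul (d b') x)) U)))"
        unfolding y_eq q'_def True opslot_mult[symmetric] opmul_assoc ..
      \<comment> \<open>The coefficients \<open>e\<close> carry \<open>x\<close> from the factors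
        \<open>d b'\<close> over to the factors \<open>b\<close>.\<close>
      also have "\<dots> = (\<Sum>b'\<in>B. \<Sum>b\<in>B. msc (e x b' b) (opmul k (opslot k s b') (q (opmul k (opslot k s (d b)) U))))"
      proof (intro sum.cong refl)
        fix b' assume b': "b' \<in> B"
        have "q (opmul k (opslot k s (mmul (d b') x)) U) = (\<Sum>b\<in>B. msc (e x b' b) (q (opmul k (opslot k s (d b)) U)))"
          unfolding e2[OF x b'] opslot_sum[OF s] opmul_sum opmul_msc
          by (rule mat.lin_on_sum_scale[OF q_lin Op_subspace]) (rule So[OF U])
        then show "opmul k (opslot k s b') (q (opmul k (opslot k s (mmul (d b') x)) U))
            = (\<Sum>b\<in>B. msc (e x b' b) (opmul k (opslot k s b') (q (opmul k (opslot k s (d b)) U))))"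
          by (simp only: opmul_sum opmul_msc)
      qed
      also have "\<dots> = (\<Sum>b\<in>B. opmul k (\<Sum>b'\<in>B. msc (e x b' b) (opslot k s b')) (q (opmul k (opslot k s (d b)) U)))"
        unfolding opmul_sum opmul_msc by (rule sum.swap)
      also have "\<dots> = (\<Sum>b\<in>B. opmul k (opslot k s (mmul x b)) (q (opmul k (opslot k s (d b)) U)))"
      proof (intro sum.cong refl)
        fix b assume b: "b \<in> B"
        show "opmul k (\<Sum>b'\<in>B. msc (e x b' b) (opslot k s b')) (q (opmul k (opslot k s (d b)) U))
            = opmul k (opslot k s (mmul x b)) (q (opmul k (opslot k s (d b)) U))"
          unfolding e1[OF x b] opslot_sum[OF s] ..
      qed
      also have "\<dots> = opmul k y (q' U)"
        unfolding y_eq q'_def True opslot_mult[symmetric] opmul_assoc opmul_sum ..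
      finally show ?thesis .
    qed
  qed
  then show ?thesis by blast
qed

lemma average_slots:
  assumes L: "left_ideal k L" and q: "average k q L {}" and "s \<le> k"
  shows "\<exists>q'. average k q' L {opslot k t x |t x. t < s \<and> x \<in> A}"
  using \<open>s \<le> k\<close>
proof (induction s)
  case 0
  then show ?case using q by (auto simp: average_def)
next
  case (Suc s)
  then obtain q' where "average k q' L {opslot k t x |t x. t < s \<and> x \<in> A}" by (meson Suc_leD)
  then show ?case by (rule average_slot[OF L]) (use Suc.prems in simp)
qed

text \<open>Averaging over the symmetric group as in Maschke's theorem, hence the factor 1 / k!.
  Conjugation by \<pi> moves slot \<open>t\<close> to another slot, so slot linearity survives
  because it is already available in all slots.\<close>

lemma average_perms:
  assumes L: "left_ideal k L" and q: "average k q L {opslot k t x |t x. t < k \<and> x \<in> A}"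
  shows "\<exists>q'. average k q' L ({opslot k t x |t x. t < k \<and> x \<in> A} \<union> {opperm k \<rho> |\<rho>. \<rho> permutes {..<k}})"
proof -
  define S where "S = {\<pi>. \<pi> permutes {..<k}}"
  have S: "finite S" "card S = fact k" unfolding S_def
    by (simp_all add: finite_permutations card_permutations)
  note Ls = L[unfolded left_ideal_def]
  have Lmul: "opmul k Z U \<in> L" if "Z \<in> calA k" "U \<in> L" for Z U using Ls that by blast
  have q_lin: "lin_on msc msc (Op k) q" and qL: "\<And>U. U \<in> Op k \<Longrightarrow> q U \<in> L" and qid: "\<And>U. U \<in> L \<Longrightarrow> q U = U"
    and qc: "\<And>t x U. t < k \<Longrightarrow> x \<in> A \<Longrightarrow> U \<in> Op k \<Longrightarrow> q (opmul k (opslot k t x) U) = opmul k (opslot k t x) (q U)"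
    using q unfolding average_def by blast+
  have Po: "opmul k (opperm k \<pi>) U \<in> Op k" if "\<pi> \<in> S" "U \<in> Op k" for \<pi> U
    using that by (intro Op_opmul Op_M) (auto simp: S_def)
  have inv: "pinv \<pi> \<in> S" if "\<pi> \<in> S" for \<pi> using that permutes_inv by (auto simp: S_def)
  define q' where "q' = (\<lambda>U. msc (1 / fact k) (\<Sum>\<pi>\<in>S. opmul k (opperm k (pinv \<pi>)) (q (opmul k (opperm k \<pi>) U))))"
  have "average k q' L ({opslot k t x |t x. t < k \<and> x \<in> A} \<union> {opperm k \<rho> |\<rho>. \<rho> permutes {..<k}})"
    unfolding average_def
  proof (intro conjI ballI)
    show "lin_on msc msc (Op k) q'"
      unfolding q'_def
      by (rule lin_onI) (simp_all add: opmul_add opmul_msc lin_on_add[OF q_lin] lin_on_scale[OF q_lin] Po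
          sum.distrib mat.scale_sum_right[symmetric] mat.scale_right_distrib mat.scale_left_commute)
    show "q' U \<in> L" if "U \<in> Op k" for U
      unfolding q'_def using Ls inv
      by (intro mat.subspace_scale mat.subspace_sum Lmul qL Po that calA_perm) (auto simp: S_def)
    show "q' U = U" if U: "U \<in> L" for U
    proof -
      have "(\<Sum>\<pi>\<in>S. opmul k (opperm k (pinv \<pi>)) (q (opmul k (opperm k \<pi>) U))) = (\<Sum>\<pi>\<in>S. U)"
      proof (intro sum.cong refl)
        fix \<pi> assume "\<pi> \<in> S"
        then have \<pi>: "\<pi> permutes {..<k}" by (simp add: S_def)
        have "opmul k (opperm k (pinv \<pi>)) (q (opmul k (opperm k \<pi>) U)) = opmul k (opone k) U"
          unfolding qid[OF Lmul[OF calA_perm[OF \<pi>] U]] opmul_assoc[symmetric]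
            opperm_mult[OF permutes_inv[OF \<pi>]] permutes_inv_o[OF \<pi>] ..
        then show "opmul k (opperm k (pinv \<pi>)) (q (opmul k (opperm k \<pi>) U)) = U"
          using opmul_one(1)[of U k] U Ls by (metis subsetD)
      qed
      also have "\<dots> = msc (fact k) U"
        unfolding mat.sum_constant_scale S(2) by simp
      finally have "q' U = msc (1 / fact k) (msc (fact k) U)" by (simp only: q'_def)
      then show ?thesis unfolding mat.scale_scale by simp
    qed
    fix y U :: "(nat \<Rightarrow> 'n, 'f) fmat"
    assume y: "y \<in> {opslot k t x |t x. t < k \<and> x \<in> A} \<union> {opperm k \<rho> |\<rho>. \<rho> permutes {..<k}}" and U: "U \<in> Op k"
    then consider t x where "y = opslot k t x" "t < k" "x \<in> A" | \<rho> where "y = opperm k \<rho>" "\<rho> permutes {..<k}" by blast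
    then show "q' (opmul k y U) = opmul k y (q' U)"
    proof cases
      case 1
      have "opmul k (opperm k (pinv \<pi>)) (q (opmul k (opperm k \<pi>) (opmul k (opslot k t x) U)))
          = opmul k (opslot k t x) (opmul k (opperm k (pinv \<pi>)) (q (opmul k (opperm k \<pi>) U)))" if "\<pi> \<in> S" for \<pi>
      proof -
        have \<pi>: "\<pi> permutes {..<k}" using that by (simp add: S_def)
        have t': "pinv \<pi> t < k" using permutes_in_image[OF permutes_inv[OF \<pi>], of t] 1(2) by simp
        have "opmul k (opperm k \<pi>) (opmul k (opslot k t x) U) = opmul k (opslot k (pinv \<pi> t) x) (opmul k (opperm k \<pi>) U)"
          unfolding opmul_assoc[symmetric] opperm_opslot[OF \<pi>] ..
        then have "q (opmul k (opperm k \<pi>) (opmul k (opslot k t x) U)) = opmul k (opslot k (pinv \<pi> t) x) (q (opmul k (opperm k \<pi>) U))"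
          using qc[OF t' 1(3) Po[OF that U]] by simp
        moreover have "opmul k (opperm k (pinv \<pi>)) (opslot k (pinv \<pi> t) x) = opmul k (opslot k t x) (opperm k (pinv \<pi>))"
          using opperm_opslot[OF permutes_inv[OF \<pi>], of "pinv \<pi> t" x]
          unfolding permutes_inv_inv[OF \<pi>] permutes_inverses(1)[OF \<pi>] .
        ultimately show ?thesis by (simp only: opmul_assoc[symmetric])
      qed
      then show ?thesis unfolding q'_def 1(1) opmul_msc opmul_sum
        by (intro arg_cong[where f="msc _"] sum.cong refl)
    next
      case 2
      \<comment> \<open>Written so that the terms for \<open>\<rho> U\<close> become terms for
        \<open>U\<close> at the new summation variable \<open>\<rho> \<circ> \<pi>\<close>, with the
        factor of \<rho> in front.\<close>
      let ?F = "\<lambda>\<pi>. opmul k (opmul k (opperm k \<rho>) (opperm k (pinv \<pi>))) (q (opmul k (opperm k \<pi>) U))"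
      have "opmul k (opperm k (pinv \<pi>)) (q (opmul k (opperm k \<pi>) (opmul k (opperm k \<rho>) U))) = ?F (\<rho> \<circ> \<pi>)" if "\<pi> \<in> S" for \<pi>
      proof -
        have \<pi>: "\<pi> permutes {..<k}" using that by (simp add: S_def)
        have "opmul k (opperm k \<rho>) (opperm k (pinv (\<rho> \<circ> \<pi>))) = opperm k (pinv (\<rho> \<circ> \<pi>) \<circ> \<rho>)"
          by (rule opperm_mult[OF 2(2)])
        also have "pinv (\<rho> \<circ> \<pi>) \<circ> \<rho> = pinv \<pi>"
          unfolding o_inv_distrib[OF permutes_bij[OF 2(2)] permutes_bij[OF \<pi>]] comp_assoc permutes_inv_o(2)[OF 2(2)] by simp
        finally show ?thesis unfolding opmul_assoc[symmetric] opperm_mult[OF \<pi>] by (rule arg_cong[OF sym])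
      qed
      then have "(\<Sum>\<pi>\<in>S. opmul k (opperm k (pinv \<pi>)) (q (opmul k (opperm k \<pi>) (opmul k (opperm k \<rho>) U)))) = (\<Sum>\<pi>\<in>S. ?F (\<rho> \<circ> \<pi>))"
        by (intro sum.cong refl)
      also have "\<dots> = (\<Sum>\<pi>\<in>S. ?F \<pi>)"
        unfolding S_def by (rule setum_permutations_compose_left[OF 2(2), symmetric])
      finally show ?thesis unfolding q'_def 2(1) opmul_msc opmul_sum opmul_assoc by simp
    qed
  qed
  then show ?thesis by blast
qed

lemma average_calA:
  assumes q: "average k q L ({opslot k t x |t x. t < k \<and> x \<in> A} \<union> {opperm k \<rho> |\<rho>. \<rho> permutes {..<k}})"
    and L: "left_ideal k L"
    and "Y \<in> calA k" and U: "U \<in> Op k"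
  shows "q (opmul k Y U) = opmul k Y (q U)"
  using \<open>Y \<in> calA k\<close>
proof (induction rule: calA_induct)
  case zero
  have "q 0 = 0" using q mat.lin_on_zero[OF _ Op_subspace] unfolding average_def by blast
  then show ?case by simp
next
  case (M \<pi> a)
  have qc: "q (opmul k (opslot k t x) V) = opmul k (opslot k t x) (q V)" if "t < k" "x \<in> A" "V \<in> Op k" for t x V
    using q that unfolding average_def by blast
  define a' where "a' = (\<lambda>j s. if s < j then a s else mone)"
  have slots: "q (opmul k (M k id (a' j)) V) = opmul k (M k id (a' j)) (q V)" if "j \<le> k" "V \<in> Op k" for j V
    using that(1)
  proof (induction j)
    case 0
    have qV: "q V \<in> Op k" using q that(2) L unfolding average_def left_ideal_def by blast
    have e: "a' 0 = (\<lambda>_. mone)" by (auto simp: a'_def)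
    show ?case unfolding e opmul_one(1)[OF that(2)] opmul_one(1)[OF qV] ..
  next
    case (Suc j)
    have "M k id (a' (Suc j)) = opmul k (opslot k j (a j)) (M k id (a' j))"
      unfolding a'_def by (rule M_slots)
    moreover have "opmul k (M k id (a' j)) V \<in> Op k" by (intro Op_opmul Op_M permutes_id that)
    moreover have "j < k" "j \<le> k" using Suc.prems by auto
    ultimately show ?case using qc[OF \<open>j < k\<close> M(2)] Suc.IH[OF \<open>j \<le> k\<close>]
      by (simp only: opmul_assoc)
  qed
  have P: "opmul k (opperm k \<pi>) U \<in> Op k" by (intro Op_opmul Op_M U M)
  have "q (opmul k (opperm k \<pi>) U) = opmul k (opperm k \<pi>) (q U)"
    using q U M(1) unfolding average_def by blast
  then show ?case unfolding M_slots_perm[of k \<pi> a] opmul_assoc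
    using slots[of k, OF le_refl P] unfolding a'_def by (simp only:)
next
  case (add X Y)
  have q_lin: "lin_on msc msc (Op k) q" using q unfolding average_def by blast
  show ?case unfolding opmul_add using add
    by (simp add: lin_on_add[OF q_lin] Op_opmul calA_Op U)
next
  case (scale c X)
  have q_lin: "lin_on msc msc (Op k) q" using q unfolding average_def by blast
  show ?case unfolding opmul_msc using scale
    by (simp add: lin_on_scale[OF q_lin] Op_opmul calA_Op U)
qed

section \<open>Regularity of \<open>calA k\<close>, its trace form and the orthogonal
  projection\<close>

interpretation matpair: vector_space_pair "msc :: 'f \<Rightarrow> (nat \<Rightarrow> 'n, 'f) fmat \<Rightarrow> _" "msc :: 'f \<Rightarrow> (nat \<Rightarrow> 'n, 'f) fmat \<Rightarrow> _"
  by unfold_locales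

text \<open>A \<open>calA k\<close>-linear retraction \<open>q\<close> onto the left ideal generated
  by \<open>Y\<close> sends 1 to some \<open>Z Y\<close>; then
  \<open>Y = q Y = Y (q 1) = Y Z Y\<close>.\<close>

lemma calA_von_Neumann_regular:
  assumes Y: "Y \<in> calA k"
  shows "\<exists>Z\<in>calA k. opmul k Y (opmul k Z Y) = Y"
proof -
  define L where "L = {opmul k Z Y |Z. Z \<in> calA k}"
  have sub: "mat.subspace L"
    unfolding mat.subspace_def
  proof (intro conjI ballI allI)
    show "0 \<in> L" unfolding L_def using calA_zero opmul_zero(1) by (metis (mono_tags, lifting) mem_Collect_eq)
    show "U + V \<in> L" if "U \<in> L" "V \<in> L" for U V
      using that unfolding L_def by (clarsimp simp: opmul_add[symmetric]) (metis calA_add)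
    show "msc c U \<in> L" if "U \<in> L" for c U
      using that unfolding L_def by (clarsimp simp: opmul_msc[symmetric]) (metis calA_msc)
  qed
  have L: "left_ideal k L"
    unfolding left_ideal_def
  proof (intro conjI sub ballI subsetI)
    show "U \<in> Op k" if "U \<in> L" for U using that Y by (auto simp: L_def calA_Op Op_opmul)
    show "opmul k Z U \<in> L" if "Z \<in> calA k" "U \<in> L" for Z U
      using that unfolding L_def by (clarsimp simp: opmul_assoc[symmetric]) (metis calA_mult)
  qed
  \<comment> \<open>A left inverse of the identity on \<open>L\<close> is a linear retraction onto
    \<open>L\<close>, from which the averaging starts.\<close>
  have "Vector_Spaces.linear msc msc (id :: (nat \<Rightarrow> 'n, 'f) fmat \<Rightarrow> _)"
    by (rule mat.linear_id)
  then obtain p :: "(nat \<Rightarrow> 'n, 'f) fmat \<Rightarrow> (nat \<Rightarrow> 'n, 'f) fmat"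
    where p: "range p \<subseteq> L" "Vector_Spaces.linear msc msc p" "\<And>v. v \<in> L \<Longrightarrow> p v = v"
    using matpair.linear_exists_left_inverse_on[of id L] sub by auto
  interpret p: Vector_Spaces.linear msc msc p by fact
  have "average k p L {}"
    using p unfolding average_def by (auto intro!: lin_onI simp: p.add p.scale)
  then obtain q where q: "average k q L ({opslot k t x |t x. t < k \<and> x \<in> A} \<union> {opperm k \<rho> |\<rho>. \<rho> permutes {..<k}})"
    using average_slots[OF L, of p k] average_perms[OF L] by blast
  have one: "opone k \<in> Op k" by (intro Op_M permutes_id)
  have "q (opone k) \<in> L" using q one unfolding average_def by blast
  then obtain Z where Z: "Z \<in> calA k" "q (opone k) = opmul k Z Y" unfolding L_def by blast
  have "Y \<in> L" unfolding L_def using calA_one opmul_one(1)[OF calA_Op[OF Y]] by (metis (mono_tags, lifting) mem_Collect_eq)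
  then have "q Y = Y" using q unfolding average_def by blast
  moreover have "q Y = opmul k Y (opmul k Z Y)"
    using average_calA[OF q L Y one] Z(2) opmul_one(2)[OF calA_Op[OF Y]] by simp
  ultimately show ?thesis using Z(1) by metis
qed

text \<open>With \<open>Y = Y Z Y\<close> the product \<open>Y Z\<close> is an idempotent of trace
  zero, hence zero, and \<open>Y = (Y Z) Y\<close> vanishes with it.\<close>

lemma calA_trace_nondegenerate:
  assumes Y: "Y \<in> calA k" and 0: "\<And>Z. Z \<in> calA k \<Longrightarrow> optr k (opmul k Y Z) = 0"
  shows "Y = 0"
proof -
  obtain Z where Z: "Z \<in> calA k" "opmul k Y (opmul k Z Y) = Y" using calA_von_Neumann_regular[OF Y] by blast
  have "opmul k Y Z = 0"
  proof (rule op_idempotent_trace_zero)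
    show "opmul k Y Z \<in> Op k" using Y Z by (intro calA_Op calA_mult)
    show "opmul k (opmul k Y Z) (opmul k Y Z) = opmul k Y Z" using Z(2) by (metis opmul_assoc)
    show "optr k (opmul k Y Z) = 0" by (rule 0[OF Z(1)])
  qed
  then show ?thesis using Z(2) by (metis opmul_assoc opmul_zero(1))
qed

lemma calA_eqI:
  assumes "Y \<in> calA k" "Y' \<in> calA k" "\<And>Z. Z \<in> calA k \<Longrightarrow> optr k (opmul k Y Z) = optr k (opmul k Y' Z)"
  shows "Y = Y'"
proof -
  have "Y - Y' = 0"
  proof (rule calA_trace_nondegenerate)
    show "Y - Y' \<in> calA k" using assms mat.subspace_diff[OF calA_subspace] by blast
    fix Z assume Z: "Z \<in> calA k"
    have "optr k (opmul k Y Z) = optr k (opmul k (Y - Y') Z) + optr k (opmul k Y' Z)"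
      unfolding optr_add[symmetric] opmul_add[symmetric] by simp
    then show "optr k (opmul k (Y - Y') Z) = 0" using assms(3)[OF Z] by simp
  qed
  then show ?thesis by simp
qed

lemma calA_projection_exists: "\<exists>Y\<in>calA k. \<forall>Z\<in>calA k. optr k (opmul k Y Z) = optr k (opmul k X Z)"
proof (rule mat.nondegenerate_represents_functional[OF calA_subspace finite_opunits calA_span])
  show "lin_on msc (*) (calA k) (\<lambda>w. optr k (opmul k w z))" for z
    by (rule lin_onI) (simp_all add: opmul_add opmul_msc optr_add optr_msc)
  show "lin_on msc (*) (calA k) (\<lambda>z. optr k (opmul k w z))" for w
    by (rule lin_onI) (simp_all add: opmul_add opmul_msc optr_add optr_msc)
  show "lin_on msc (*) (calA k) (\<lambda>z. optr k (opmul k X z))"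
    by (rule lin_onI) (simp_all add: opmul_add opmul_msc optr_add optr_msc)
  show "z = 0" if "z \<in> calA k" "\<And>w. w \<in> calA k \<Longrightarrow> optr k (opmul k w z) = 0" for z
    by (rule calA_trace_nondegenerate[OF that(1)]) (use that(2) optr_comm in metis)
qed

text \<open>The projection onto \<open>calA k\<close> orthogonal for the trace form; it plays the role of the
  Reynolds operator.\<close>
definition reynolds :: "nat \<Rightarrow> (nat \<Rightarrow> 'n, 'f) fmat \<Rightarrow> (nat \<Rightarrow> 'n, 'f) fmat" where
  "reynolds k X = (SOME Y. Y \<in> calA k \<and> (\<forall>Z\<in>calA k. optr k (opmul k Y Z) = optr k (opmul k X Z)))"

lemma reynolds_calA: "reynolds k X \<in> calA k"
  and reynolds_optr: "Z \<in> calA k \<Longrightarrow> optr k (opmul k (reynolds k X) Z) = optr k (opmul k X Z)"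
proof -
  have "reynolds k X \<in> calA k \<and> (\<forall>Z\<in>calA k. optr k (opmul k (reynolds k X) Z) = optr k (opmul k X Z))"
    unfolding reynolds_def using calA_projection_exists[of k X]
    by (intro someI_ex[of "\<lambda>Y. Y \<in> calA k \<and> (\<forall>Z\<in>calA k. optr k (opmul k Y Z) = optr k (opmul k X Z))"]) blast
  then show "reynolds k X \<in> calA k" "Z \<in> calA k \<Longrightarrow> optr k (opmul k (reynolds k X) Z) = optr k (opmul k X Z)" by auto
qed

lemma reynolds_eqI: "Y \<in> calA k \<Longrightarrow> (\<And>Z. Z \<in> calA k \<Longrightarrow> optr k (opmul k Y Z) = optr k (opmul k X Z)) \<Longrightarrow> reynolds k X = Y"
  by (rule calA_eqI[OF reynolds_calA]) (simp_all add: reynolds_optr)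

lemma reynolds_id: "Y \<in> calA k \<Longrightarrow> reynolds k Y = Y"
  by (rule reynolds_eqI) auto

lemma reynolds_add: "reynolds k (X + Y) = reynolds k X + reynolds k Y"
  by (rule reynolds_eqI) (simp_all add: calA_add reynolds_calA opmul_add optr_add reynolds_optr)

lemma reynolds_msc: "reynolds k (msc c X) = msc c (reynolds k X)"
  by (rule reynolds_eqI) (simp_all add: calA_msc reynolds_calA opmul_msc optr_msc reynolds_optr)

lemma reynolds_zero: "reynolds k 0 = 0"
  by (rule reynolds_id[OF calA_zero])

lemma reynolds_sum: "reynolds k (\<Sum>q\<in>Q. h q) = (\<Sum>q\<in>Q. reynolds k (h q))"
proof (induction Q rule: infinite_finite_induct)
  case (insert q Q)
  then show ?case unfolding sum.insert[OF insert.hyps] reynolds_add by simp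
qed (auto simp: reynolds_zero)

text \<open>By cyclicity of the trace \<open>Y\<close> moves onto the test element \<open>Z\<close>,
  and \<open>Z Y\<close> is again in \<open>calA k\<close>.\<close>

lemma reynolds_left: "Y \<in> calA k \<Longrightarrow> reynolds k (opmul k Y X) = opmul k Y (reynolds k X)"
proof (rule reynolds_eqI)
  fix Z assume Y: "Y \<in> calA k" and Z: "Z \<in> calA k"
  have "optr k (opmul k (opmul k Y (reynolds k X)) Z) = optr k (opmul k (reynolds k X) (opmul k Z Y))"
    by (metis opmul_assoc optr_comm)
  also have "\<dots> = optr k (opmul k X (opmul k Z Y))" by (rule reynolds_optr[OF calA_mult[OF Z Y]])
  also have "\<dots> = optr k (opmul k (opmul k Y X) Z)" by (metis opmul_assoc optr_comm)
  finally show "optr k (opmul k (opmul k Y (reynolds k X)) Z) = optr k (opmul k (opmul k Y X) Z)" .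
qed (simp_all add: calA_mult reynolds_calA)

lemma reynolds_right: "Y \<in> calA k \<Longrightarrow> reynolds k (opmul k X Y) = opmul k (reynolds k X) Y"
proof (rule reynolds_eqI)
  fix Z assume Y: "Y \<in> calA k" and Z: "Z \<in> calA k"
  then show "optr k (opmul k (opmul k (reynolds k X) Y) Z) = optr k (opmul k (opmul k X Y) Z)"
    by (simp add: opmul_assoc reynolds_optr calA_mult)
qed (simp_all add: calA_mult reynolds_calA)

end

section \<open>Trace polynomials\<close>

text \<open>For \<open>Y = M k \<pi> c\<close> this is a product over the cycles of \<pi> of traces
  of words in the \<open>c s\<close> and \<open>X s\<close>, so elements of \<open>calA k\<close>
  give multilinear pure trace functions.\<close>

definition form :: "nat \<Rightarrow> (nat \<Rightarrow> 'n::finite, 'f::comm_ring_1) fmat \<Rightarrow> (nat \<Rightarrow> ('n, 'f) fmat) \<Rightarrow> 'f" where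
  "form k Y X = optr k (opmul k Y (M k id X))"

definition tens :: "nat \<Rightarrow> (nat \<Rightarrow> 'n, 'f::comm_ring_1) fmat \<Rightarrow> ('n, 'f) fmat \<Rightarrow> (nat \<Rightarrow> 'n, 'f) fmat" where
  "tens k Y a = (\<lambda>I J. Y I J * a (I k) (J k))"

text \<open>Partial trace of \<open>Y (1 \<otimes> a)\<close> over the last slot.\<close>
definition ptr :: "nat \<Rightarrow> ('n::finite, 'f::comm_ring_1) fmat \<Rightarrow> (nat \<Rightarrow> 'n, 'f) fmat \<Rightarrow> (nat \<Rightarrow> 'n, 'f) fmat" where
  "ptr k a Y = (\<lambda>I J. \<Sum>i\<in>UNIV. \<Sum>j\<in>UNIV. Y (I(k := i)) (J(k := j)) * a j i)"

lemma permutes_Suc: "\<pi> permutes {..<k} \<Longrightarrow> \<pi> permutes {..<Suc k}"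
  by (erule permutes_subset) auto

lemma permutes_lessThan_fixes: "\<pi> permutes {..<k} \<Longrightarrow> \<pi> k = k" for k :: nat
  by (simp add: permutes_not_in)

lemma permutes_restrict_Suc: "\<pi> permutes {..<Suc k} \<Longrightarrow> \<pi> k = k \<Longrightarrow> \<pi> permutes {..<k}"
  by (rule permutes_superset) (auto simp: less_Suc_eq)

lemma tens_M: "\<pi> permutes {..<k} \<Longrightarrow> tens k (M k \<pi> c) a = M (Suc k) \<pi> (c(k := a))"
  by (auto simp: tens_def M_def permutes_lessThan_fixes fun_eq_iff intro!: prod.cong)

lemma M_Suc_id: "M (Suc k) id X = tens k (M k id X) (X k)"
  by (subst tens_M) (simp_all add: permutes_id)

lemma tens_add: "tens k (X + Y) a = tens k X a + tens k Y a"
  by (simp add: tens_def fun_eq_iff algebra_simps plus_fun_apply)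

lemma tens_msc: "tens k (msc c X) a = msc c (tens k X a)"
  by (simp add: tens_def msc_def fun_eq_iff algebra_simps)

lemma tens_zero: "tens k 0 a = 0"
  by (simp add: tens_def fun_eq_iff zero_fun_apply)

lemma ptr_add: "ptr k a (X + Y) = ptr k a X + ptr k a Y"
  by (simp add: ptr_def fun_eq_iff algebra_simps sum.distrib plus_fun_apply)

lemma ptr_msc: "ptr k a (msc c X) = msc c (ptr k a X)"
  by (simp add: ptr_def msc_def fun_eq_iff sum_distrib_left algebra_simps)

lemma ptr_zero: "ptr k a 0 = 0"
  by (simp add: ptr_def fun_eq_iff zero_fun_apply)

text \<open>Tensoring with \<open>a\<close> and the partial trace against \<open>a\<close> are
  adjoint for the trace pairing. Both commutation rules for \<open>reynolds\<close>,
  \<open>reynolds_tens\<close> and \<open>reynolds_ptr\<close>, rest on this.\<close>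

lemma optr_tens:
  assumes Y: "Y \<in> Op k"
  shows "optr (Suc k) (opmul (Suc k) Z (tens k Y a)) = optr k (opmul k (ptr k a Z) Y)"
proof -
  have Y': "Y (J(k := j)) (I(k := i)) = Y J I" for I J i j by (rule OpD[OF Y]) auto
  have "optr (Suc k) (opmul (Suc k) Z (tens k Y a))
      = (\<Sum>I\<in>Ix k. \<Sum>i\<in>UNIV. \<Sum>J\<in>Ix k. \<Sum>j\<in>UNIV. Z (I(k := i)) (J(k := j)) * (Y J I * a j i))"
    by (simp add: optr_def opmul_def Ix_Suc_sum tens_def Y')
  also have "\<dots> = (\<Sum>I\<in>Ix k. \<Sum>J\<in>Ix k. \<Sum>i\<in>UNIV. \<Sum>j\<in>UNIV. Z (I(k := i)) (J(k := j)) * (Y J I * a j i))"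
    by (intro sum.cong refl sum.swap)
  also have "\<dots> = optr k (opmul k (ptr k a Z) Y)"
    by (simp add: optr_def opmul_def ptr_def sum_distrib_right sum_distrib_left mult_ac)
  finally show ?thesis .
qed

lemma form_Suc: "form (Suc k) Y X = form k (ptr k (X k) Y) X"
  unfolding form_def M_Suc_id by (rule optr_tens) (intro Op_M permutes_id)

lemma form_cong: "(\<And>s. s < k \<Longrightarrow> X s = X' s) \<Longrightarrow> form k Y X = form k Y X'"
  unfolding form_def using M_cong[of k X X' id id] by simp

lemma form_add: "form k (Y + Z) X = form k Y X + form k Z X"
  by (simp add: form_def opmul_add optr_add)

lemma form_msc: "form k (msc c Y) X = c * form k Y X"
  by (simp add: form_def opmul_msc optr_msc)

lemma form_zero: "form k 0 X = 0"
  by (simp add: form_def)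

lemma optr_sum: "optr k (\<Sum>q\<in>Q. h q) = (\<Sum>q\<in>Q. optr k (h q))"
  by (induction Q rule: infinite_finite_induct) (auto simp: optr_add)

lemma form_slot_sum:
  "s < k \<Longrightarrow> form k Y (X(s := (\<Sum>q\<in>Q. msc (c q) (x q)))) = (\<Sum>q\<in>Q. c q * form k Y (X(s := x q)))"
  by (simp only: form_def M_sum_slot opmul_sum opmul_msc optr_sum optr_msc)

lemma form_slot_msc: "s < k \<Longrightarrow> form k Y (X(s := msc c x)) = c * form k Y (X(s := x))"
  using form_slot_sum[of s k Y X "\<lambda>_. c" "\<lambda>_. x" "{()}"] by simp

lemma form_slot_add:
  assumes "s < k"
  shows "form k Y (X(s := x + y)) = form k Y (X(s := x)) + form k Y (X(s := y))"
  using form_slot_sum[OF assms, of Y X "\<lambda>_. 1" "\<lambda>b. if b then x else y" UNIV]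
  by (simp add: UNIV_bool add.commute msc_def)

text \<open>After multiplication by the variables \<open>c s\<close> is followed by
  \<open>X (\<pi> s)\<close>, so a right factor of the former is a left factor of the
  latter.\<close>

lemma M_slot_move:
  assumes \<pi>: "\<pi> permutes {..<k}"
  shows "form k (M k \<pi> (c(s := mmul (c s) b))) X = form k (M k \<pi> c) (X(\<pi> s := mmul b (X (\<pi> s))))"
proof -
  have "mmul ((c(s := mmul (c s) b)) r) (X (\<pi> r)) = mmul (c r) ((X(\<pi> s := mmul b (X (\<pi> s)))) (\<pi> r))" for r
    using permutes_inj[OF \<pi>] by (auto simp: mmul_assoc inj_eq)
  then show ?thesis unfolding form_def M_mult[OF \<pi>] by (simp only:)
qed

text \<open>A fixed point of \<pi> is a cycle of length one, so its slot contributes only a scalar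
  trace.\<close>

lemma ptr_M_fixed:
  assumes \<pi>: "\<pi> permutes {..<k}"
  shows "ptr k a (M (Suc k) \<pi> c) = msc (mtrace (mmul (c k) a)) (M k \<pi> c)"
proof (intro ext)
  fix I J
  have "M (Suc k) \<pi> c (I(k := i)) (J(k := j)) = M k \<pi> c I J * c k i j" for i j
  proof -
    have "(\<Prod>s<k. c s ((I(k := i)) s) ((J(k := j)) (\<pi> s))) = (\<Prod>s<k. c s (I s) (J (\<pi> s)))"
    proof (intro prod.cong refl)
      fix s assume "s \<in> {..<k}"
      then have "s < k" "\<pi> s < k" using permutes_in_image[OF \<pi>, of s] by auto
      then show "c s ((I(k := i)) s) ((J(k := j)) (\<pi> s)) = c s (I s) (J (\<pi> s))" by simp
    qed
    then show ?thesis by (simp add: M_def permutes_lessThan_fixes[OF \<pi>])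
  qed
  then show "ptr k a (M (Suc k) \<pi> c) I J = msc (mtrace (mmul (c k) a)) (M k \<pi> c) I J"
    by (simp add: ptr_def msc_def mtrace_def mmul_def sum_distrib_right sum_distrib_left mult_ac)
qed

text \<open>Removes \<open>k\<close> from its cycle: the predecessor of \<open>k\<close> is sent to
  \<open>\<pi> k\<close>, and \<open>k\<close> becomes fixed.\<close>

definition contract :: "nat \<Rightarrow> (nat \<Rightarrow> nat) \<Rightarrow> nat \<Rightarrow> nat" where
  "contract k \<pi> = Transposition.transpose k (\<pi> k) \<circ> \<pi>"

lemma contract_permutes:
  assumes "\<pi> permutes {..<Suc k}"
  shows "contract k \<pi> permutes {..<k}"
proof (rule permutes_restrict_Suc)
  have "\<pi> k < Suc k" using permutes_in_image[OF assms, of k] by simp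
  then show "contract k \<pi> permutes {..<Suc k}"
    unfolding contract_def by (intro permutes_compose[OF assms] permutes_swap_id) auto
  show "contract k \<pi> k = k" by (simp add: contract_def)
qed

text \<open>Summing out slot \<open>k\<close> glues the coefficients along the piece
  \<open>pinv \<pi> k\<close>, \<open>k\<close>, \<open>\<pi> k\<close> of the cycle, with
  \<open>a\<close> between the coefficients of the first two.\<close>

lemma ptr_M_moved:
  assumes \<pi>: "\<pi> permutes {..<Suc k}" and k: "\<pi> k \<noteq> k"
  shows "ptr k a (M (Suc k) \<pi> c)
    = M k (contract k \<pi>) (c(pinv \<pi> k := mmul (c (pinv \<pi> k)) (mmul a (c k))))"
proof (intro ext)
  fix I J
  define s0 where "s0 = pinv \<pi> k"
  have s0: "\<pi> s0 = k" unfolding s0_def by (rule permutes_inverses(1)[OF \<pi>])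
  have s0k: "s0 < k"
  proof -
    have "s0 \<in> {..<Suc k}" using permutes_in_image[OF \<pi>, of s0] s0 by simp
    moreover have "s0 \<noteq> k" using s0 k by auto
    ultimately show ?thesis by simp
  qed
  have pk: "\<pi> k < k" using permutes_in_image[OF \<pi>, of k] k by simp
  have other: "\<pi> s < k \<and> contract k \<pi> s = \<pi> s" if "s \<in> {..<k} - {s0}" for s
  proof -
    have "\<pi> s \<noteq> k" using that s0 permutes_inj[OF \<pi>] by (metis DiffD2 injD singletonI)
    moreover have "\<pi> s \<noteq> \<pi> k" using that permutes_inj[OF \<pi>] by (auto dest: injD)
    moreover have "\<pi> s < Suc k" using permutes_in_image[OF \<pi>, of s] that by auto
    ultimately show ?thesis by (simp add: contract_def transpose_def)
  qed
  define P where "P = (\<Prod>s\<in>{..<k} - {s0}. c s (I s) (J (\<pi> s)))"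
  have "M (Suc k) \<pi> c (I(k := i)) (J(k := j)) = P * (c s0 (I s0) j * c k i (J (\<pi> k)))" for i j
  proof -
    have "(\<Prod>s<k. c s ((I(k := i)) s) ((J(k := j)) (\<pi> s)))
        = c s0 (I s0) j * (\<Prod>s\<in>{..<k} - {s0}. c s ((I(k := i)) s) ((J(k := j)) (\<pi> s)))"
      using s0k s0 by (subst prod.remove[of _ s0]) auto
    also have "(\<Prod>s\<in>{..<k} - {s0}. c s ((I(k := i)) s) ((J(k := j)) (\<pi> s))) = P"
      unfolding P_def
    proof (intro prod.cong refl)
      fix s assume s: "s \<in> {..<k} - {s0}"
      then show "c s ((I(k := i)) s) ((J(k := j)) (\<pi> s)) = c s (I s) (J (\<pi> s))"
        using other[OF s] by simp
    qed
    finally show ?thesis using pk by (simp add: M_def mult_ac)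
  qed
  then have "ptr k a (M (Suc k) \<pi> c) I J
      = P * (\<Sum>i\<in>UNIV. \<Sum>j\<in>UNIV. c s0 (I s0) j * (a j i * c k i (J (\<pi> k))))"
    by (simp add: ptr_def sum_distrib_left mult_ac)
  also have "(\<Sum>i\<in>UNIV. \<Sum>j\<in>UNIV. c s0 (I s0) j * (a j i * c k i (J (\<pi> k)))) = mmul (c s0) (mmul a (c k)) (I s0) (J (\<pi> k))"
    unfolding mmul_def sum_distrib_left by (rule sum.swap)
  also have "P * \<dots> = M k (contract k \<pi>) (c(s0 := mmul (c s0) (mmul a (c k)))) I J"
  proof -
    have "contract k \<pi> s0 = \<pi> k" by (simp add: contract_def s0)
    moreover have "(\<Prod>s\<in>{..<k} - {s0}. (c(s0 := mmul (c s0) (mmul a (c k)))) s (I s) (J (contract k \<pi> s))) = P"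
      unfolding P_def by (intro prod.cong refl) (use other in auto)
    ultimately show ?thesis
      unfolding M_def using s0k by (subst prod.remove[of _ s0]) (auto simp: mult_ac)
  qed
  finally show "ptr k a (M (Suc k) \<pi> c) I J
    = M k (contract k \<pi>) (c(pinv \<pi> k := mmul (c (pinv \<pi> k)) (mmul a (c k)))) I J"
    unfolding s0_def .
qed

lemma mtrace_munit: "mtrace (mmul a (munit j i)) = a i j" "mtrace (mmul (munit j i) a) = a i j"
proof -
  have "mtrace (mmul a (munit j i)) = (\<Sum>l\<in>UNIV. if l = i then \<Sum>m\<in>UNIV. if m = j then a l m else 0 else 0)"
    unfolding mtrace_def mmul_def munit_def by (intro sum.cong refl) (auto intro!: sum.cong)
  then show "mtrace (mmul a (munit j i)) = a i j" by simp
  have "mtrace (mmul (munit j i) a) = (\<Sum>l\<in>UNIV. if l = j then \<Sum>m\<in>UNIV. if m = i then a m l else 0 else 0)"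
    unfolding mtrace_def mmul_def munit_def by (intro sum.cong refl) (auto intro!: sum.cong)
  then show "mtrace (mmul (munit j i) a) = a i j" by simp
qed

section \<open>Trace polynomials represented by elements of \<open>calA k\<close>\<close>

primrec tsub :: "(nat \<Rightarrow> ('f, 'm) tpoly) \<Rightarrow> ('f, 'm) tpoly \<Rightarrow> ('f, 'm) tpoly" where
  "tsub \<tau> (TVar i) = \<tau> i"
| "tsub \<tau> (TElem a) = TElem a"
| "tsub \<tau> (TSc c) = TSc c"
| "tsub \<tau> (TAdd p q) = TAdd (tsub \<tau> p) (tsub \<tau> q)"
| "tsub \<tau> (TMul p q) = TMul (tsub \<tau> p) (tsub \<tau> q)"
| "tsub \<tau> (TTr p) = TTr (tsub \<tau> p)"

lemma teval_tsub: "teval ad mu sc el tr \<sigma> (tsub \<tau> p) = teval ad mu sc el tr (\<lambda>s. teval ad mu sc el tr \<sigma> (\<tau> s)) p"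
  by (induction p) auto

lemma tconsts_tsub: "tconsts p \<subseteq> A \<Longrightarrow> (\<And>s. tconsts (\<tau> s) \<subseteq> A) \<Longrightarrow> tconsts (tsub \<tau> p) \<subseteq> A"
  by (induction p) auto

abbreviation "mev \<equiv> teval madd mmul (\<lambda>c. msc c mone) id mtr"

context regular_matrix_algebra
begin

lemma calA_tens: "Y \<in> calA k \<Longrightarrow> a \<in> A \<Longrightarrow> tens k Y a \<in> calA (Suc k)"
  by (induction rule: calA_induct)
    (auto simp: tens_zero tens_M tens_add tens_msc intro!: calA_zero calA_add calA_msc calA_M permutes_Suc)

lemma calA_ptr:
  assumes "Y \<in> calA (Suc k)" "a \<in> A"
  shows "ptr k a Y \<in> calA k"
  using assms(1)
proof (induction rule: calA_induct)
  case (M \<pi> c)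
  show ?case
  proof (cases "\<pi> k = k")
    case True
    show ?thesis unfolding ptr_M_fixed[OF permutes_restrict_Suc[OF M(1) True]]
      by (intro calA_msc calA_M M permutes_restrict_Suc[OF M(1) True])
  next
    case False
    show ?thesis unfolding ptr_M_moved[OF M(1) False]
      by (intro calA_M contract_permutes M) (use M(2) assms(2) A_mult in auto)
  qed
qed (auto simp: ptr_zero ptr_add ptr_msc intro!: calA_zero calA_add calA_msc)

text \<open>Adjointness turns a test against \<open>calA (Suc k)\<close> into a test against partial
  traces, which lie in \<open>calA k\<close>.\<close>

lemma reynolds_tens:
  assumes X: "X \<in> Op k"
  shows "reynolds (Suc k) (tens k X mone) = tens k (reynolds k X) mone"
proof (rule reynolds_eqI)
  show "tens k (reynolds k X) mone \<in> calA (Suc k)" by (intro calA_tens reynolds_calA A_one)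
  fix Z assume Z: "Z \<in> calA (Suc k)"
  have P: "ptr k mone Z \<in> calA k" by (rule calA_ptr[OF Z A_one])
  have *: "optr (Suc k) (opmul (Suc k) (tens k Y mone) Z) = optr k (opmul k Y (ptr k mone Z))" if "Y \<in> Op k" for Y
    unfolding optr_comm[of "Suc k" _ Z] optr_tens[OF that] by (rule optr_comm)
  show "optr (Suc k) (opmul (Suc k) (tens k (reynolds k X) mone) Z) = optr (Suc k) (opmul (Suc k) (tens k X mone) Z)"
    unfolding *[OF X] *[OF calA_Op[OF reynolds_calA]] by (rule reynolds_optr[OF P])
qed

lemma reynolds_ptr:
  assumes a: "a \<in> A"
  shows "reynolds k (ptr k a X) = ptr k a (reynolds (Suc k) X)"
proof (rule reynolds_eqI)
  show "ptr k a (reynolds (Suc k) X) \<in> calA k" by (intro calA_ptr reynolds_calA a)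
  fix Z assume Z: "Z \<in> calA k"
  show "optr k (opmul k (ptr k a (reynolds (Suc k) X)) Z) = optr k (opmul k (ptr k a X) Z)"
    unfolding optr_tens[OF calA_Op[OF Z], symmetric] by (intro reynolds_optr calA_tens Z a)
qed

text \<open>Slot \<open>0\<close> is the output: as \<open>tr (e\<^sub>j\<^sub>i F) = F\<^sub>i\<^sub>j\<close>, the form of \<open>Y\<close> with
  \<open>e\<^sub>j\<^sub>i\<close> in that slot is the entry \<open>(i, j)\<close> of a matrix valued polynomial.\<close>
definition rep :: "nat \<Rightarrow> (nat \<Rightarrow> 'n, 'f) fmat \<Rightarrow> ('f, ('n, 'f) fmat) tpoly \<Rightarrow> bool" where
  "rep k Y p \<longleftrightarrow> tconsts p \<subseteq> A \<and> (\<forall>X i j. mev X p i j = form k Y (X(0 := munit j i)))"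

text \<open>Induction on the number of variables, summing out the last slot. If it is fixed, a
  factor \<open>tr (c X)\<close> splits off; otherwise the word \<open>X c\<close> is inserted, for
  the contracted permutation, in front of the slot \<open>t0\<close> that follows it in its
  cycle.\<close>

lemma rep_M_exists:
  assumes "\<pi> permutes {..<Suc k}" "\<And>s. c s \<in> A"
  shows "\<exists>p. rep (Suc k) (M (Suc k) \<pi> c) p"
  using assms
proof (induction k arbitrary: \<pi> c)
  case 0
  have \<pi>: "\<pi> permutes {..<0}"
    by (rule permutes_restrict_Suc[OF 0(1)]) (use permutes_in_image[OF 0(1), of 0] in simp)
  have "form (Suc 0) (M (Suc 0) \<pi> c) (X(0 := munit j i)) = c 0 i j" for X i j
    unfolding form_Suc ptr_M_fixed[OF \<pi>] form_msc
    by (simp add: form_def optr_def opmul_def M_def Ix_0 mtrace_munit)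
  \<comment> \<open>Only the output slot is left, so the polynomial is the constant
    coefficient.\<close>
  then have "rep (Suc 0) (M (Suc 0) \<pi> c) (TElem (c 0))"
    using 0(2) by (simp add: rep_def)
  then show ?case by blast
next
  case (Suc k)
  let ?m = "Suc k"
  show ?case
  proof (cases "\<pi> ?m = ?m")
    case True
    note \<pi> = permutes_restrict_Suc[OF Suc.prems(1) True]
    obtain p where p: "rep ?m (M ?m \<pi> c) p" using Suc.IH[of \<pi> c] \<pi> Suc.prems(2) by blast
    have "rep (Suc ?m) (M (Suc ?m) \<pi> c) (TMul p (TTr (TMul (TElem (c ?m)) (TVar ?m))))"
      unfolding rep_def
    proof (intro conjI allI)
      show "tconsts (TMul p (TTr (TMul (TElem (c ?m)) (TVar ?m)))) \<subseteq> A"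
        using p Suc.prems(2) by (simp add: rep_def)
      fix X i j
      have "form (Suc ?m) (M (Suc ?m) \<pi> c) (X(0 := munit j i)) = mtrace (mmul (c ?m) (X ?m)) * mev X p i j"
        unfolding form_Suc[of ?m] ptr_M_fixed[OF \<pi>] form_msc using p by (simp add: rep_def)
      moreover have "mev X (TMul p (TTr (TMul (TElem (c ?m)) (TVar ?m)))) = msc (mtrace (mmul (c ?m) (X ?m))) (mev X p)"
        by (simp add: mtr_def mmul_msc)
      ultimately show "mev X (TMul p (TTr (TMul (TElem (c ?m)) (TVar ?m)))) i j = form (Suc ?m) (M (Suc ?m) \<pi> c) (X(0 := munit j i))"
        by (simp add: msc_def)
    qed
    then show ?thesis by blast
  next
    case False
    define \<pi>' where "\<pi>' = contract ?m \<pi>"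
    note \<pi>' = contract_permutes[OF Suc.prems(1), folded \<pi>'_def]
    obtain p where p: "rep ?m (M ?m \<pi>' c) p" using Suc.IH[of \<pi>' c] \<pi>' Suc.prems(2) by blast
    define s0 t0 where "s0 = pinv \<pi> ?m" and "t0 = \<pi> ?m"
    have t0: "t0 < ?m" using permutes_in_image[OF Suc.prems(1), of ?m] False by (simp add: t0_def)
    have s0t0: "\<pi>' s0 = t0"
      by (simp add: \<pi>'_def s0_def t0_def contract_def permutes_inverses(1)[OF Suc.prems(1)])
    have key: "form (Suc ?m) (M (Suc ?m) \<pi> c) X
        = form ?m (M ?m \<pi>' c) (X(t0 := mmul (mmul (X ?m) (c ?m)) (X t0)))" for X
      unfolding form_Suc[of ?m] ptr_M_moved[OF Suc.prems(1) False] \<pi>'_def[symmetric] s0_def[symmetric]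
        M_slot_move[OF \<pi>'] s0t0 ..
    show ?thesis
    proof (cases "t0 = 0")
      case True
      \<comment> \<open>Slot 0 carries \<open>munit j i\<close> and admits no substitution. Left
        multiplication of \<open>munit j i\<close> by a matrix combines the \<open>munit l i\<close>
        with weights from its column \<open>j\<close>, which amounts to right multiplication of the
        output.\<close>
      have "rep (Suc ?m) (M (Suc ?m) \<pi> c) (TMul p (TMul (TVar ?m) (TElem (c ?m))))"
        unfolding rep_def
      proof (intro conjI allI)
        show "tconsts (TMul p (TMul (TVar ?m) (TElem (c ?m)))) \<subseteq> A"
          using p Suc.prems(2) by (simp add: rep_def)
        fix X i j
        let ?b = "mmul (X ?m) (c ?m)"
        have "mmul ?b (munit j i) = (\<Sum>l\<in>UNIV. msc (?b l j) (munit l i))"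
        proof (intro ext)
          fix x y
          have "mmul ?b (munit j i) x y = (\<Sum>m\<in>UNIV. if m = j then if y = i then ?b x m else 0 else 0)"
            unfolding mmul_def[of ?b] munit_def by (intro sum.cong refl) auto
          moreover have "(\<Sum>l\<in>UNIV. msc (?b l j) (munit l i)) x y = (\<Sum>l\<in>UNIV. if x = l then if y = i then ?b l j else 0 else 0)"
            unfolding sum_fun2_apply msc_def munit_def by (intro sum.cong refl) auto
          ultimately show "mmul ?b (munit j i) x y = (\<Sum>l\<in>UNIV. msc (?b l j) (munit l i)) x y" by simp
        qed
        then have "form (Suc ?m) (M (Suc ?m) \<pi> c) (X(0 := munit j i))
            = form ?m (M ?m \<pi>' c) (X(0 := (\<Sum>l\<in>UNIV. msc (?b l j) (munit l i))))"
          unfolding key True by simp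
        also have "\<dots> = (\<Sum>l\<in>UNIV. ?b l j * mev X p i l)"
          using p by (subst form_slot_sum) (simp_all add: rep_def)
        also have "\<dots> = mev X (TMul p (TMul (TVar ?m) (TElem (c ?m)))) i j"
          by (simp add: mmul_def[of "mev X p"] mult.commute)
        finally show "mev X (TMul p (TMul (TVar ?m) (TElem (c ?m)))) i j = form (Suc ?m) (M (Suc ?m) \<pi> c) (X(0 := munit j i))" ..
      qed
      then show ?thesis by blast
    next
      case False
      define \<tau> :: "nat \<Rightarrow> ('f, ('n, 'f) fmat) tpoly"
        where "\<tau> = TVar(t0 := TMul (TMul (TVar ?m) (TElem (c ?m))) (TVar t0))"
      have "rep (Suc ?m) (M (Suc ?m) \<pi> c) (tsub \<tau> p)"
        unfolding rep_def
      proof (intro conjI allI tconsts_tsub)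
        show "tconsts p \<subseteq> A" "tconsts (\<tau> s) \<subseteq> A" for s
          using p Suc.prems(2) by (simp_all add: rep_def \<tau>_def)
        fix X i j
        have "(\<lambda>s. mev X (\<tau> s)) = X(t0 := mmul (mmul (X ?m) (c ?m)) (X t0))"
          by (auto simp: \<tau>_def)
        then have "mev X (tsub \<tau> p) i j = form ?m (M ?m \<pi>' c) (X(t0 := mmul (mmul (X ?m) (c ?m)) (X t0), 0 := munit j i))"
          unfolding teval_tsub using p by (simp add: rep_def)
        also have "\<dots> = form (Suc ?m) (M (Suc ?m) \<pi> c) (X(0 := munit j i))"
          unfolding key using False by (simp add: fun_upd_twist)
        finally show "mev X (tsub \<tau> p) i j = form (Suc ?m) (M (Suc ?m) \<pi> c) (X(0 := munit j i))" .
      qed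
      then show ?thesis by blast
    qed
  qed
qed

lemma rep_zero: "rep k 0 (TSc 0)"
  by (simp add: rep_def form_zero msc_def)

lemma rep_add: "rep k Y p \<Longrightarrow> rep k Z q \<Longrightarrow> rep k (Y + Z) (TAdd p q)"
  by (simp add: rep_def form_add madd_def)

lemma rep_msc: "rep k Y p \<Longrightarrow> rep k (msc c Y) (TMul (TSc c) p)"
  by (simp add: rep_def form_msc mmul_msc) (simp add: msc_def)

lemma rep_exists:
  assumes "Y \<in> calA (Suc k)"
  shows "\<exists>p. rep (Suc k) Y p"
  using assms by (induction rule: calA_induct) (use rep_zero rep_add rep_msc rep_M_exists in blast)+

end

section \<open>Evaluation of trace polynomials\<close>

abbreviation "slotswap k \<equiv> Transposition.transpose k (Suc k)"

lemma slotswap_permutes: "slotswap k permutes {..<Suc (Suc k)}"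
  by (rule permutes_swap_id) auto

text \<open>The swap puts \<open>X k\<close> and \<open>X (Suc k)\<close> next to each other on one
  cycle, while the adjoined unit slot contributes nothing between them: this is the kernel
  counterpart of substituting a product for a variable.\<close>

lemma form_mult:
  assumes Y: "Y \<in> Op (Suc k)"
  shows "form (Suc (Suc k)) (opmul (Suc (Suc k)) (opperm (Suc (Suc k)) (slotswap k)) (tens (Suc k) Y mone)) X
    = form (Suc k) Y (X(k := mmul (X k) (X (Suc k))))"
proof -
  let ?m = "Suc (Suc k)" and ?\<tau> = "slotswap k"
  have \<tau>: "?\<tau> permutes {..<?m}" by (rule slotswap_permutes)
  have inv: "pinv ?\<tau> (Suc k) = k" by simp
  have contr: "contract (Suc k) ?\<tau> = id"
    by (simp add: contract_def transpose_commute[of "Suc k" k])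
  have "form ?m (opmul ?m (opperm ?m ?\<tau>) (tens (Suc k) Y mone)) X
      = optr ?m (opmul ?m (opmul ?m (M ?m id X) (opperm ?m ?\<tau>)) (tens (Suc k) Y mone))"
    unfolding form_def by (subst optr_comm) (simp only: opmul_assoc)
  also have "opmul ?m (M ?m id X) (opperm ?m ?\<tau>) = M ?m ?\<tau> X"
    unfolding M_mult[OF permutes_id] by (simp only: mmul_one o_id)
  also have "optr ?m (opmul ?m (M ?m ?\<tau> X) (tens (Suc k) Y mone))
      = optr (Suc k) (opmul (Suc k) (ptr (Suc k) mone (M ?m ?\<tau> X)) Y)"
    by (rule optr_tens[OF Y])
  also have "ptr (Suc k) mone (M ?m ?\<tau> X) = M (Suc k) id (X(k := mmul (X k) (X (Suc k))))"
    by (subst ptr_M_moved[OF \<tau>]) (simp_all only: inv contr mmul_one transpose_apply_second n_not_Suc_n not_False_eq_True)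
  finally show ?thesis unfolding form_def by (simp only: optr_comm[of "Suc k" Y])
qed

lemma ptr_tens_mone:
  assumes Y: "Y \<in> Op k"
  shows "ptr k a (tens k Y mone) = msc (mtrace a) Y"
proof (intro ext)
  fix I J
  have "Y (I(k := i)) (J(k := j)) = Y I J" for i j by (rule OpD[OF Y]) auto
  then have "ptr k a (tens k Y mone) I J = (\<Sum>i\<in>UNIV. \<Sum>j\<in>UNIV. Y I J * ((if i = j then 1 else 0) * a j i))"
    by (simp add: ptr_def tens_def mone_def mult.assoc)
  also have "\<dots> = (\<Sum>i\<in>UNIV. Y I J * a i i)"
    unfolding sum_distrib_left[symmetric] by simp
  finally show "ptr k a (tens k Y mone) I J = msc (mtrace a) Y I J"
    by (simp add: msc_def mtrace_def sum_distrib_left sum_distrib_right mult.commute)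
qed

lemma form_tens: "Y \<in> Op k \<Longrightarrow> form (Suc k) (tens k Y mone) X = mtrace (X k) * form k Y X"
  by (simp add: form_Suc ptr_tens_mone form_msc)

lemma form_perm:
  assumes \<rho>: "\<rho> permutes {..<k}"
  shows "form k (opmul k (opperm k \<rho>) (opmul k Y (opperm k (pinv \<rho>)))) X = form k Y (X \<circ> pinv \<rho>)"
proof -
  have "form k (opmul k (opperm k \<rho>) (opmul k Y (opperm k (pinv \<rho>)))) X
      = optr k (opmul k Y (opmul k (opmul k (opperm k (pinv \<rho>)) (M k id X)) (opperm k \<rho>)))"
    unfolding form_def opmul_assoc by (subst optr_comm) (simp only: opmul_assoc)
  also have "opmul k (opmul k (opperm k (pinv \<rho>)) (M k id X)) (opperm k \<rho>) = M k id (X \<circ> pinv \<rho>)"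
    using permutes_inv_o(1)[OF \<rho>]
    by (simp only: M_mult[OF permutes_inv[OF \<rho>]] mmul_one id_o o_def[symmetric])
  finally show ?thesis by (simp only: form_def)
qed

text \<open>The trace of the swap against \<open>munit j i \<otimes> X 1\<close> is the trace of
  their product, so the swap represents a single variable.\<close>

lemma form_transpose: "form (Suc (Suc 0)) (opperm (Suc (Suc 0)) (slotswap 0)) (X(0 := munit j i)) = X (Suc 0) i j"
proof -
  have contr: "contract (Suc 0) (slotswap 0) = id"
    by (simp add: contract_def transpose_commute[of "Suc 0" 0])
  have inv: "pinv (slotswap 0) (Suc 0) = 0" by simp
  have 0: "id permutes {..<0::nat}" by (rule permutes_id)
  have "ptr (Suc 0) (X (Suc 0)) (opperm (Suc (Suc 0)) (slotswap 0)) = M (Suc 0) id ((\<lambda>_. mone)(0 := X (Suc 0)))"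
    by (subst ptr_M_moved[OF slotswap_permutes]) (simp_all only: inv contr mmul_one transpose_apply_second n_not_Suc_n not_False_eq_True)
  then have "form (Suc (Suc 0)) (opperm (Suc (Suc 0)) (slotswap 0)) (X(0 := munit j i))
      = form (Suc 0) (M (Suc 0) id ((\<lambda>_. mone)(0 := X (Suc 0)))) (X(0 := munit j i))"
    by (simp add: form_Suc[of "Suc 0"])
  also have "\<dots> = X (Suc 0) i j"
    unfolding form_Suc ptr_M_fixed[OF 0] form_msc
    by (simp add: form_def optr_def opmul_def M_def Ix_0 mtrace_munit)
  finally show ?thesis .
qed

section \<open>Well defined values in \<open>R\<close>\<close>

lemma mmul_uminus: "mmul (- X) Y = - mmul X Y"
  by (simp add: mmul_def fun_eq_iff sum_negf)

locale trace_identity_algebra = regular_matrix_algebra A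
  for A :: "('n::finite, 'f::field_char_0) fmat set" +
  fixes \<beta> :: "'f \<Rightarrow> 'r::ring_1" and \<alpha> :: "('n, 'f) fmat \<Rightarrow> 'r" and tr :: "'r \<Rightarrow> 'r"
  assumes alg: "A_algebra_with_trace A \<beta> \<alpha> tr"
    and identities: "\<And>p. Mn_trace_identity A p \<Longrightarrow> satisfies_identity \<beta> \<alpha> tr p"
begin

abbreviation "reval \<equiv> teval (+) (*) \<beta> \<alpha> tr"

lemma \<beta>_one: "\<beta> 1 = 1" and \<beta>_add: "\<beta> (a + b) = \<beta> a + \<beta> b" and \<beta>_mult: "\<beta> (a * b) = \<beta> a * \<beta> b"
  and \<alpha>_one: "\<alpha> mone = 1"
  by (insert alg[unfolded A_algebra_with_trace_def], (elim conjE, metis)+)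

lemma \<beta>_zero: "\<beta> 0 = 0"
  using \<beta>_add[of 0 0] by simp

lemma \<beta>_uminus_one: "\<beta> (- 1) = - 1"
  using \<beta>_add[of 1 "-1"] by (simp add: \<beta>_one \<beta>_zero eq_neg_iff_add_eq_0 add.commute)

text \<open>The difference of the two polynomials is an \<open>A\<close>-trace identity of the
  matrix algebra. Here the hypothesis on the identities of \<open>R\<close> enters, and it makes
  \<open>Ev\<close> independent of the chosen polynomial.\<close>

lemma reval_eqI:
  assumes "tconsts p \<subseteq> A" "tconsts q \<subseteq> A" and eq: "\<And>X. mev X p = mev X q"
  shows "reval \<sigma> p = reval \<sigma> q"
proof -
  have "Mn_trace_identity A (TAdd p (TMul (TSc (- 1)) q))"
    using assms unfolding Mn_trace_identity_def by (simp add: mmul_uminus madd_eq mzero_eq)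
  then have "reval \<sigma> (TAdd p (TMul (TSc (- 1)) q)) = 0"
    using identities unfolding satisfies_identity_def by blast
  then show ?thesis by (simp add: \<beta>_uminus_one)
qed

definition Ev :: "nat \<Rightarrow> (nat \<Rightarrow> 'n, 'f) fmat \<Rightarrow> (nat \<Rightarrow> 'r) \<Rightarrow> 'r" where
  "Ev k Y \<sigma> = reval \<sigma> (SOME p. rep k Y p)"

lemma Ev_rep:
  assumes "rep k Y p"
  shows "Ev k Y \<sigma> = reval \<sigma> p"
proof -
  define q where "q = (SOME p. rep k Y p)"
  have "rep k Y q" unfolding q_def using someI[of "rep k Y", OF assms] .
  then have "reval \<sigma> q = reval \<sigma> p"
    using assms by (intro reval_eqI ext) (simp_all add: rep_def)
  then show ?thesis by (simp only: Ev_def q_def)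
qed

text \<open>Carries an equality of multilinear forms over \<open>F\<close>, up to substituting
  polynomials for variables, over to \<open>R\<close>. \<open>Ev_mult\<close>,
  \<open>Ev_ptr\<close>, \<open>Ev_tr\<close> and \<open>Ev_perm\<close> are obtained by choosing
  \<tau>.\<close>

lemma Ev_sub:
  assumes "Y \<in> calA (Suc k)" "\<And>s. tconsts (\<tau> s) \<subseteq> A"
    and "\<And>X i j. form k' Y' (X(0 := munit j i)) = form (Suc k) Y ((\<lambda>s. mev X (\<tau> s))(0 := munit j i))"
  shows "Ev k' Y' \<sigma> = Ev (Suc k) Y (\<lambda>s. reval \<sigma> (\<tau> s))"
proof -
  obtain p where p: "rep (Suc k) Y p" using rep_exists[OF assms(1)] by blast
  have "rep k' Y' (tsub \<tau> p)"
    unfolding rep_def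
  proof (intro conjI allI tconsts_tsub)
    show "tconsts p \<subseteq> A" using p by (simp add: rep_def)
    show "tconsts (\<tau> s) \<subseteq> A" for s by (rule assms(2))
    show "mev X (tsub \<tau> p) i j = form k' Y' (X(0 := munit j i))" for X i j
      unfolding teval_tsub assms(3) using p by (simp add: rep_def)
  qed
  then show ?thesis unfolding Ev_rep[OF p] by (simp add: Ev_rep teval_tsub)
qed

lemma Ev_add:
  assumes "Y \<in> calA (Suc k)" "Z \<in> calA (Suc k)"
  shows "Ev (Suc k) (Y + Z) \<sigma> = Ev (Suc k) Y \<sigma> + Ev (Suc k) Z \<sigma>"
proof -
  obtain p q where "rep (Suc k) Y p" "rep (Suc k) Z q" using assms rep_exists by blast
  then show ?thesis by (simp add: Ev_rep Ev_rep[OF rep_add])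
qed

lemma Ev_msc:
  assumes "Y \<in> calA (Suc k)"
  shows "Ev (Suc k) (msc c Y) \<sigma> = \<beta> c * Ev (Suc k) Y \<sigma>"
proof -
  obtain p where "rep (Suc k) Y p" using assms rep_exists by blast
  then show ?thesis by (simp add: Ev_rep Ev_rep[OF rep_msc])
qed

lemma Ev_zero: "Ev (Suc k) 0 \<sigma> = 0"
  using Ev_rep[OF rep_zero] by (simp add: \<beta>_zero)

lemma Ev_sum:
  "(\<And>q. q \<in> Q \<Longrightarrow> h q \<in> calA (Suc k)) \<Longrightarrow> Ev (Suc k) (\<Sum>q\<in>Q. h q) \<sigma> = (\<Sum>q\<in>Q. Ev (Suc k) (h q) \<sigma>)"
proof (induction Q rule: infinite_finite_induct)
  case (insert q Q)
  then show ?case unfolding sum.insert[OF insert.hyps]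
    by (subst Ev_add) (auto intro: calA_sum)
qed (auto simp: Ev_zero)

text \<open>A representing polynomial may mention variables outside 1, ..., k. Setting them to zero
  does not change the form, since slot 0 is overwritten and later slots are not read; afterwards
  they cannot influence the value.\<close>

lemma Ev_local:
  assumes Y: "Y \<in> calA (Suc k)" and eq: "\<And>s. 1 \<le> s \<Longrightarrow> s \<le> k \<Longrightarrow> \<sigma> s = \<sigma>' s"
  shows "Ev (Suc k) Y \<sigma> = Ev (Suc k) Y \<sigma>'"
proof -
  have *: "Ev (Suc k) Y \<sigma> = Ev (Suc k) Y (\<lambda>s. reval \<sigma> (if 1 \<le> s \<and> s \<le> k then TVar s else TSc 0))" for \<sigma>
    by (rule Ev_sub[OF Y]) (auto intro!: form_cong)
  have "(\<lambda>s. reval \<sigma> (if 1 \<le> s \<and> s \<le> k then TVar s else TSc 0)) = (\<lambda>s. reval \<sigma>' (if 1 \<le> s \<and> s \<le> k then TVar s else TSc 0))"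
    using eq by auto
  then show ?thesis using *[of \<sigma>] *[of \<sigma>'] by simp
qed

text \<open>Additivity in a slot is itself a trace identity once the second summand has a variable
  of its own.\<close>

lemma Ev_slot_add:
  assumes Y: "Y \<in> calA (Suc (Suc k))"
  shows "Ev (Suc (Suc k)) Y (\<sigma>(Suc k := x + y)) = Ev (Suc (Suc k)) Y (\<sigma>(Suc k := x)) + Ev (Suc (Suc k)) Y (\<sigma>(Suc k := y))"
proof -
  let ?s = "Suc k" and ?t = "Suc (Suc k)"
  obtain p where p: "rep ?t Y p" using rep_exists[OF Y] by blast
  have pA: "tconsts p \<subseteq> A" using p by (simp add: rep_def)
  \<comment> \<open>\<open>?t\<close> lies beyond the slots of \<open>Y\<close> and is free to hold
    the second summand.\<close>
  define \<sigma>' where "\<sigma>' = \<sigma>(?s := x, ?t := y)"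
  have "reval \<sigma>' (tsub (TVar(?s := TAdd (TVar ?s) (TVar ?t))) p) = reval \<sigma>' (TAdd p (tsub (TVar(?s := TVar ?t)) p))"
  proof (rule reval_eqI)
    fix X :: "nat \<Rightarrow> ('n, 'f) fmat"
    have "(\<lambda>s. mev X ((TVar(?s := TAdd (TVar ?s) (TVar ?t))) s)) = X(?s := X ?s + X ?t)"
      "(\<lambda>s. mev X ((TVar(?s := TVar ?t)) s)) = X(?s := X ?t)" by (auto simp: madd_eq)
    then have "mev X (tsub (TVar(?s := TAdd (TVar ?s) (TVar ?t))) p) = mev (X(?s := X ?s + X ?t)) p"
      "mev X (tsub (TVar(?s := TVar ?t)) p) = mev (X(?s := X ?t)) p" by (simp_all only: teval_tsub)
    moreover have "mev (X(?s := X ?s + X ?t)) p = mev X p + mev (X(?s := X ?t)) p"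
    proof (intro ext)
      fix i j
      have e: "X(?s := z, 0 := munit j i) = (X(0 := munit j i))(?s := z)" for z by (rule fun_upd_twist) simp
      have "X(0 := munit j i, ?s := X ?s) = X(0 := munit j i)" by auto
      then show "mev (X(?s := X ?s + X ?t)) p i j = (mev X p + mev (X(?s := X ?t)) p) i j"
        using p form_slot_add[of ?s ?t Y "X(0 := munit j i)" "X ?s" "X ?t"]
        by (simp only: rep_def e plus_fun_apply)
    qed
    ultimately show "mev X (tsub (TVar(?s := TAdd (TVar ?s) (TVar ?t))) p) = mev X (TAdd p (tsub (TVar(?s := TVar ?t)) p))"
      by (simp add: madd_eq)
    show "tconsts (tsub (TVar(?s := TAdd (TVar ?s) (TVar ?t))) p) \<subseteq> A"
      by (rule tconsts_tsub[OF pA]) simp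
    show "tconsts (TAdd p (tsub (TVar(?s := TVar ?t)) p)) \<subseteq> A"
      unfolding tconsts.simps by (intro Un_least pA tconsts_tsub[OF pA]) simp
  qed
  moreover have "(\<lambda>s. reval \<sigma>' ((TVar(?s := TAdd (TVar ?s) (TVar ?t))) s)) = \<sigma>'(?s := x + y)"
    "(\<lambda>s. reval \<sigma>' ((TVar(?s := TVar ?t)) s)) = \<sigma>'(?s := y)" by (auto simp: \<sigma>'_def)
  ultimately have "reval (\<sigma>'(?s := x + y)) p = reval \<sigma>' p + reval (\<sigma>'(?s := y)) p"
    by (simp only: teval_tsub teval.simps)
  then have "Ev ?t Y (\<sigma>'(?s := x + y)) = Ev ?t Y \<sigma>' + Ev ?t Y (\<sigma>'(?s := y))"
    by (simp only: Ev_rep[OF p])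
  moreover have "Ev ?t Y (\<sigma>'(?s := z)) = Ev ?t Y (\<sigma>(?s := z))" for z
    by (rule Ev_local[OF Y]) (auto simp: \<sigma>'_def)
  moreover have "Ev ?t Y \<sigma>' = Ev ?t Y (\<sigma>(?s := x))"
    by (rule Ev_local[OF Y]) (auto simp: \<sigma>'_def)
  ultimately show ?thesis by simp
qed

lemma Ev_slot_scale:
  assumes Y: "Y \<in> calA (Suc (Suc k))"
  shows "Ev (Suc (Suc k)) Y (\<sigma>(Suc k := \<beta> c * x)) = \<beta> c * Ev (Suc (Suc k)) Y (\<sigma>(Suc k := x))"
proof -
  let ?s = "Suc k" and ?t = "Suc (Suc k)"
  have "Ev ?t (msc c Y) (\<sigma>(?s := x))
      = Ev ?t Y (\<lambda>s. reval (\<sigma>(?s := x)) ((TVar(?s := TMul (TSc c) (TVar ?s))) s))"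
  proof (rule Ev_sub[OF Y])
    show "tconsts ((TVar(?s := TMul (TSc c) (TVar ?s))) s) \<subseteq> A" for s by simp
    fix X :: "nat \<Rightarrow> ('n, 'f) fmat" and i j
    have 1: "(\<lambda>s. mev X ((TVar(?s := TMul (TSc c) (TVar ?s))) s)) = X(?s := msc c (X ?s))"
      by (auto simp: mmul_msc)
    have 2: "X(?s := msc c (X ?s), 0 := munit j i) = (X(0 := munit j i))(?s := msc c (X ?s))"
      by (rule fun_upd_twist) simp
    have 3: "X(0 := munit j i, ?s := X ?s) = X(0 := munit j i)" by auto
    show "form ?t (msc c Y) (X(0 := munit j i))
        = form ?t Y ((\<lambda>s. mev X ((TVar(?s := TMul (TSc c) (TVar ?s))) s))(0 := munit j i))"
      unfolding 1 2 form_slot_msc[OF lessI] 3 form_msc ..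
  qed
  moreover have "(\<lambda>s. reval (\<sigma>(?s := x)) ((TVar(?s := TMul (TSc c) (TVar ?s))) s)) = \<sigma>(?s := \<beta> c * x)"
    by auto
  ultimately show ?thesis using Ev_msc[OF Y] by simp
qed

lemma Ev_mult:
  assumes Y: "Y \<in> calA (Suc (Suc k))"
  shows "Ev (Suc (Suc (Suc k))) (opmul (Suc (Suc (Suc k))) (opperm (Suc (Suc (Suc k))) (slotswap (Suc k))) (tens (Suc (Suc k)) Y mone)) \<sigma>
    = Ev (Suc (Suc k)) Y (\<sigma>(Suc k := \<sigma> (Suc k) * \<sigma> (Suc (Suc k))))"
proof -
  let ?s = "Suc k" and ?t = "Suc (Suc k)"
  have "Ev (Suc ?t) (opmul (Suc ?t) (opperm (Suc ?t) (slotswap ?s)) (tens ?t Y mone)) \<sigma>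
      = Ev ?t Y (\<lambda>s. reval \<sigma> ((TVar(?s := TMul (TVar ?s) (TVar ?t))) s))"
  proof (rule Ev_sub[OF Y])
    show "tconsts ((TVar(?s := TMul (TVar ?s) (TVar ?t))) s) \<subseteq> A" for s by simp
    fix X :: "nat \<Rightarrow> ('n, 'f) fmat" and i j
    have "(\<lambda>s. mev X ((TVar(?s := TMul (TVar ?s) (TVar ?t))) s)) = X(?s := mmul (X ?s) (X ?t))"
      by auto
    then show "form (Suc ?t) (opmul (Suc ?t) (opperm (Suc ?t) (slotswap ?s)) (tens ?t Y mone)) (X(0 := munit j i))
        = form ?t Y ((\<lambda>s. mev X ((TVar(?s := TMul (TVar ?s) (TVar ?t))) s))(0 := munit j i))"
      unfolding form_mult[OF calA_Op[OF Y]] by (simp add: fun_upd_twist)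
  qed
  moreover have "(\<lambda>s. reval \<sigma> ((TVar(?s := TMul (TVar ?s) (TVar ?t))) s)) = \<sigma>(?s := \<sigma> ?s * \<sigma> ?t)"
    by auto
  ultimately show ?thesis by simp
qed

lemma Ev_tens:
  assumes Y: "Y \<in> calA (Suc k)"
  shows "Ev (Suc (Suc k)) (tens (Suc k) Y mone) \<sigma> = Ev (Suc k) Y \<sigma> * tr (\<sigma> (Suc k))"
proof -
  obtain p where p: "rep (Suc k) Y p" using rep_exists[OF Y] by blast
  have "rep (Suc (Suc k)) (tens (Suc k) Y mone) (TMul p (TTr (TVar (Suc k))))"
    unfolding rep_def
  proof (intro conjI allI)
    show "tconsts (TMul p (TTr (TVar (Suc k)))) \<subseteq> A" using p by (simp add: rep_def)
    fix X :: "nat \<Rightarrow> ('n, 'f) fmat" and i j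
    have "mev X (TMul p (TTr (TVar (Suc k)))) = msc (mtrace (X (Suc k))) (mev X p)"
      by (simp add: mtr_def mmul_msc)
    then show "mev X (TMul p (TTr (TVar (Suc k)))) i j = form (Suc (Suc k)) (tens (Suc k) Y mone) (X(0 := munit j i))"
      unfolding form_tens[OF calA_Op[OF Y]] using p by (simp only:) (simp add: msc_def rep_def)
  qed
  then show ?thesis by (simp add: Ev_rep Ev_rep[OF p])
qed

lemma Ev_ptr:
  assumes Y: "Y \<in> calA (Suc (Suc k))" and a: "a \<in> A"
  shows "Ev (Suc k) (ptr (Suc k) a Y) \<sigma> = Ev (Suc (Suc k)) Y (\<sigma>(Suc k := \<alpha> a))"
proof -
  let ?s = "Suc k" and ?t = "Suc (Suc k)"
  have "Ev ?s (ptr ?s a Y) \<sigma> = Ev ?t Y (\<lambda>s. reval \<sigma> ((TVar(?s := TElem a)) s))"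
  proof (rule Ev_sub[OF Y])
    show "tconsts ((TVar(?s := TElem a)) s) \<subseteq> A" for s using a by simp
    fix X :: "nat \<Rightarrow> ('n, 'f) fmat" and i j
    have *: "(\<lambda>s. mev X ((TVar(?s := TElem a)) s)) = X(?s := a)" by auto
    show "form ?s (ptr ?s a Y) (X(0 := munit j i)) = form ?t Y ((\<lambda>s. mev X ((TVar(?s := TElem a)) s))(0 := munit j i))"
      unfolding * form_Suc[of ?s] by (simp, rule form_cong) simp
  qed
  moreover have "(\<lambda>s. reval \<sigma> ((TVar(?s := TElem a)) s)) = \<sigma>(?s := \<alpha> a)" by auto
  ultimately show ?thesis by simp
qed

text \<open>On matrices a trace is a scalar multiple of \<open>mone\<close> and leaves its slot by
  linearity; transported to \<open>R\<close>, this pulls out \<open>tr x\<close>.\<close>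

lemma Ev_tr:
  assumes Y: "Y \<in> calA (Suc (Suc k))"
  shows "Ev (Suc (Suc k)) Y (\<sigma>(Suc k := tr x)) = Ev (Suc k) (ptr (Suc k) mone Y) \<sigma> * tr x"
proof -
  let ?s = "Suc k" and ?t = "Suc (Suc k)"
  have Y1: "ptr ?s mone Y \<in> calA ?s" by (rule calA_ptr[OF Y A_one])
  have "Ev ?t (tens ?s (ptr ?s mone Y) mone) (\<sigma>(?s := x))
      = Ev ?t Y (\<lambda>s. reval (\<sigma>(?s := x)) ((TVar(?s := TTr (TVar ?s))) s))"
  proof (rule Ev_sub[OF Y])
    show "tconsts ((TVar(?s := TTr (TVar ?s))) s) \<subseteq> A" for s by simp
    fix X :: "nat \<Rightarrow> ('n, 'f) fmat" and i j
    have *: "(\<lambda>s. mev X ((TVar(?s := TTr (TVar ?s))) s)) = X(?s := msc (mtrace (X ?s)) mone)"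
      by (auto simp: mtr_def)
    have **: "X(?s := z, 0 := munit j i) = (X(0 := munit j i))(?s := z)" for z
      by (rule fun_upd_twist) simp
    have "form ?s (ptr ?s mone Y) (X(0 := munit j i)) = form ?t Y ((X(0 := munit j i))(?s := mone))"
      unfolding form_Suc[of ?s Y] by (simp, rule form_cong) simp
    then show "form ?t (tens ?s (ptr ?s mone Y) mone) (X(0 := munit j i))
        = form ?t Y ((\<lambda>s. mev X ((TVar(?s := TTr (TVar ?s))) s))(0 := munit j i))"
      unfolding * ** form_tens[OF calA_Op[OF Y1]] by (simp add: form_slot_msc)
  qed
  moreover have "(\<lambda>s. reval (\<sigma>(?s := x)) ((TVar(?s := TTr (TVar ?s))) s)) = \<sigma>(?s := tr x)" by auto
  moreover have "Ev ?s (ptr ?s mone Y) (\<sigma>(?s := x)) = Ev ?s (ptr ?s mone Y) \<sigma>"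
    by (rule Ev_local[OF Y1]) simp
  ultimately show ?thesis using Ev_tens[OF Y1, of "\<sigma>(?s := x)"] by simp
qed

lemma Ev_perm:
  assumes Y: "Y \<in> calA (Suc k)" and \<rho>: "\<rho> permutes {..<Suc k}" "\<rho> 0 = 0"
  shows "Ev (Suc k) (opmul (Suc k) (opperm (Suc k) \<rho>) (opmul (Suc k) Y (opperm (Suc k) (pinv \<rho>)))) \<sigma>
    = Ev (Suc k) Y (\<sigma> \<circ> pinv \<rho>)"
proof -
  have "Ev (Suc k) (opmul (Suc k) (opperm (Suc k) \<rho>) (opmul (Suc k) Y (opperm (Suc k) (pinv \<rho>)))) \<sigma>
      = Ev (Suc k) Y (\<lambda>s. reval \<sigma> (TVar (pinv \<rho> s)))"
  proof (rule Ev_sub[OF Y])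
    fix X :: "nat \<Rightarrow> ('n, 'f) fmat" and i j
    have "pinv \<rho> s = 0 \<longleftrightarrow> s = 0" for s unfolding permutes_inv_eq[OF \<rho>(1)] \<rho>(2) by (rule eq_commute)
    then have eq: "(X(0 := munit j i)) \<circ> pinv \<rho> = (\<lambda>s. mev X (TVar (pinv \<rho> s)))(0 := munit j i)"
      by (intro ext) (simp add: fun_upd_apply)
    show "form (Suc k) (opmul (Suc k) (opperm (Suc k) \<rho>) (opmul (Suc k) Y (opperm (Suc k) (pinv \<rho>)))) (X(0 := munit j i))
        = form (Suc k) Y ((\<lambda>s. mev X (TVar (pinv \<rho> s)))(0 := munit j i))"
      unfolding form_perm[OF \<rho>(1)] eq ..
  qed simp
  then show ?thesis by (simp add: o_def)
qed

lemma Ev_swap: "Ev (Suc (Suc 0)) (opperm (Suc (Suc 0)) (slotswap 0)) \<sigma> = \<sigma> (Suc 0)"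
proof -
  have "rep (Suc (Suc 0)) (opperm (Suc (Suc 0)) (slotswap 0)) (TVar (Suc 0))"
    by (simp only: rep_def form_transpose teval.simps tconsts.simps) simp
  then show ?thesis by (simp add: Ev_rep)
qed

text \<open>Pairing \<open>munit j i\<close> with a variable reads its entry (i, j), so a tensor of
  matrix units stands for a monomial in generic entries times the matrix unit in slot 0.
  \<open>N\<close> projects it and evaluates the result in \<open>R\<close>.\<close>

definition N :: "nat \<Rightarrow> (nat \<Rightarrow> ('n, 'f) fmat) \<Rightarrow> (nat \<Rightarrow> 'r) \<Rightarrow> 'r" where
  "N k X \<sigma> = Ev (Suc k) (reynolds (Suc k) (M (Suc k) id X)) \<sigma>"

lemma N_local:
  assumes "\<And>s. s \<le> k \<Longrightarrow> X s = X' s" "\<And>s. 1 \<le> s \<Longrightarrow> s \<le> k \<Longrightarrow> \<sigma> s = \<sigma>' s"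
  shows "N k X \<sigma> = N k X' \<sigma>'"
proof -
  have "M (Suc k) id X = M (Suc k) id X'" by (rule M_cong) (use assms(1) in auto)
  then show ?thesis unfolding N_def using Ev_local[OF reynolds_calA assms(2)] by simp
qed

lemma N_slot_add: "N (Suc k) X (\<sigma>(Suc k := x + y)) = N (Suc k) X (\<sigma>(Suc k := x)) + N (Suc k) X (\<sigma>(Suc k := y))"
  unfolding N_def by (rule Ev_slot_add[OF reynolds_calA])

lemma N_slot_scale: "N (Suc k) X (\<sigma>(Suc k := \<beta> c * x)) = \<beta> c * N (Suc k) X (\<sigma>(Suc k := x))"
  unfolding N_def by (rule Ev_slot_scale[OF reynolds_calA])

text \<open>The entry rule for products in kernel form: \<open>munit l i\<close> and
  \<open>munit j l\<close> read the entries (i, l) and (l, j), and the sum over \<open>l\<close>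
  produces the swap that multiplies two slots.\<close>

lemma M_unit_sum:
  "(\<Sum>l\<in>UNIV. M (Suc (Suc k)) id (X(k := munit l i, Suc k := munit j l)))
    = opmul (Suc (Suc k)) (opperm (Suc (Suc k)) (slotswap k)) (tens (Suc k) (M (Suc k) id (X(k := munit j i))) mone)"
proof -
  let ?m = "Suc (Suc k)"
  let ?X = "X(k := munit j i, Suc k := mone)"
  have "opmul ?m (opperm ?m (slotswap k)) (tens (Suc k) (M (Suc k) id (X(k := munit j i))) mone)
      = M ?m (slotswap k) (\<lambda>s. ?X (slotswap k s))"
    by (simp only: tens_M[OF permutes_id] M_mult[OF slotswap_permutes] mmul_one id_o)
  moreover have "(\<Sum>l\<in>UNIV. M ?m id (X(k := munit l i, Suc k := munit j l))) = M ?m (slotswap k) (\<lambda>s. ?X (slotswap k s))"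
  proof (intro ext)
    fix I J
    let ?P = "\<Prod>s<k. X s (I s) (J s)"
    have "(\<Sum>l\<in>UNIV. M ?m id (X(k := munit l i, Suc k := munit j l))) I J
        = (\<Sum>l\<in>UNIV. ?P * (munit l i (I k) (J k) * munit j l (I (Suc k)) (J (Suc k))))"
      unfolding sum_fun2_apply M_def by (intro sum.cong refl) (simp add: mult.assoc)
    also have "\<dots> = ?P * (\<Sum>l\<in>UNIV. if I k = l then if J k = i \<and> I (Suc k) = j \<and> J (Suc k) = l then 1 else 0 else 0)"
      unfolding sum_distrib_left by (intro sum.cong refl) (auto simp: munit_def)
    also have "\<dots> = ?P * (mone (I k) (J (Suc k)) * munit j i (I (Suc k)) (J k))"
      by (auto simp: munit_def mone_def)
    also have "\<dots> = M ?m (slotswap k) (\<lambda>s. ?X (slotswap k s)) I J"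
    proof -
      have "(\<Prod>s<k. ?X (slotswap k s) (I s) (J (slotswap k s))) = ?P"
        by (intro prod.cong refl) (auto simp: transpose_def)
      then show ?thesis by (simp add: M_def mult.assoc)
    qed
    finally show "(\<Sum>l\<in>UNIV. M ?m id (X(k := munit l i, Suc k := munit j l))) I J
      = M ?m (slotswap k) (\<lambda>s. ?X (slotswap k s)) I J" .
  qed
  ultimately show ?thesis by simp
qed

text \<open>\<open>reynolds\<close> commutes with the swap and with the adjoined unit slot, so
  \<open>M_unit_sum\<close> survives projection, and \<open>Ev_mult\<close> evaluates it as a
  product in \<open>R\<close>.\<close>

lemma N_mult:
  "(\<Sum>l\<in>UNIV. N (Suc (Suc k)) (X(Suc k := munit l i, Suc (Suc k) := munit j l)) (\<sigma>(Suc k := x, Suc (Suc k) := y)))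
    = N (Suc k) (X(Suc k := munit j i)) (\<sigma>(Suc k := x * y))"
proof -
  let ?s = "Suc k" and ?t = "Suc (Suc k)" and ?\<sigma> = "\<sigma>(Suc k := x, Suc (Suc k) := y)"
  let ?Y = "M ?t id (X(?s := munit j i))"
  have P: "opperm (Suc ?t) (slotswap ?s) \<in> calA (Suc ?t)" by (rule calA_perm[OF slotswap_permutes])
  have "(\<Sum>l\<in>UNIV. N ?t (X(?s := munit l i, ?t := munit j l)) ?\<sigma>)
      = Ev (Suc ?t) (reynolds (Suc ?t) (\<Sum>l\<in>UNIV. M (Suc ?t) id (X(?s := munit l i, ?t := munit j l)))) ?\<sigma>"
    unfolding N_def reynolds_sum by (rule Ev_sum[symmetric]) (rule reynolds_calA)
  also have "\<dots> = Ev (Suc ?t) (opmul (Suc ?t) (opperm (Suc ?t) (slotswap ?s)) (tens ?t (reynolds ?t ?Y) mone)) ?\<sigma>"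
    unfolding M_unit_sum reynolds_left[OF P] reynolds_tens[OF Op_M[OF permutes_id]] ..
  also have "\<dots> = Ev ?t (reynolds ?t ?Y) (\<sigma>(?s := x * y))"
    unfolding Ev_mult[OF reynolds_calA] by (rule Ev_local[OF reynolds_calA]) auto
  finally show ?thesis by (simp only: N_def)
qed

lemma ptr_M_munit: "ptr (Suc k) a (M (Suc (Suc k)) id (X(Suc k := munit j i))) = msc (a i j) (M (Suc k) id X)"
proof -
  have "M (Suc k) id (X(Suc k := munit j i)) = M (Suc k) id X" by (rule M_cong) auto
  then show ?thesis unfolding ptr_M_fixed[OF permutes_id] by (simp add: mtrace_munit)
qed

text \<open>Substituting \<open>\<alpha> a\<close> is a partial trace, which commutes with the
  projection and turns \<open>munit j i\<close> into the scalar \<open>a i j\<close>.\<close>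

lemma N_\<alpha>: "a \<in> A \<Longrightarrow> N (Suc k) (X(Suc k := munit j i)) (\<sigma>(Suc k := \<alpha> a)) = \<beta> (a i j) * N k X \<sigma>"
  unfolding N_def by (simp only: Ev_ptr[OF reynolds_calA, symmetric] reynolds_ptr[symmetric] ptr_M_munit reynolds_msc Ev_msc[OF reynolds_calA])

text \<open>On the left the trace leaves its slot, with the scalar \<open>mone i j\<close>; on the
  right the diagonal units add up to an adjoined unit slot. Both yield the projection in one
  variable fewer times \<open>tr x\<close>.\<close>

lemma N_tr:
  "N (Suc k) (X(Suc k := munit j i)) (\<sigma>(Suc k := tr x))
    = (if i = j then \<Sum>l\<in>UNIV. N (Suc k) (X(Suc k := munit l l)) (\<sigma>(Suc k := x)) else 0)"
proof -
  let ?s = "Suc k" and ?t = "Suc (Suc k)"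
  have 1: "N ?s (X(?s := munit j i)) (\<sigma>(?s := tr x)) = \<beta> (mone i j) * Ev ?s (reynolds ?s (M ?s id X)) \<sigma> * tr x"
    unfolding N_def by (simp only: Ev_tr[OF reynolds_calA] reynolds_ptr[OF A_one, symmetric] ptr_M_munit reynolds_msc Ev_msc[OF reynolds_calA])
  have sum1: "(\<Sum>l\<in>UNIV. munit l l) = (mone :: ('n, 'f) fmat)"
  proof (intro ext)
    fix a b :: 'n
    have "(\<Sum>l\<in>UNIV. munit l l) a b = (\<Sum>l\<in>UNIV. if a = l then mone a b else (0::'f))"
      unfolding sum_fun2_apply munit_def mone_def by (intro sum.cong refl) auto
    then show "(\<Sum>l\<in>UNIV. munit l l) a b = (mone a b :: 'f)" by simp
  qed
  have "(\<Sum>l\<in>UNIV. M ?t id (X(?s := munit l l))) = tens ?s (M ?s id X) mone"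
    using M_sum_slot[of ?s ?t id X "\<lambda>_. 1" "\<lambda>l. munit l l" UNIV]
    by (simp only: tens_M[OF permutes_id] mat.scale_one sum1 lessI)
  then have "(\<Sum>l\<in>UNIV. N ?s (X(?s := munit l l)) (\<sigma>(?s := x))) = Ev ?t (reynolds ?t (tens ?s (M ?s id X) mone)) (\<sigma>(?s := x))"
    unfolding N_def by (subst Ev_sum[symmetric]) (simp_all only: reynolds_calA reynolds_sum[symmetric])
  also have "\<dots> = Ev ?s (reynolds ?s (M ?s id X)) (\<sigma>(?s := x)) * tr x"
    unfolding reynolds_tens[OF Op_M[OF permutes_id]] Ev_tens[OF reynolds_calA] by simp
  also have "Ev ?s (reynolds ?s (M ?s id X)) (\<sigma>(?s := x)) = Ev ?s (reynolds ?s (M ?s id X)) \<sigma>"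
    by (rule Ev_local[OF reynolds_calA]) simp
  finally have 2: "(\<Sum>l\<in>UNIV. N ?s (X(?s := munit l l)) (\<sigma>(?s := x))) = Ev ?s (reynolds ?s (M ?s id X)) \<sigma> * tr x" .
  show ?thesis unfolding 1 2 by (simp add: mone_def \<beta>_zero \<beta>_one)
qed

text \<open>Projection commutes with permutations of the slots because these belong to
  \<open>calA (Suc k)\<close>. This lets \<open>N\<close> descend to commutative monomials.\<close>

lemma N_perm:
  assumes \<rho>: "\<rho> permutes {..<Suc k}" "\<rho> 0 = 0"
  shows "N k (X \<circ> \<rho>) (\<sigma> \<circ> \<rho>) = N k X \<sigma>"
proof -
  let ?m = "Suc k"
  have P: "opperm ?m \<rho> \<in> calA ?m" "opperm ?m (pinv \<rho>) \<in> calA ?m"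
    using calA_perm \<rho>(1) permutes_inv by blast+
  have "opmul ?m (opperm ?m \<rho>) (opmul ?m (M ?m id X) (opperm ?m (pinv \<rho>))) = M ?m (pinv \<rho> \<circ> \<rho>) (X \<circ> \<rho>)"
    by (simp only: M_mult[OF permutes_id] M_mult[OF \<rho>(1)] mmul_one o_id o_def[of X \<rho>])
  then have "M ?m id (X \<circ> \<rho>) = opmul ?m (opperm ?m \<rho>) (opmul ?m (M ?m id X) (opperm ?m (pinv \<rho>)))"
    using permutes_inv_o(2)[OF \<rho>(1)] by simp
  then have "N k (X \<circ> \<rho>) (\<sigma> \<circ> \<rho>) = Ev ?m (reynolds ?m (M ?m id X)) ((\<sigma> \<circ> \<rho>) \<circ> pinv \<rho>)"
    unfolding N_def by (simp only: reynolds_left[OF P(1)] reynolds_right[OF P(2)] Ev_perm[OF reynolds_calA \<rho>])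
  also have "(\<sigma> \<circ> \<rho>) \<circ> pinv \<rho> = \<sigma>" by (simp add: comp_assoc permutes_inv_o(1)[OF \<rho>(1)])
  finally show ?thesis by (simp only: N_def)
qed

text \<open>The sum of \<open>munit i j \<otimes> munit j i\<close> is the swap, which is already in
  \<open>calA 2\<close> and represents one variable. Thus an element of \<open>R\<close> is
  recovered from its generic entries.\<close>

lemma N_var: "(\<Sum>i\<in>UNIV. \<Sum>j\<in>UNIV. N (Suc 0) (X(0 := munit i j, Suc 0 := munit j i)) \<sigma>) = \<sigma> (Suc 0)"
proof -
  let ?m = "Suc (Suc 0)"
  have "(\<Sum>i\<in>UNIV. \<Sum>j\<in>UNIV. N (Suc 0) (X(0 := munit i j, Suc 0 := munit j i)) \<sigma>)
      = Ev ?m (reynolds ?m (\<Sum>i\<in>UNIV. \<Sum>j\<in>UNIV. M ?m id (X(0 := munit i j, Suc 0 := munit j i)))) \<sigma>"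
    unfolding N_def reynolds_sum by (subst Ev_sum) (auto intro!: calA_sum reynolds_calA sum.cong Ev_sum[symmetric])
  also have "(\<Sum>i\<in>UNIV. \<Sum>j\<in>UNIV. M ?m id (X(0 := munit i j, Suc 0 := munit j i))) = opperm ?m (slotswap 0)"
  proof (intro ext)
    fix I J :: "nat \<Rightarrow> 'n"
    have "(\<Sum>i\<in>UNIV. \<Sum>j\<in>UNIV. M ?m id (X(0 := munit i j, Suc 0 := munit j i))) I J
        = (\<Sum>i\<in>UNIV. \<Sum>j\<in>UNIV. if I 0 = i then if J 0 = j then if I (Suc 0) = j \<and> J (Suc 0) = i then 1 else 0 else 0 else (0::'f))"
      unfolding sum_fun2_apply M_def by (intro sum.cong refl) (auto simp: munit_def)
    also have "\<dots> = (\<Sum>i\<in>UNIV. if I 0 = i then if I (Suc 0) = J 0 \<and> J (Suc 0) = i then 1 else 0 else 0)"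
      by (intro sum.cong refl) auto
    also have "\<dots> = opperm ?m (slotswap 0) I J"
      by (auto simp: M_def mone_def)
    finally show "(\<Sum>i\<in>UNIV. \<Sum>j\<in>UNIV. M ?m id (X(0 := munit i j, Suc 0 := munit j i))) I J = opperm ?m (slotswap 0) I J" .
  qed
  also have "reynolds ?m (opperm ?m (slotswap 0)) = opperm ?m (slotswap 0)"
    by (rule reynolds_id[OF calA_perm[OF slotswap_permutes]])
  finally show ?thesis by (simp only: Ev_swap)
qed

end

section \<open>The universal commutative ring\<close>

text \<open>The values of \<pi> are the elements and the operations go through chosen preimages, so
  the quotient lives on a prescribed type instead of a type of cosets.\<close>

definition quot_ring :: "('p::comm_ring_1 \<Rightarrow> 'u) \<Rightarrow> 'u ring" where
  "quot_ring \<pi> = \<lparr>carrier = range \<pi>, monoid.mult = (\<lambda>a b. \<pi> ((SOME q. \<pi> q = a) * (SOME q. \<pi> q = b))),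
    one = \<pi> 1, zero = \<pi> 0, add = (\<lambda>a b. \<pi> ((SOME q. \<pi> q = a) + (SOME q. \<pi> q = b)))\<rparr>"

locale ring_quotient =
  fixes \<pi> :: "'p::comm_ring_1 \<Rightarrow> 'u" and J :: "'p set"
  assumes eq_iff: "\<pi> p = \<pi> q \<longleftrightarrow> p - q \<in> J"
    and J_add: "p \<in> J \<Longrightarrow> q \<in> J \<Longrightarrow> p + q \<in> J"
    and J_mult: "p \<in> J \<Longrightarrow> p * q \<in> J"
begin

lemma quot_carrier: "carrier (quot_ring \<pi>) = range \<pi>"
  and quot_one: "\<one>\<^bsub>quot_ring \<pi>\<^esub> = \<pi> 1"
  and quot_zero: "\<zero>\<^bsub>quot_ring \<pi>\<^esub> = \<pi> 0"
  by (simp_all add: quot_ring_def)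

lemma quot_some: "(SOME q'. \<pi> q' = \<pi> q) - q \<in> J"
  using someI[of "\<lambda>q'. \<pi> q' = \<pi> q" q] by (simp add: eq_iff)

lemma quot_add: "\<pi> p \<oplus>\<^bsub>quot_ring \<pi>\<^esub> \<pi> q = \<pi> (p + q)"
proof -
  have "((SOME p'. \<pi> p' = \<pi> p) + (SOME q'. \<pi> q' = \<pi> q)) - (p + q) \<in> J"
    using J_add[OF quot_some[of p] quot_some[of q]] by (simp add: algebra_simps)
  then show ?thesis by (simp add: quot_ring_def eq_iff)
qed

lemma quot_mult: "\<pi> p \<otimes>\<^bsub>quot_ring \<pi>\<^esub> \<pi> q = \<pi> (p * q)"
proof -
  let ?p = "SOME p'. \<pi> p' = \<pi> p" and ?q = "SOME q'. \<pi> q' = \<pi> q"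
  have "(?p - p) * ?q + (?q - q) * p \<in> J"
    by (intro J_add J_mult quot_some)
  then have "?p * ?q - p * q \<in> J" by (simp add: algebra_simps)
  then show ?thesis by (simp add: quot_ring_def eq_iff)
qed

lemma cring_quot: "cring (quot_ring \<pi>)"
proof (rule cringI)
  show "abelian_group (quot_ring \<pi>)"
  proof (rule abelian_groupI)
    fix x assume "x \<in> carrier (quot_ring \<pi>)"
    then obtain p where x: "x = \<pi> p" by (auto simp: quot_carrier)
    have "\<pi> (- p) \<oplus>\<^bsub>quot_ring \<pi>\<^esub> x = \<zero>\<^bsub>quot_ring \<pi>\<^esub>" by (simp add: x quot_add quot_zero)
    then show "\<exists>y\<in>carrier (quot_ring \<pi>). y \<oplus>\<^bsub>quot_ring \<pi>\<^esub> x = \<zero>\<^bsub>quot_ring \<pi>\<^esub>" by (auto simp: quot_carrier)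
  qed (auto simp: quot_carrier quot_add quot_zero add_ac)
  show "Group.comm_monoid (quot_ring \<pi>)"
    by (rule comm_monoidI) (auto simp: quot_carrier quot_mult quot_one mult_ac)
qed (auto simp: quot_carrier quot_add quot_mult algebra_simps)

lemma quot_finsum: "finite S \<Longrightarrow> finsum (quot_ring \<pi>) (\<lambda>k. \<pi> (h k)) S = \<pi> (\<Sum>k\<in>S. h k)"
proof (induction S rule: finite_induct)
  case empty
  interpret cring "quot_ring \<pi>" by (rule cring_quot)
  show ?case by (simp add: quot_zero)
next
  case (insert k S)
  interpret cring "quot_ring \<pi>" by (rule cring_quot)
  show ?case using insert by (simp add: quot_carrier quot_add finsum_insert)
qed

end

section \<open>Functionals on polynomials in the generic entries\<close>

lemma poly_mapping_sum_single: "q = (\<Sum>m\<in>Poly_Mapping.keys q. Poly_Mapping.single m (Poly_Mapping.lookup q m))"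
  by (rule poly_mapping_eqI) (simp add: lookup_sum lookup_single in_keys_iff when_def)

lemma poly_mapping_additive_induct [case_names zero single add]:
  fixes q :: "'a \<Rightarrow>\<^sub>0 'b::comm_monoid_add"
  assumes "P 0" "\<And>m c. P (Poly_Mapping.single m c)" "\<And>p q. P p \<Longrightarrow> P q \<Longrightarrow> P (p + q)"
  shows "P q"
proof -
  have "P (\<Sum>m\<in>S. Poly_Mapping.single m (Poly_Mapping.lookup q m))" for S
    by (induction S rule: infinite_finite_induct) (use assms in auto)
  then show ?thesis by (subst poly_mapping_sum_single)
qed

context trace_identity_algebra
begin

text \<open>The entry \<open>(i, j)\<close> of a generic matrix corresponds under the trace form to \<open>e\<^sub>j\<^sub>i\<close>;
  slot \<open>0\<close> holds the matrix coefficient of the monomial.\<close>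
definition slots :: "'n \<Rightarrow> 'n \<Rightarrow> ('r \<times> 'n \<times> 'n) list \<Rightarrow> nat \<Rightarrow> ('n, 'f) fmat" where
  "slots a b w s = (case s of 0 \<Rightarrow> munit a b | Suc t \<Rightarrow> munit (snd (snd (w ! t))) (fst (snd (w ! t))))"

text \<open>Letter \<open>t\<close> of the word sits in slot \<open>t + 1\<close>, hence the shift;
  the value at 0 is a default, as slot 0 carries the output.\<close>

definition vals :: "('r \<times> 'n \<times> 'n) list \<Rightarrow> nat \<Rightarrow> 'r" where
  "vals w s = fst (w ! (s - 1))"

definition NL :: "'n \<Rightarrow> 'n \<Rightarrow> ('r \<times> 'n \<times> 'n) list \<Rightarrow> 'r" where
  "NL a b w = N (length w) (slots a b w) (vals w)"

definition NM :: "'n \<Rightarrow> 'n \<Rightarrow> ('r \<times> 'n \<times> 'n) multiset \<Rightarrow> 'r" where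
  "NM a b m = NL a b (SOME w. mset w = m)"

definition NP :: "'n \<Rightarrow> 'n \<Rightarrow> (('r \<times> 'n \<times> 'n) multiset \<Rightarrow>\<^sub>0 'f) \<Rightarrow> 'r" where
  "NP a b q = (\<Sum>m\<in>Poly_Mapping.keys q. \<beta> (Poly_Mapping.lookup q m) * NM a b m)"

text \<open>Polynomial variables commute while \<open>N\<close> reads an ordered list;
  \<open>N_perm\<close> closes this gap.\<close>

lemma NL_mset_cong:
  assumes "mset w = mset w'"
  shows "NL a b w = NL a b w'"
proof -
  obtain p where p: "p permutes {..<length w'}" and w: "permute_list p w' = w"
    by (rule mset_eq_permutation[OF assms])
  have len: "length w = length w'" using mset_eq_length[OF assms] .
  \<comment> \<open>The permutation of the letters, shifted by one so that it fixes the output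
    slot.\<close>
  define \<rho> where "\<rho> = (\<lambda>s. case s of 0 \<Rightarrow> 0 | Suc t \<Rightarrow> Suc (p t))"
  have nth: "w ! t = w' ! p t" if "t < length w'" for t
    using permute_list_nth[OF p that] w by simp
  have \<rho>: "\<rho> permutes {..<Suc (length w')}"
    unfolding permutes_def bij_iff[symmetric]
  proof (intro conjI allI impI)
    show "bij \<rho>"
    proof (rule o_bij)
      define \<rho>' where "\<rho>' = (\<lambda>s. case s of 0 \<Rightarrow> 0 | Suc t \<Rightarrow> Suc (pinv p t))"
      show "\<rho>' \<circ> \<rho> = id" "\<rho> \<circ> \<rho>' = id"
        by (rule ext; simp add: \<rho>_def \<rho>'_def permutes_inverses[OF p] split: nat.split)+
    qed
    show "\<rho> s = s" if "s \<notin> {..<Suc (length w')}" for s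
      using that permutes_not_in[OF p] by (cases s) (auto simp: \<rho>_def)
  qed
  have "NL a b w = N (length w') (slots a b w' \<circ> \<rho>) (vals w' \<circ> \<rho>)"
    unfolding NL_def len
  proof (rule N_local)
    fix s assume s: "s \<le> length w'"
    show "slots a b w s = (slots a b w' \<circ> \<rho>) s"
      using s nth by (cases s) (auto simp: slots_def \<rho>_def)
    show "vals w s = (vals w' \<circ> \<rho>) s" if "1 \<le> s"
      using s nth that by (cases s) (auto simp: vals_def \<rho>_def)
  qed
  also have "\<dots> = NL a b w'" unfolding NL_def by (rule N_perm[OF \<rho>]) (simp add: \<rho>_def)
  finally show ?thesis .
qed

lemma NM_mset: "NM a b (mset w) = NL a b w"
  unfolding NM_def by (rule NL_mset_cong, rule someI) (rule refl)

lemma NP_add: "NP a b (p + q) = NP a b p + NP a b q"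
  unfolding NP_def by (rule setsum_keys_plus_distrib) (simp_all add: \<beta>_zero \<beta>_add distrib_right)

lemma NP_zero: "NP a b 0 = 0"
  by (simp add: NP_def)

lemma NP_single: "NP a b (Poly_Mapping.single m c) = \<beta> c * NM a b m"
  by (simp add: NP_def \<beta>_zero)

lemma NP_sum: "NP a b (\<Sum>k\<in>S. h k) = (\<Sum>k\<in>S. NP a b (h k))"
  by (induction S rule: infinite_finite_induct) (auto simp: NP_zero NP_add)

lemma NP_uminus: "NP a b (- p) = - NP a b p"
  using NP_add[of a b p "- p"] by (simp add: NP_zero eq_neg_iff_add_eq_0 add.commute)

lemma NP_diff: "NP a b (p - q) = NP a b p - NP a b q"
  using NP_add[of a b p "- q"] by (simp add: NP_uminus)

lemma NP_scale: "NP a b (Poly_Mapping.single 0 c * q) = \<beta> c * NP a b q"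
proof (induction q rule: poly_mapping_additive_induct)
  case (single m d)
  show ?case by (simp add: mult_single NP_single \<beta>_mult mult.assoc)
qed (simp_all add: NP_zero NP_add distrib_left)

text \<open>The largest ideal on which the functionals \<open>NP a b\<close> vanish.\<close>
definition J :: "(('r \<times> 'n \<times> 'n) multiset \<Rightarrow>\<^sub>0 'f) set" where
  "J = {q. \<forall>a b m. NP a b (q * Poly_Mapping.single m 1) = 0}"

lemma J_D: "q \<in> J \<Longrightarrow> NP a b (q * Poly_Mapping.single m 1) = 0"
  by (simp add: J_def)

lemma J_zero: "0 \<in> J"
  by (simp add: J_def NP_zero)

lemma J_add: "p \<in> J \<Longrightarrow> q \<in> J \<Longrightarrow> p + q \<in> J"
  by (simp add: J_def NP_add distrib_right)

lemma J_diff: "p \<in> J \<Longrightarrow> q \<in> J \<Longrightarrow> p - q \<in> J"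
  by (simp add: J_def NP_diff left_diff_distrib)

text \<open>Multiplication by a monomial turns one test in the definition of \<open>J\<close> into
  another, and scalars can be pulled out of the functionals.\<close>

lemma J_mult: "p \<in> J \<Longrightarrow> p * q \<in> J"
proof (induction q rule: poly_mapping_additive_induct)
  case zero
  show ?case by (simp add: J_zero)
next
  case (single m c)
  have "NP a b (p * Poly_Mapping.single m c * Poly_Mapping.single m' 1) = 0" for a b m'
  proof -
    have "p * Poly_Mapping.single m c * Poly_Mapping.single m' 1
        = Poly_Mapping.single 0 c * (p * Poly_Mapping.single (m + m') 1)"
      by (simp add: mult.left_commute[of _ p] mult_single mult.assoc)
    then show ?thesis using single by (simp add: NP_scale J_def)
  qed
  then show ?case by (simp add: J_def)
next
  case (add q q')
  then show ?case by (simp add: distrib_left J_add)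
qed

text \<open>A representative that depends only on the class modulo \<open>J\<close>, read as a
  coefficient function to land in the element type that the theorem prescribes for
  \<open>C\<close>.\<close>

definition proj :: "(('r \<times> 'n \<times> 'n) multiset \<Rightarrow>\<^sub>0 'f) \<Rightarrow> ('r \<times> 'n \<times> 'n) multiset \<Rightarrow> 'f" where
  "proj q = Poly_Mapping.lookup (SOME q'. q' - q \<in> J)"

lemma proj_eq_iff: "proj p = proj q \<longleftrightarrow> p - q \<in> J"
proof
  have *: "(SOME q'. q' - q \<in> J) - q \<in> J" for q
    by (rule someI[of "\<lambda>q'. q' - q \<in> J" q]) (simp add: J_zero)
  assume "proj p = proj q"
  then have "(SOME q'. q' - p \<in> J) = (SOME q'. q' - q \<in> J)"
    by (simp add: proj_def lookup_inject)
  then show "p - q \<in> J" using J_diff[OF *[of q] *[of p]] by simp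
next
  assume pq: "p - q \<in> J"
  have "q' - p \<in> J \<longleftrightarrow> q' - q \<in> J" for q'
    using J_add[of "q' - p" "p - q"] J_diff[of "q' - q" "p - q"] pq by auto
  then show "proj p = proj q" by (simp add: proj_def)
qed

sublocale ring_quotient proj J
  by unfold_locales (auto simp: proj_eq_iff J_add J_mult)

abbreviation "var x i j \<equiv> Poly_Mapping.single {#(x, i, j)#} (1::'f)"
abbreviation "const c \<equiv> Poly_Mapping.single (0 :: ('r \<times> 'n \<times> 'n) multiset) (c :: 'f)"

text \<open>The test monomial is given as a list and new factors are appended to it; this is why the
  rules for \<open>N\<close> speak about the last slots.\<close>

lemma proj_eqI:
  assumes "\<And>a b w. NP a b (p * Poly_Mapping.single (mset w) 1) = NP a b (q * Poly_Mapping.single (mset w) 1)"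
  shows "proj p = proj q"
proof -
  have "NP a b ((p - q) * Poly_Mapping.single m 1) = 0" for a b m
    using assms[of a b "SOME w. mset w = m"] someI_ex[OF ex_mset[of m]] by (simp add: left_diff_distrib NP_diff)
  then show ?thesis by (simp add: proj_eq_iff J_def)
qed

lemma NP_const: "NP a b (const c * Poly_Mapping.single (mset w) 1) = \<beta> c * N (length w) (slots a b w) (vals w)"
  by (simp only: NP_scale NP_single NM_mset \<beta>_one mult_1_left NL_def)

lemma NP_var: "NP a b (var x i j * Poly_Mapping.single (mset w) 1)
  = N (Suc (length w)) ((slots a b w)(Suc (length w) := munit j i)) ((vals w)(Suc (length w) := x))"
proof -
  have "NP a b (var x i j * Poly_Mapping.single (mset w) 1) = NL a b (w @ [(x, i, j)])"
    by (simp add: mult_single NP_single \<beta>_one flip: NM_mset)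
  also have "\<dots> = N (Suc (length w)) ((slots a b w)(Suc (length w) := munit j i)) ((vals w)(Suc (length w) := x))"
    unfolding NL_def length_append_singleton
    by (rule N_local) (auto simp: slots_def vals_def nth_append split: nat.split)
  finally show ?thesis .
qed

lemma NP_var_var: "NP a b (var x i j * var y i' j' * Poly_Mapping.single (mset w) 1)
  = N (Suc (Suc (length w))) ((slots a b w)(Suc (length w) := munit j i, Suc (Suc (length w)) := munit j' i'))
      ((vals w)(Suc (length w) := x, Suc (Suc (length w)) := y))"
proof -
  have "NP a b (var x i j * var y i' j' * Poly_Mapping.single (mset w) 1) = NL a b (w @ [(x, i, j), (y, i', j')])"
    by (simp add: mult_single NP_single \<beta>_one add_mset_commute flip: NM_mset)
  also have "\<dots> = N (Suc (Suc (length w))) ((slots a b w)(Suc (length w) := munit j i, Suc (Suc (length w)) := munit j' i'))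
      ((vals w)(Suc (length w) := x, Suc (Suc (length w)) := y))"
    unfolding NL_def
    by (simp, rule N_local) (auto simp: slots_def vals_def nth_append nth_Cons split: nat.split)
  finally show ?thesis .
qed

section \<open>The embedding by generic matrices\<close>

abbreviation "C \<equiv> quot_ring proj"

definition \<phi> :: "'r \<Rightarrow> 'n \<Rightarrow> 'n \<Rightarrow> ('r \<times> 'n \<times> 'n) multiset \<Rightarrow> 'f" where
  "\<phi> x i j = proj (var x i j)"

definition \<iota> :: "'f \<Rightarrow> ('r \<times> 'n \<times> 'n) multiset \<Rightarrow> 'f" where
  "\<iota> c = proj (const c)"

lemma comm_F_algebra_C: "comm_F_algebra C \<iota>"
  unfolding comm_F_algebra_def
  by (intro conjI allI cring_quot)
    (simp_all add: \<iota>_def quot_carrier quot_one quot_add quot_mult single_add[symmetric] mult_single)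

text \<open>As in the following facts, a relation for \<phi> is a membership in \<open>J\<close>,
  and testing it against monomials gives the rule of the same kind for \<open>N\<close>.\<close>

lemma \<phi>_add: "\<phi> (x + y) = cmadd C (\<phi> x) (\<phi> y)"
  unfolding \<phi>_def cmadd_def quot_add
  by (rule ext, rule ext, rule proj_eqI) (simp only: NP_var NP_add distrib_right N_slot_add)

lemma \<phi>_mult: "\<phi> (x * y) = cmmul C (\<phi> x) (\<phi> y)"
  unfolding \<phi>_def cmmul_def quot_mult quot_finsum[OF finite]
  by (rule ext, rule ext, rule proj_eqI) (simp only: NP_var NP_sum sum_distrib_right NP_var_var N_mult)

lemma \<phi>_scale: "\<phi> (\<beta> c * x) = cmmul C (cmscalar C (\<iota> c)) (\<phi> x)"
proof (rule ext, rule ext)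
  fix i j :: 'n
  have "(if i = k then \<iota> c else \<zero>\<^bsub>C\<^esub>) \<otimes>\<^bsub>C\<^esub> \<phi> x k j = proj (if i = k then const c * var x i j else 0)" for k
    by (simp add: \<iota>_def \<phi>_def quot_zero quot_mult)
  then have "cmmul C (cmscalar C (\<iota> c)) (\<phi> x) i j = proj (const c * var x i j)"
    unfolding cmmul_def cmscalar_def by (simp add: quot_finsum)
  moreover have "proj (var (\<beta> c * x) i j) = proj (const c * var x i j)"
    by (rule proj_eqI) (simp only: mult.assoc NP_scale NP_var N_slot_scale)
  ultimately show "\<phi> (\<beta> c * x) i j = cmmul C (cmscalar C (\<iota> c)) (\<phi> x) i j"
    by (simp add: \<phi>_def)
qed

lemma \<phi>_\<alpha>: "a \<in> A \<Longrightarrow> \<phi> (\<alpha> a) = cmof \<iota> a"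
  unfolding \<phi>_def cmof_def \<iota>_def
  by (rule ext, rule ext, rule proj_eqI) (simp only: NP_var NP_const N_\<alpha>)

lemma \<phi>_one: "\<phi> 1 = cmscalar C \<one>\<^bsub>C\<^esub>"
proof -
  have "\<phi> 1 = cmof \<iota> mone" using \<phi>_\<alpha>[OF A_one] by (simp only: \<alpha>_one)
  then show ?thesis by (simp add: cmof_def cmscalar_def mone_def \<iota>_def quot_one quot_zero fun_eq_iff)
qed

lemma \<phi>_tr: "\<phi> (tr x) = cmscalar C (cmtrace C (\<phi> x))"
proof (rule ext, rule ext)
  fix i j :: 'n
  have "proj (var (tr x) i j) = proj (if i = j then \<Sum>l\<in>UNIV. var x l l else 0)"
  proof (rule proj_eqI, cases "i = j")
    fix a b w
    show "NP a b (var (tr x) i j * Poly_Mapping.single (mset w) 1)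
        = NP a b ((if i = j then \<Sum>l\<in>UNIV. var x l l else 0) * Poly_Mapping.single (mset w) 1)" if "i = j"
      unfolding NP_var N_tr if_P[OF that] sum_distrib_right NP_sum ..
    show "NP a b (var (tr x) i j * Poly_Mapping.single (mset w) 1)
        = NP a b ((if i = j then \<Sum>l\<in>UNIV. var x l l else 0) * Poly_Mapping.single (mset w) 1)" if "i \<noteq> j"
      unfolding NP_var N_tr if_not_P[OF that] by (simp only: mult_zero_left NP_zero)
  qed
  then show "\<phi> (tr x) i j = cmscalar C (cmtrace C (\<phi> x)) i j"
    by (simp add: \<phi>_def cmscalar_def cmtrace_def quot_finsum quot_zero)
qed

text \<open>The functionals vanish on \<open>J\<close>, so they take equal values on equal entries.
  The one for (i, j) applied to entry (i, j), summed over all i and j, returns the element by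
  \<open>N_var\<close>.\<close>

lemma inj_\<phi>: "inj \<phi>"
proof (rule injI)
  fix x y assume eq: "\<phi> x = \<phi> y"
  \<comment> \<open>The test monomial is empty; \<open>mone\<close> fills the slots beyond
    1.\<close>
  have step: "N (Suc 0) ((\<lambda>_. mone)(0 := munit i j, Suc 0 := munit j i)) (\<lambda>_. x)
      = N (Suc 0) ((\<lambda>_. mone)(0 := munit i j, Suc 0 := munit j i)) (\<lambda>_. y)" for i j
  proof -
    have "var x i j - var y i j \<in> J"
      using fun_cong[OF fun_cong[OF eq, of i], of j] by (simp add: \<phi>_def proj_eq_iff)
    then have "NP i j ((var x i j - var y i j) * Poly_Mapping.single (mset []) 1) = 0"
      by (rule J_D)
    then have "NP i j (var x i j * Poly_Mapping.single (mset []) 1) = NP i j (var y i j * Poly_Mapping.single (mset []) 1)"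
      unfolding left_diff_distrib NP_diff right_minus_eq .
    moreover have "NP i j (var z i j * Poly_Mapping.single (mset []) 1)
        = N (Suc 0) ((\<lambda>_. mone)(0 := munit i j, Suc 0 := munit j i)) (\<lambda>_. z)" for z
      unfolding NP_var list.size
    proof (rule N_local)
      show "((slots i j [])(Suc 0 := munit j i)) s = ((\<lambda>_. mone)(0 := munit i j, Suc 0 := munit j i)) s"
        if "s \<le> Suc 0" for s using that by (cases s) (simp_all add: slots_def)
      show "((vals [])(Suc 0 := z)) s = z" if "1 \<le> s" "s \<le> Suc 0" for s
        using that by (cases s) simp_all
    qed
    ultimately show ?thesis by (simp only:)
  qed
  have "x = (\<Sum>i\<in>UNIV. \<Sum>j\<in>UNIV. N (Suc 0) ((\<lambda>_. mone)(0 := munit i j, Suc 0 := munit j i)) (\<lambda>_. x))"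
    by (rule N_var[symmetric])
  also have "\<dots> = (\<Sum>i\<in>UNIV. \<Sum>j\<in>UNIV. N (Suc 0) ((\<lambda>_. mone)(0 := munit i j, Suc 0 := munit j i)) (\<lambda>_. y))"
    by (intro sum.cong refl step)
  also have "\<dots> = y"
    by (rule N_var)
  finally show "x = y" .
qed

end

theorem theorem7p1:
  fixes G :: "('n::finite, 'f::field_char_0) fmat set"
    and \<beta> :: "'f \<Rightarrow> 'r::ring_1" and \<alpha> :: "('n, 'f) fmat \<Rightarrow> 'r" and tr :: "'r \<Rightarrow> 'r"
  assumes "linearly_reductive G"
    and "A_algebra_with_trace (centralizer G) \<beta> \<alpha> tr"
    and "\<And>p. Mn_trace_identity (centralizer G) p \<Longrightarrow> satisfies_identity \<beta> \<alpha> tr p"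
  shows "\<exists>(C :: (('r \<times> 'n \<times> 'n) multiset \<Rightarrow> 'f) ring) \<iota> (\<phi> :: 'r \<Rightarrow> ('n \<Rightarrow> 'n \<Rightarrow> _)).
           comm_F_algebra C \<iota> \<and>
           (\<forall>x. \<phi> x \<in> cmat_carrier C) \<and> inj \<phi> \<and>
           \<phi> 1 = cmscalar C \<one>\<^bsub>C\<^esub> \<and>
           (\<forall>x y. \<phi> (x + y) = cmadd C (\<phi> x) (\<phi> y)) \<and>
           (\<forall>x y. \<phi> (x * y) = cmmul C (\<phi> x) (\<phi> y)) \<and>
           (\<forall>c x. \<phi> (\<beta> c * x) = cmmul C (cmscalar C (\<iota> c)) (\<phi> x)) \<and>
           (\<forall>x. \<phi> (tr x) = cmscalar C (cmtrace C (\<phi> x))) \<and>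
           (\<forall>a \<in> centralizer G. \<phi> (\<alpha> a) = cmof \<iota> a)"
proof -
  interpret regular_matrix_algebra "centralizer G"
    by (rule centralizer_regular_matrix_algebra[OF assms(1)])
  interpret trace_identity_algebra "centralizer G" \<beta> \<alpha> tr
    by unfold_locales (use assms in auto)
  have "\<phi> x \<in> cmat_carrier C" for x
    by (simp add: cmat_carrier_def \<phi>_def quot_carrier)
  then show ?thesis
    using comm_F_algebra_C inj_\<phi> \<phi>_one \<phi>_add \<phi>_mult \<phi>_scale \<phi>_tr \<phi>_\<alpha> by blast
qed

end
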